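(* Let $\Omega\subset\mathbb{R}^d$ be a nonempty, bounded, open set, let $0<s<1$, $1\le p<\infty$ and $\alpha,\beta\ge0$. (I) If $sp+\alpha+\beta<d-\overline{\dim}_M(\partial\Omega)$, then $W_0^{s,p;\,\alpha,\beta}(\Omega)=W^{s,p;\,\alpha,\beta}(\Omega)$. (II) If $\partial\Omega$ is $(d-sp-\alpha-\beta)$-homogeneous, $p>1$ and $sp+\alpha+\beta=\underline{\mathrm{co\,dim}}_A(\partial\Omega)$, then $W_0^{s,p;\,\alpha,\beta}(\Omega)=W^{s,p;\,\alpha,\beta}(\Omega)$. (III) If $\Omega$ is $\kappa$-plump (for some $\kappa\in(0,1)$) and $sp+\alpha+\beta>\overline{\mathrm{co\,dim}}_A(\partial\Omega)$, then $W_0^{s,p;\,\alpha,\beta}(\Omega)\ne W^{s,p;\,\alpha,\beta}(\Omega)$.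
   Context: Notation: $d_\Omega(x)=\mathrm{dist}(x,\partial\Omega)$; for $E\subset\mathbb{R}^d$ and $r>0$, $\widetilde E_r=\{x\in\mathbb{R}^d:\mathrm{dist}(x,E)\le r\}$; $|\cdot|$ of a set is Lebesgue measure. Spaces: $[f]_{W^{s,p;\,\alpha,\beta}(\Omega)}=\left(\int_\Omega\int_\Omega\frac{|f(x)-f(y)|^p}{|x-y|^{d+sp}}d_\Omega(y)^{-\alpha}d_\Omega(x)^{-\beta}\,dy\,dx\right)^{1/p}$ (symmetric under interchanging $\alpha$ and $\beta$); $W^{s,p;\,\alpha,\beta}(\Omega)=\{f\in L^p(\Omega):[f]_{W^{s,p;\,\alpha,\beta}(\Omega)}<\infty\}$ with norm $\|f\|_{L^p(\Omega)}+[f]_{W^{s,p;\,\alpha,\beta}(\Omega)}$. $W_0^{s,p;\,\alpha,\beta}(\Omega)$ is the closure of $C_c^\infty(\Omega)\cap W^{s,p;\,\alpha,\beta}(\Omega)$ in $W^{s,p;\,\alpha,\beta}(\Omega)$ with respect to this norm, where $C_c^\infty(\Omega)$ denotes smooth functions with compact support in $\Omega$. Assouad codimensions: $\underline{\mathrm{co\,dim}}_A(E)$ is the supremum of all $q\ge0$ for which there is $C=C(q)\ge1$ with $|\widetilde E_r\cap B(x,R)|\le C|B(x,R)|(r/R)^q$ for all $x\in E$, $0<r<R<\mathrm{diam}\,E$. $\overline{\mathrm{co\,dim}}_A(E)$ is the infimum of all $q\ge0$ for which there is $c=c(q)>0$ with $|\widetilde E_r\cap B(x,R)|\ge c|B(x,R)|(r/R)^q$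 for all $x\in E$, $0<r<R<\mathrm{diam}\,E$. Upper Minkowski dimension: $\overline{\dim}_M(E)=\inf\{t\ge0:\limsup_{r\to0}|\widetilde E_r|\,r^{t-d}=0\}$. Homogeneity: $E\subset\mathbb{R}^d$ is $\sigma$-homogeneous if there is a constant $L$ such that $|\{y\in\mathbb{R}^d:\mathrm{dist}(y,E)\le r,\ |x-y|\le\lambda r\}|\le L r^d\lambda^\sigma$ for all $x\in E$, $\lambda\ge1$, $r>0$. Plumpness: $E\subset\mathbb{R}^d$ is $\kappa$-plump, $\kappa\in(0,1)$, if for each $0<r<\mathrm{diam}(E)$ and each $x\in\overline E$ there is $z\in\overline B(x,r)$ with $B(z,\kappa r)\subset E$. *)

theory Defs
  imports "HOL-Analysis.Analysis"
begin

text \<open>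
  Functions on \<open>\<Omega>\<close> are represented by total functions whose values outside \<open>\<Omega>\<close> are irrelevant.
  Function spaces are sets of functions rather than of classes modulo equality almost everywhere;
  membership in each of the spaces \<open>Lp_space\<close>, \<open>W_space\<close>, \<open>W0_space\<close> is invariant under changes on
  null sets.
\<close>

definition ennroot :: "real \<Rightarrow> ennreal \<Rightarrow> ennreal" where
  "ennroot p x = (if x = \<infinity> then \<infinity> else ennreal (enn2real x powr (1 / p)))"

definition bdist :: "'a::euclidean_space set \<Rightarrow> 'a \<Rightarrow> real" where
  "bdist \<Omega> x = infdist x (frontier \<Omega>)"

definition Lp_norm :: "real \<Rightarrow> 'a::euclidean_space set \<Rightarrow> ('a \<Rightarrow> real) \<Rightarrow> ennreal" where
  "Lp_norm p \<Omega> f = ennroot p (\<integral>\<^sup>+x. ennreal (\<bar>f x\<bar> powr p) \<partial>lebesgue_on \<Omega>)"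

definition Lp_space :: "real \<Rightarrow> 'a::euclidean_space set \<Rightarrow> ('a \<Rightarrow> real) set" where
  "Lp_space p \<Omega> = {f \<in> borel_measurable (lebesgue_on \<Omega>). Lp_norm p \<Omega> f < \<infinity>}"

text \<open>On the diagonal the integrand below is \<open>0\<close> (division by zero), which affects only a null set.\<close>

definition W_seminorm ::
  "real \<Rightarrow> real \<Rightarrow> real \<Rightarrow> real \<Rightarrow> 'a::euclidean_space set \<Rightarrow> ('a \<Rightarrow> real) \<Rightarrow> ennreal" where
  "W_seminorm s p \<alpha> \<beta> \<Omega> f = ennroot p
     (\<integral>\<^sup>+x. (\<integral>\<^sup>+y. ennreal (\<bar>f x - f y\<bar> powr p / dist x y powr (real DIM('a) + s * p)
          * bdist \<Omega> y powr (- \<alpha>) * bdist \<Omega> x powr (- \<beta>)) \<partial>lebesgue_on \<Omega>) \<partial>lebesgue_on \<Omega>)"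

definition W_space ::
  "real \<Rightarrow> real \<Rightarrow> real \<Rightarrow> real \<Rightarrow> 'a::euclidean_space set \<Rightarrow> ('a \<Rightarrow> real) set" where
  "W_space s p \<alpha> \<beta> \<Omega> = {f \<in> Lp_space p \<Omega>. W_seminorm s p \<alpha> \<beta> \<Omega> f < \<infinity>}"

definition W_norm ::
  "real \<Rightarrow> real \<Rightarrow> real \<Rightarrow> real \<Rightarrow> 'a::euclidean_space set \<Rightarrow> ('a \<Rightarrow> real) \<Rightarrow> ennreal" where
  "W_norm s p \<alpha> \<beta> \<Omega> f = Lp_norm p \<Omega> f + W_seminorm s p \<alpha> \<beta> \<Omega> f"

primrec Ck :: "nat \<Rightarrow> ('a::euclidean_space \<Rightarrow> real) \<Rightarrow> bool" where
  "Ck 0 f \<longleftrightarrow> continuous_on UNIV f"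
| "Ck (Suc k) f \<longleftrightarrow>
     (\<forall>x. f differentiable (at x)) \<and> (\<forall>v. Ck k (\<lambda>x. frechet_derivative f (at x) v))"

text \<open>Elements of \<open>C\<^sub>c\<^sup>\<infinity>(\<Omega>)\<close> are taken to be extended by zero to the whole space.\<close>

definition Cc_smooth :: "'a::euclidean_space set \<Rightarrow> ('a \<Rightarrow> real) set" where
  "Cc_smooth \<Omega> = {f. (\<forall>k. Ck k f) \<and>
     compact (closure {x. f x \<noteq> 0}) \<and> closure {x. f x \<noteq> 0} \<subseteq> \<Omega>}"

definition W0_space ::
  "real \<Rightarrow> real \<Rightarrow> real \<Rightarrow> real \<Rightarrow> 'a::euclidean_space set \<Rightarrow> ('a \<Rightarrow> real) set" where
  "W0_space s p \<alpha> \<beta> \<Omega> = {f \<in> W_space s p \<alpha> \<beta> \<Omega>. \<forall>\<epsilon>>0.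
     \<exists>\<phi> \<in> Cc_smooth \<Omega> \<inter> W_space s p \<alpha> \<beta> \<Omega>. W_norm s p \<alpha> \<beta> \<Omega> (\<lambda>x. f x - \<phi> x) < ennreal \<epsilon>}"

text \<open>
  The notions below are meant for nonempty \<open>E\<close>, and those mentioning \<open>diameter\<close> for bounded \<open>E\<close>:
  in the library \<open>infdist x {} = 0\<close>, and \<open>diameter\<close> is real-valued and hence meaningless on
  unbounded sets.
\<close>

definition thickening :: "'a::euclidean_space set \<Rightarrow> real \<Rightarrow> 'a set" where
  "thickening E r = {x. infdist x E \<le> r}"

text \<open>The dimensions are extended reals, so that suprema and infima over sets of exponents need no
  boundedness or nonemptiness convention.\<close>

definition lower_assouad_codim :: "'a::euclidean_space set \<Rightarrow> ereal" where
  "lower_assouad_codim E = Sup {ereal q | q. 0 \<le> q \<and>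
     (\<exists>C\<ge>1. \<forall>x\<in>E. \<forall>r R. 0 < r \<and> r < R \<and> R < diameter E \<longrightarrow>
        measure lebesgue (thickening E r \<inter> ball x R)
          \<le> C * measure lebesgue (ball x R) * (r / R) powr q)}"

definition upper_assouad_codim :: "'a::euclidean_space set \<Rightarrow> ereal" where
  "upper_assouad_codim E = Inf {ereal q | q. 0 \<le> q \<and>
     (\<exists>c>0. \<forall>x\<in>E. \<forall>r R. 0 < r \<and> r < R \<and> R < diameter E \<longrightarrow>
        measure lebesgue (thickening E r \<inter> ball x R)
          \<ge> c * measure lebesgue (ball x R) * (r / R) powr q)}"

definition upper_minkowski_dim :: "'a::euclidean_space set \<Rightarrow> ereal" where
  "upper_minkowski_dim E = Inf {ereal t | t. 0 \<le> t \<and>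
     Limsup (at_right 0) (\<lambda>r. emeasure lebesgue (thickening E r)
        * ennreal (r powr (t - real DIM('a)))) = 0}"

definition homogeneous :: "real \<Rightarrow> 'a::euclidean_space set \<Rightarrow> bool" where
  "homogeneous \<sigma> E \<longleftrightarrow> (\<exists>L. \<forall>x\<in>E. \<forall>\<mu>\<ge>1. \<forall>r>0.
     measure lebesgue {y. infdist y E \<le> r \<and> dist x y \<le> \<mu> * r}
       \<le> L * r ^ DIM('a) * \<mu> powr \<sigma>)"

definition plump :: "real \<Rightarrow> 'a::euclidean_space set \<Rightarrow> bool" where
  "plump \<kappa> E \<longleftrightarrow> 0 < \<kappa> \<and> \<kappa> < 1 \<and>
     (\<forall>r x. 0 < r \<and> r < diameter E \<and> x \<in> closure E \<longrightarrow>
        (\<exists>z \<in> cball x r. ball z (\<kappa> * r) \<subseteq> E))"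

end

theory Submission
  imports Defs
begin

text \<open>
  Write \<open>\<gamma> = s * p + \<alpha> + \<beta>\<close>. In (I) and (II) all that matters about the boundary is an estimate
  \<open>|{x \<in> \<Omega>. d(x) < r}| \<le> \<eta> * r powr \<gamma>\<close> for small \<open>r\<close>, with \<open>\<eta>\<close> arbitrarily small in (I) and with
  some \<open>\<eta>\<close> in (II). A bounded function is multiplied by the logarithmic cutoffs
  \<open>w\<^sub>N = max 0 (min 1 (2 + log 2 d / N))\<close>. Each of the about \<open>N\<close> dyadic layers between
  \<open>d = 4 powr -N\<close> and \<open>d = 2 powr -N\<close> contributes at most a constant times \<open>\<eta> * N powr -p\<close> to the
  \<open>p\<close>-th power of the seminorm of \<open>w\<^sub>N\<close>, which is therefore \<open>O(\<eta> * N powr (1 - p))\<close> and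
  tends to zero. The truncated function has compact support in \<open>\<Omega>\<close> and is mollified; near the
  diagonal Jensen's inequality bounds the energy of the mollified function by that of the
  original one, and away from the diagonal convergence in \<open>L\<^sup>1\<close> suffices.

  In (III) the constant function 1 is not approximable. Plumpness gives, at each boundary point and
  each dyadic scale, a ball inside \<open>\<Omega>\<close>. For a test function close to 1 the averages over these balls
  go from at least 1/2 to 0, so at some scale \<open>r\<close> they jump, and the energy near the point
  at this scale is at least \<open>c * r powr t\<close>, with \<open>t\<close> smaller than \<open>d - q\<close> for an exponent \<open>q < \<gamma>\<close>
  admissible for the upper Assouad codimension. Since the
  boundary contains many separated points at every scale, these local bounds add up, by induction
  on the scale, to a lower bound that does not depend on the test function.
\<close>

text \<open>The weights \<open>dw powr - \<alpha>\<close> and \<open>dw powr - \<beta>\<close> blow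
  up at the boundary, so convolution cannot be applied to a general function of the space. It is
  applied after the cutoff: the weights are then bounded on the close pairs that matter, and on
  distant pairs one variable stays in the support while the other sees only a weight of finite
  integral. A cutoff across a single dyadic layer would have energy of order \<eta>, enough for (I)
  but not for (II); spreading the transition over many layers gains a negative power of their number
  exactly when \<open>p > 1\<close>. All estimates concern p-th powers of norms, where the triangle
  inequality costs a factor \<open>2 powr p\<close>, and Borel representatives, for which Tonelli's
  theorem is available. In (III) the scale of the jump depends on the point and on the test function
  and cannot be prescribed. Letting the required jump decay geometrically costs a small power of the
  scale, paid for by the gap between q and \<gamma>. The induction over scales takes the place of a
  covering or Hausdorff content argument.\<close>

lemma abs_add_powr_le:
  fixes a b p :: real
  assumes "0 \<le> p"
  shows "\<bar>a + b\<bar> powr p \<le> 2 powr p * (\<bar>a\<bar> powr p + \<bar>b\<bar> powr p)"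
proof -
  have "\<bar>a + b\<bar> powr p \<le> (2 * max \<bar>a\<bar> \<bar>b\<bar>) powr p"
    using assms by (intro powr_mono2) auto
  also have "\<dots> = 2 powr p * (max \<bar>a\<bar> \<bar>b\<bar>) powr p"
    by (simp add: powr_mult)
  also have "(max \<bar>a\<bar> \<bar>b\<bar>) powr p \<le> \<bar>a\<bar> powr p + \<bar>b\<bar> powr p"
    by (auto simp: max_def)
  finally show ?thesis by simp
qed

text \<open>The graph of a convex power lies above its tangent at \<open>b\<close>. Convexity is
  obtained from the second derivative on the open half line, so \<open>a = 0\<close> is treated by
  hand.\<close>

lemma powr_ge_tangent:
  fixes a b p :: real
  assumes "1 \<le> p" "0 \<le> a" "0 < b"
  shows "b powr p + p * b powr (p - 1) * (a - b) \<le> a powr p"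
proof (cases "a = 0")
  case True
  have "b powr (p - 1) * b = b powr p"
    using assms by (simp add: powr_diff)
  then have "b powr p + p * b powr (p - 1) * (a - b) = (1 - p) * b powr p"
    using True by (simp add: algebra_simps)
  also have "\<dots> \<le> 0" using assms by (simp add: mult_nonpos_nonneg)
  finally show ?thesis using True assms by simp
next
  case False
  have "convex_on {0<..} (\<lambda>x. x powr p)"
  proof (rule f''_ge0_imp_convex)
    show "convex {0::real<..}" by simp
    show "((\<lambda>x. x powr p) has_real_derivative p * x powr (p - 1)) (at x)" if "x \<in> {0<..}" for x
      using that by (auto intro!: derivative_eq_intros)
    show "((\<lambda>x. p * x powr (p - 1)) has_real_derivative p * ((p - 1) * x powr (p - 1 - 1))) (at x)"
      if "x \<in> {0<..}" for x
      using that by (auto intro!: derivative_eq_intros)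
    show "0 \<le> p * ((p - 1) * x powr (p - 1 - 1))" if "x \<in> {0<..}" for x
      using assms by simp
  qed
  then have "p * b powr (p - 1) * (a - b) \<le> a powr p - b powr p"
    using assms False
    by (intro convex_on_imp_above_tangent[where A = "{0<..}"])
       (auto intro!: derivative_eq_intros simp: interior_open)
  then show ?thesis by simp
qed

lemma integrable_mult_bounded:
  fixes w f :: "'b \<Rightarrow> real"
  assumes w: "integrable M w" and f: "f \<in> borel_measurable M" and C: "\<And>x. \<bar>f x\<bar> \<le> C"
  shows "integrable M (\<lambda>x. w x * f x)"
proof (rule Bochner_Integration.integrable_bound[OF integrable_mult_left[OF w, of C]])
  show "(\<lambda>x. w x * f x) \<in> borel_measurable M" using w f by measurable
  show "AE x in M. norm (w x * f x) \<le> norm (w x * C)"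
  proof (rule AE_I2)
    fix x
    have "\<bar>f x\<bar> \<le> \<bar>C\<bar>" using C[of x] by linarith
    then show "norm (w x * f x) \<le> norm (w x * C)" by (simp add: abs_mult mult_left_mono)
  qed
qed

text \<open>Integrate the tangent inequality at the weighted mean \<open>b\<close> of the absolute
  values: the linear term integrates to zero. Boundedness of \<open>h\<close> keeps every integral
  finite; the conclusion is in \<open>ennreal\<close> for use under iterated integrals.\<close>

lemma jensen_powr:
  fixes w h :: "'b \<Rightarrow> real"
  assumes p: "1 \<le> p" and w0: "\<And>x. 0 \<le> w x" and w: "integrable M w" "(\<integral>x. w x \<partial>M) = 1"
    and hm: "h \<in> borel_measurable M" and hb: "\<And>x. \<bar>h x\<bar> \<le> B"
  shows "ennreal (\<bar>\<integral>x. w x * h x \<partial>M\<bar> powr p) \<le> (\<integral>\<^sup>+x. ennreal (w x) * ennreal (\<bar>h x\<bar> powr p) \<partial>M)"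
proof -
  have B0: "0 \<le> B" using hb[of undefined] by linarith
  define b where "b = (\<integral>x. w x * \<bar>h x\<bar> \<partial>M)"
  have i1: "integrable M (\<lambda>x. w x * \<bar>h x\<bar>)" using hm hb by (intro integrable_mult_bounded[OF w(1)]) auto
  have i2: "integrable M (\<lambda>x. w x * \<bar>h x\<bar> powr p)"
    using hm hb p B0 by (intro integrable_mult_bounded[OF w(1), where C = "B powr p"]) (auto intro!: powr_mono2)
  have b0: "0 \<le> b" unfolding b_def using w0 by (intro Bochner_Integration.integral_nonneg) auto
  have le: "\<bar>\<integral>x. w x * h x \<partial>M\<bar> \<le> b"
  proof -
    have "\<bar>\<integral>x. w x * h x \<partial>M\<bar> \<le> (\<integral>x. \<bar>w x * h x\<bar> \<partial>M)" by (rule integral_abs_bound)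
    also have "\<dots> = b" unfolding b_def using w0 by (simp add: abs_mult)
    finally show ?thesis .
  qed
  have bp: "b powr p \<le> (\<integral>x. w x * \<bar>h x\<bar> powr p \<partial>M)"
  proof (cases "b = 0")
    case True then show ?thesis using p w0 by (simp add: integral_nonneg)
  next
    case False
    with b0 have b1: "0 < b" by simp
    have "b powr p = b powr p * 1 + p * b powr (p - 1) * (b - b * 1)" by simp
    also have "\<dots> = (\<integral>x. b powr p * w x + p * b powr (p - 1) * (w x * \<bar>h x\<bar> - b * w x) \<partial>M)"
      using w i1 by (simp add: b_def)
    also have "\<dots> \<le> (\<integral>x. w x * \<bar>h x\<bar> powr p \<partial>M)"
    proof (rule integral_mono)
      show "integrable M (\<lambda>x. b powr p * w x + p * b powr (p - 1) * (w x * \<bar>h x\<bar> - b * w x))"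
        using w i1 by auto
      show "integrable M (\<lambda>x. w x * \<bar>h x\<bar> powr p)" by (rule i2)
      fix x
      have "w x * (b powr p + p * b powr (p - 1) * (\<bar>h x\<bar> - b)) \<le> w x * \<bar>h x\<bar> powr p"
        using w0 p b1 by (intro mult_left_mono powr_ge_tangent) auto
      then show "b powr p * w x + p * b powr (p - 1) * (w x * \<bar>h x\<bar> - b * w x) \<le> w x * \<bar>h x\<bar> powr p"
        by (simp add: algebra_simps)
    qed
    finally show ?thesis .
  qed
  have "\<bar>\<integral>x. w x * h x \<partial>M\<bar> powr p \<le> b powr p" using le p by (intro powr_mono2) auto
  also note bp
  finally have "ennreal (\<bar>\<integral>x. w x * h x \<partial>M\<bar> powr p) \<le> ennreal (\<integral>x. w x * \<bar>h x\<bar> powr p \<partial>M)"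
    by (rule ennreal_leI)
  also have "\<dots> = (\<integral>\<^sup>+x. ennreal (w x * \<bar>h x\<bar> powr p) \<partial>M)"
    using i2 w0 by (intro nn_integral_eq_integral[symmetric]) auto
  also have "\<dots> = (\<integral>\<^sup>+x. ennreal (w x) * ennreal (\<bar>h x\<bar> powr p) \<partial>M)"
    using w0 by (simp add: ennreal_mult)
  finally show ?thesis .
qed

section \<open>Sums over dyadic layers\<close>

text \<open>Only one layer per point has to dominate \<open>F\<close>, so the sets
  \<open>A k\<close> may overlap; balls and sublevel sets can serve in place of annuli.\<close>

lemma nn_integral_le_suminf_layers:
  fixes F :: "'b \<Rightarrow> ennreal"
  assumes A: "\<And>k::nat. A k \<in> sets M" and cover: "\<And>x. x \<in> space M \<Longrightarrow> F x \<noteq> 0 \<Longrightarrow> \<exists>k. x \<in> A k \<and> F x \<le> c k"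
  shows "(\<integral>\<^sup>+x. F x \<partial>M) \<le> (\<Sum>k. c k * emeasure M (A k))"
proof -
  have "(\<integral>\<^sup>+x. F x \<partial>M) \<le> (\<integral>\<^sup>+x. (\<Sum>k. c k * indicator (A k) x) \<partial>M)"
  proof (rule nn_integral_mono)
    fix x assume x: "x \<in> space M"
    show "F x \<le> (\<Sum>k. c k * indicator (A k) x)"
    proof (cases "F x = 0")
      case False
      then obtain k where k: "x \<in> A k" "F x \<le> c k" using cover x by blast
      have "F x \<le> c k * indicator (A k) x" using k by simp
      also have "\<dots> = (\<Sum>j\<in>{k}. c j * indicator (A j) x)" by (subst sum.insert) auto
      also have "\<dots> \<le> (\<Sum>k. c k * indicator (A k) x)" by (rule sum_le_suminf) auto
      finally show ?thesis .
    qed simp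
  qed
  also have "\<dots> = (\<Sum>k. \<integral>\<^sup>+x. c k * indicator (A k) x \<partial>M)"
    using A by (intro nn_integral_suminf) auto
  also have "\<dots> = (\<Sum>k. c k * emeasure M (A k))"
    using A by (simp add: nn_integral_cmult_indicator)
  finally show ?thesis .
qed

lemma suminf_ennreal_geometric_le:
  fixes a r :: real
  assumes r: "0 \<le> r" "r < 1" and a: "0 \<le> a" and F: "\<And>k. F k \<le> ennreal (a * r ^ k)"
  shows "(\<Sum>k. F k) \<le> ennreal (a / (1 - r))"
proof -
  have "(\<Sum>k. F k) \<le> (\<Sum>k. ennreal (a * r ^ k))"
    by (intro suminf_le F) auto
  also have "\<dots> = ennreal (\<Sum>k. a * r ^ k)"
    using r a by (intro suminf_ennreal2) (auto intro!: summable_mult summable_geometric)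
  also have "(\<Sum>k. a * r ^ k) = a / (1 - r)"
    using r by (simp add: suminf_mult suminf_geometric summable_geometric divide_inverse)
  finally show ?thesis .
qed

lemma ex_dyadic_bracket:
  fixes t :: real
  assumes "0 < t" "t < 1"
  shows "\<exists>k::nat. 2 powr - real (Suc k) \<le> t \<and> t < 2 powr - real k"
proof -
  define P where "P n \<longleftrightarrow> 2 powr - real n \<le> t" for n :: nat
  obtain m where m: "(1/2) ^ m < t" using real_arch_pow_inv[of t "1/2"] assms by auto
  have e: "2 powr - real n = (1/2) ^ n" for n :: nat
    by (simp add: powr_minus powr_realpow power_one_over inverse_eq_divide)
  have "P m" using m by (simp add: P_def e)
  then have L: "P (LEAST n. P n)" by (rule LeastI)
  have "(LEAST n. P n) \<noteq> 0"
  proof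
    assume "(LEAST n. P n) = 0" then show False using L assms by (simp add: P_def)
  qed
  then obtain k where k: "(LEAST n. P n) = Suc k" using not0_implies_Suc by blast
  have "\<not> P k" using not_less_Least[of k P] k by simp
  with L k show ?thesis unfolding P_def by (intro exI[of _ k]) auto
qed

lemma ex_dyadic_bracket_up:
  fixes t :: real
  assumes "1 \<le> t"
  shows "\<exists>k::nat. 2 powr real k \<le> t \<and> t < 2 powr real (Suc k)"
proof -
  obtain m where m: "t < 2 ^ m" using real_arch_pow[of 2 t] by auto
  have L: "t < 2 ^ (LEAST n. t < 2 ^ n)" using m by (rule LeastI)
  have "(LEAST n. t < 2 ^ n) \<noteq> 0"
  proof
    assume "(LEAST n. t < 2 ^ n) = 0" then show False using L assms by simp
  qed
  then obtain k where k: "(LEAST n. t < 2 ^ n) = Suc k" using not0_implies_Suc by blast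
  have "\<not> t < 2 ^ k" using not_less_Least[of k "\<lambda>n. t < 2 ^ n"] k by simp
  with L k show ?thesis by (intro exI[of _ k]) (auto simp: powr_realpow powr_add)
qed

section \<open>Integrals of powers of the distance\<close>

text \<open>Stands for the polar-coordinate integral of \<open>r powr (a - 1)\<close>, computed on
  dyadic shells: the first factor is the variation of the integrand over a shell, the second comes
  from its volume, the denominator sums a geometric series.\<close>

definition inner_const :: "nat \<Rightarrow> real \<Rightarrow> real" where
  "inner_const n a = 2 powr \<bar>a - n\<bar> * unit_ball_vol n / (1 - 2 powr (- a))"

lemma inner_const_nonneg: "0 < a \<Longrightarrow> 0 \<le> inner_const n a"
  unfolding inner_const_def using powr_mono[of "-a" 0 "2::real"] by (intro divide_nonneg_nonneg mult_nonneg_nonneg) auto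

lemma nn_integral_inner_powr_le:
  fixes x :: "'a::euclidean_space"
  assumes a: "0 < a" and R: "0 < R"
  shows "(\<integral>\<^sup>+y. ennreal (dist x y powr (a - real DIM('a))) * indicator (ball x R) y \<partial>lborel)
    \<le> ennreal (inner_const DIM('a) a * R powr a)"
proof -
  let ?d = "real DIM('a)"
  let ?v = "unit_ball_vol ?d"
  define A where "A k = ball x (R * 2 powr - real k)" for k :: nat
  define c where "c k = ennreal (2 powr \<bar>a - ?d\<bar> * (R * 2 powr - real k) powr (a - ?d))" for k :: nat
  have "(\<integral>\<^sup>+y. ennreal (dist x y powr (a - ?d)) * indicator (ball x R) y \<partial>lborel) \<le> (\<Sum>k. c k * emeasure lborel (A k))"
  proof (rule nn_integral_le_suminf_layers)
    show "A k \<in> sets lborel" for k unfolding A_def by simp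
    fix y assume "ennreal (dist x y powr (a - ?d)) * indicator (ball x R) y \<noteq> 0"
    \<comment> \<open>The centre contributes nothing, as \<open>0 powr e = 0\<close> for every
      exponent.\<close>
    then have y: "dist x y \<noteq> 0" "dist x y < R" by (auto simp: indicator_def split: if_splits)
    define t where "t = dist x y / R"
    have "0 < t" "t < 1" using y R by (auto simp: t_def)
    then obtain k where k: "2 powr - real (Suc k) \<le> t" "t < 2 powr - real k" using ex_dyadic_bracket by blast
    have d: "dist x y = R * t" using R by (simp add: t_def)
    \<comment> \<open>The exponent may have either sign, and the sign decides which end of the
      dyadic bracket bounds the power; the factor on the right covers both cases.\<close>
    have "t powr (a - ?d) \<le> 2 powr \<bar>a - ?d\<bar> * (2 powr - real k) powr (a - ?d)"
    proof (cases "a - ?d \<ge> 0")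
      case True
      then have "t powr (a - ?d) \<le> 1 * (2 powr - real k) powr (a - ?d)"
        using k \<open>0 < t\<close> by (auto intro!: powr_mono2)
      also have "\<dots> \<le> 2 powr \<bar>a - ?d\<bar> * (2 powr - real k) powr (a - ?d)"
        by (intro mult_right_mono ge_one_powr_ge_zero) auto
      finally show ?thesis .
    next
      case False
      then have "t powr (a - ?d) \<le> (2 powr - real (Suc k)) powr (a - ?d)"
        using k \<open>0 < t\<close> by (intro powr_mono2') auto
      also have "2 powr - real (Suc k) = 2 powr (-1) * 2 powr - real k"
        by (subst powr_add[symmetric]) (simp add: algebra_simps)
      also have "\<dots> powr (a - ?d) = 2 powr \<bar>a - ?d\<bar> * (2 powr - real k) powr (a - ?d)"
        using False by (subst powr_mult) (simp only: powr_powr abs_of_neg not_le, simp add: algebra_simps)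
      finally show ?thesis .
    qed
    then have "R powr (a - ?d) * t powr (a - ?d) \<le> R powr (a - ?d) * (2 powr \<bar>a - ?d\<bar> * (2 powr - real k) powr (a - ?d))"
      by (intro mult_left_mono) auto
    then have "dist x y powr (a - ?d) \<le> 2 powr \<bar>a - ?d\<bar> * (R * 2 powr - real k) powr (a - ?d)"
      using R \<open>0 < t\<close> by (simp add: d powr_mult mult_ac)
    then show "\<exists>k. y \<in> A k \<and> ennreal (dist x y powr (a - ?d)) * indicator (ball x R) y \<le> c k"
      using k R by (intro exI[of _ k]) (auto simp: A_def c_def d y indicator_def intro!: ennreal_leI mult_strict_left_mono)
  qed
  also have "\<dots> \<le> ennreal ((2 powr \<bar>a - ?d\<bar> * ?v * R powr a) / (1 - 2 powr (- a)))"
  proof (rule suminf_ennreal_geometric_le)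
    show "2 powr (- a) < 1" using a powr_less_mono[of "-a" 0 "2::real"] by simp
    fix k :: nat
    have e: "(2 powr (- a)) ^ k = (2 powr - real k) powr a"
      by (simp add: powr_powr powr_realpow[symmetric] mult.commute)
    have "(R * 2 powr - real k) powr (a - ?d) * (R * 2 powr - real k) ^ DIM('a) = (R * 2 powr - real k) powr a"
      using R by (simp add: powr_diff powr_realpow)
    then have "c k * emeasure lborel (A k) = ennreal (2 powr \<bar>a - ?d\<bar> * ?v * (R * 2 powr - real k) powr a)"
      using R by (simp add: c_def A_def emeasure_ball ennreal_mult[symmetric] mult_ac)
    also have "(R * 2 powr - real k) powr a = R powr a * (2 powr (- a)) ^ k"
      using R by (simp add: powr_mult e)
    finally show "c k * emeasure lborel (A k) \<le> ennreal (2 powr \<bar>a - ?d\<bar> * ?v * R powr a * (2 powr (- a)) ^ k)"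
      by (simp add: mult_ac)
  qed auto
  also have "2 powr \<bar>a - ?d\<bar> * ?v * R powr a / (1 - 2 powr (- a)) = inner_const DIM('a) a * R powr a"
    by (simp add: inner_const_def)
  finally show ?thesis .
qed

text \<open>The factor \<open>2 ^ n\<close> appears because shell \<open>k\<close> is enclosed in a
  ball of twice its inner radius.\<close>

definition outer_const :: "nat \<Rightarrow> real \<Rightarrow> real" where
  "outer_const n a = 2 ^ n * unit_ball_vol n / (1 - 2 powr (- a))"

lemma outer_const_nonneg: "0 < a \<Longrightarrow> 0 \<le> outer_const n a"
  unfolding outer_const_def using powr_mono[of "-a" 0 "2::real"] by (intro divide_nonneg_nonneg mult_nonneg_nonneg) auto

lemma nn_integral_outer_powr_le:
  fixes x :: "'a::euclidean_space"
  assumes a: "0 < a" and R: "0 < R"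
  shows "(\<integral>\<^sup>+y. ennreal (dist x y powr (- a - real DIM('a))) * indicator (- ball x R) y \<partial>lborel)
    \<le> ennreal (outer_const DIM('a) a * R powr (- a))"
proof -
  let ?d = "real DIM('a)"
  let ?v = "unit_ball_vol ?d"
  define A where "A k = ball x (2 * R * 2 powr real k)" for k :: nat
  define c where "c k = ennreal ((R * 2 powr real k) powr (- a - ?d))" for k :: nat
  have "(\<integral>\<^sup>+y. ennreal (dist x y powr (- a - ?d)) * indicator (- ball x R) y \<partial>lborel) \<le> (\<Sum>k. c k * emeasure lborel (A k))"
  proof (rule nn_integral_le_suminf_layers)
    show "A k \<in> sets lborel" for k unfolding A_def by simp
    fix y assume "ennreal (dist x y powr (- a - ?d)) * indicator (- ball x R) y \<noteq> 0"
    then have y: "dist x y \<ge> R" by (auto simp: indicator_def split: if_splits)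
    define t where "t = dist x y / R"
    have "1 \<le> t" using y R by (auto simp: t_def)
    then obtain k where k: "2 powr real k \<le> t" "t < 2 powr real (Suc k)" using ex_dyadic_bracket_up by blast
    have d: "dist x y = R * t" using R by (simp add: t_def)
    have "dist x y powr (- a - ?d) \<le> (R * 2 powr real k) powr (- a - ?d)"
      using k R a unfolding d by (intro powr_mono2') auto
    moreover have "dist x y < 2 * R * 2 powr real k"
      using k R by (simp add: d powr_add)
    ultimately show "\<exists>k. y \<in> A k \<and> ennreal (dist x y powr (- a - ?d)) * indicator (- ball x R) y \<le> c k"
      by (intro exI[of _ k]) (auto simp: A_def c_def indicator_def intro!: ennreal_leI)
  qed
  also have "\<dots> \<le> ennreal ((2 ^ DIM('a) * ?v * R powr (- a)) / (1 - 2 powr (- a)))"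
  proof (rule suminf_ennreal_geometric_le)
    show "2 powr (- a) < 1" using a powr_less_mono[of "-a" 0 "2::real"] by simp
    fix k :: nat
    have e: "(2 powr (- a)) ^ k = (2 powr real k) powr (- a)"
      by (simp add: powr_powr powr_realpow[symmetric] mult.commute)
    have "(R * 2 powr real k) powr (- a - ?d) * (R * 2 powr real k) ^ DIM('a) = (R * 2 powr real k) powr (- a)"
      using R by (simp add: powr_diff powr_realpow)
    moreover have "(2 * R * 2 powr real k) ^ DIM('a) = 2 ^ DIM('a) * (R * 2 powr real k) ^ DIM('a)"
      by (simp add: power_mult_distrib)
    ultimately have "c k * emeasure lborel (A k) = ennreal (2 ^ DIM('a) * ?v * (R * 2 powr real k) powr (- a))"
      using R by (simp add: c_def A_def emeasure_ball ennreal_mult[symmetric] mult_ac)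
    also have "(R * 2 powr real k) powr (- a) = R powr (- a) * (2 powr (- a)) ^ k"
      using R by (simp add: powr_mult e)
    finally show "c k * emeasure lborel (A k) \<le> ennreal (2 ^ DIM('a) * ?v * R powr (- a) * (2 powr (- a)) ^ k)"
      by (simp add: mult_ac)
  qed auto
  also have "2 ^ DIM('a) * ?v * R powr (- a) / (1 - 2 powr (- a)) = outer_const DIM('a) a * R powr (- a)"
    by (simp add: outer_const_def)
  finally show ?thesis .
qed

subsection \<open>Smooth functions and convolution\<close>

text \<open>\<open>Ck\<close> refers to the chosen \<open>frechet_derivative\<close>; uniqueness of
  the derivative lets any explicit formula take its place.\<close>

lemma Ck_SucI:
  assumes "\<And>x. (f has_derivative F x) (at x)" and "\<And>v. Ck k (\<lambda>x. F x v)"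
  shows "Ck (Suc k) f"
proof -
  have "frechet_derivative f (at x) = F x" for x
    using assms(1) frechet_derivative_at by metis
  then show ?thesis using assms by (auto simp: differentiable_def)
qed

text \<open>The levels of \<open>Ck\<close> are not nested by definition: level \<open>Suc k\<close>
  speaks of differentiability and of the derivatives, and continuity of \<open>f\<close> itself has
  to be deduced.\<close>

lemma Ck_SucD: "Ck (Suc k) f \<Longrightarrow> Ck k f"
proof (induction k arbitrary: f)
  case 0
  then show ?case
    by (auto simp: continuous_on_eq_continuous_at intro!: differentiable_imp_continuous_within)
next
  case (Suc k)
  show ?case unfolding Ck.simps(2)[of k]
  proof safe
    show "f differentiable (at x)" for x using Suc.prems by auto
    show "Ck k (\<lambda>x. frechet_derivative f (at x) v)" for v
      by (rule Suc.IH) (use Suc.prems in \<open>simp add: Ck.simps(2)[of "Suc k"] del: Ck.simps\<close>)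
  qed
qed

lemma Ck_Suc_has_derivative:
  "Ck (Suc k) f \<Longrightarrow> (f has_derivative frechet_derivative f (at x)) (at x)"
  using frechet_derivative_works by auto

lemma Ck_const: "Ck k (\<lambda>x. c)"
proof (induction k arbitrary: c)
  case (Suc k)
  show ?case by (rule Ck_SucI[where F = "\<lambda>x v. 0"]) (auto intro: Suc)
qed simp

lemma Ck_add: "Ck k f \<Longrightarrow> Ck k g \<Longrightarrow> Ck k (\<lambda>x. f x + g x)"
proof (induction k arbitrary: f g)
  case (Suc k)
  show ?case
  proof (rule Ck_SucI)
    show "((\<lambda>x. f x + g x) has_derivative (\<lambda>v. frechet_derivative f (at x) v + frechet_derivative g (at x) v)) (at x)" for x
      by (intro has_derivative_add Suc.prems[THEN Ck_Suc_has_derivative])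
    show "Ck k (\<lambda>x. frechet_derivative f (at x) v + frechet_derivative g (at x) v)" for v
      using Suc.prems by (intro Suc.IH) auto
  qed
qed (auto intro: continuous_intros)

lemma Ck_mult: "Ck k f \<Longrightarrow> Ck k g \<Longrightarrow> Ck k (\<lambda>x. f x * g x)"
proof (induction k arbitrary: f g)
  case (Suc k)
  show ?case
  proof (rule Ck_SucI)
    show "((\<lambda>x. f x * g x) has_derivative (\<lambda>v. f x * frechet_derivative g (at x) v + frechet_derivative f (at x) v * g x)) (at x)" for x
      by (intro has_derivative_mult Suc.prems[THEN Ck_Suc_has_derivative])
    show "Ck k (\<lambda>x. f x * frechet_derivative g (at x) v + frechet_derivative f (at x) v * g x)" for v
      using Suc.prems Suc.prems[THEN Ck_SucD] by (intro Ck_add Suc.IH) auto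
  qed
qed (auto intro: continuous_intros)

lemma Ck_inner: "Ck k (\<lambda>x. x \<bullet> a)"
proof (cases k)
  case (Suc n)
  show ?thesis unfolding Suc
    by (rule Ck_SucI[where F = "\<lambda>x v. v \<bullet> a"]) (auto intro!: derivative_eq_intros Ck_const)
qed (auto intro: continuous_intros)

text \<open>The functions \<open>flat_exp m\<close> are closed under differentiation up to linear combinations.\<close>

definition flat_exp :: "nat \<Rightarrow> real \<Rightarrow> real" where
  "flat_exp m t = (if 0 < t then inverse t ^ m * exp (- inverse t) else 0)"

text \<open>Substituting \<open>inverse t\<close> on the right of 0 gives a power divided by an
  exponential at infinity.\<close>

lemma flat_exp_tendsto_0: "(flat_exp m \<longlongrightarrow> 0) (at 0)"
proof -
  have "((\<lambda>t. inverse t ^ m / exp (inverse t)) \<longlongrightarrow> (0::real)) (at_right 0)"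
    by (rule filterlim_compose[OF tendsto_power_div_exp_0 filterlim_inverse_at_top_right])
  then have "(flat_exp m \<longlongrightarrow> 0) (at_right 0)"
    by (rule Lim_transform_eventually) (auto simp: eventually_at_filter flat_exp_def exp_minus divide_inverse)
  moreover have "(flat_exp m \<longlongrightarrow> 0) (at_left 0)"
    by (rule Lim_transform_eventually[OF tendsto_const]) (auto simp: eventually_at_filter flat_exp_def)
  ultimately show ?thesis by (simp add: filterlim_split_at)
qed

lemma has_real_derivative_flat_exp:
  "(flat_exp m has_real_derivative (flat_exp (m + 2) t - real m * flat_exp (m + 1) t)) (at t)"
proof -
  consider "t < 0" | "t = 0" | "0 < t" by linarith
  then show ?thesis
  proof cases
    case 1
    have "((\<lambda>_. 0) has_real_derivative 0) (at t)" by simp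
    then have "(flat_exp m has_real_derivative 0) (at t)"
      by (rule has_field_derivative_transform_within_open[where S = "{..<0}"]) (use 1 in \<open>auto simp: flat_exp_def\<close>)
    then show ?thesis using 1 by (simp add: flat_exp_def)
  next
    case 2
    \<comment> \<open>For nonzero \<open>h\<close> the difference quotient at 0 is
      \<open>flat_exp (Suc m) h\<close>.\<close>
    have "((\<lambda>h. (flat_exp m (0 + h) - flat_exp m 0) / h) \<longlongrightarrow> 0) (at 0)"
      by (rule Lim_transform_eventually[OF flat_exp_tendsto_0[of "Suc m"]])
         (auto simp: eventually_at_filter flat_exp_def divide_inverse)
    then show ?thesis using 2 by (simp add: DERIV_def flat_exp_def)
  next
    case 3
    have "((\<lambda>t. inverse t ^ m * exp (- inverse t)) has_real_derivative
        (inverse t ^ m * (exp (- inverse t) * inverse t ^ 2) + real m * inverse t ^ (m - 1) * (- (inverse t ^ 2)) * exp (- inverse t))) (at t)"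
      using 3 by (auto intro!: derivative_eq_intros simp: power2_eq_square)
    also have "(inverse t ^ m * (exp (- inverse t) * inverse t ^ 2) + real m * inverse t ^ (m - 1) * (- (inverse t ^ 2)) * exp (- inverse t))
      = flat_exp (m + 2) t - real m * flat_exp (m + 1) t"
      using 3 by (cases m) (auto simp: flat_exp_def algebra_simps power2_eq_square)
    finally show ?thesis
      by (rule has_field_derivative_transform_within_open[where S = "{0<..}"]) (use 3 in \<open>auto simp: flat_exp_def\<close>)
  qed
qed

lemma Ck_flat_exp_norm: "Ck k (\<lambda>x. flat_exp m (c - x \<bullet> x))"
proof (induction k arbitrary: m)
  case 0
  have "continuous_on UNIV (flat_exp m)"
    using has_real_derivative_flat_exp by (intro DERIV_continuous_on) (auto intro: has_field_derivative_at_within)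
  then show ?case by (auto intro!: continuous_intros continuous_on_compose2[of UNIV "flat_exp m"])
next
  case (Suc k)
  show ?case
  proof (rule Ck_SucI)
    fix x :: 'a
    have "((\<lambda>x. c - x \<bullet> x) has_derivative (\<lambda>v. - 2 * (x \<bullet> v))) (at x)"
      by (auto intro!: derivative_eq_intros simp: inner_commute)
    from has_derivative_compose[OF this has_real_derivative_flat_exp[THEN has_field_derivative_imp_has_derivative]]
    show "((\<lambda>x. flat_exp m (c - x \<bullet> x)) has_derivative
       (\<lambda>v. (flat_exp (m + 2) (c - x \<bullet> x) + (- real m) * flat_exp (m + 1) (c - x \<bullet> x)) * ((- 2) * (x \<bullet> v)))) (at x)"
      by simp
  next
    fix v :: 'a
    show "Ck k (\<lambda>x. (flat_exp (m + 2) (c - x \<bullet> x) + (- real m) * flat_exp (m + 1) (c - x \<bullet> x)) * ((- 2) * (x \<bullet> v)))"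
      by (intro Ck_mult Ck_add Suc Ck_const Ck_inner)
  qed
qed

lemma continuous_compact_support_bounded:
  fixes f :: "'a::euclidean_space \<Rightarrow> real"
  assumes "continuous_on UNIV f" "\<And>x. R < norm x \<Longrightarrow> f x = 0"
  obtains B where "0 \<le> B" "\<And>x. \<bar>f x\<bar> \<le> B"
proof -
  have "compact (f ` cball 0 R)"
    using assms(1) by (intro compact_continuous_image) (auto intro: continuous_on_subset)
  then obtain B where B: "\<And>y. y \<in> f ` cball 0 R \<Longrightarrow> norm y \<le> B"
    using compact_imp_bounded bounded_iff by metis
  have "\<bar>f x\<bar> \<le> max 0 B" for x
  proof (cases "norm x \<le> R")
    case True then show ?thesis using B[of "f x"] by auto
  next
    case False then show ?thesis using assms(2)[of x] by auto
  qed
  then show ?thesis by (intro that[of "max 0 B"]) auto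
qed

lemma frechet_derivative_compact_support:
  fixes f :: "'a::euclidean_space \<Rightarrow> real"
  assumes "\<And>x. R < norm x \<Longrightarrow> f x = 0" and "R < norm x"
  shows "frechet_derivative f (at x) = (\<lambda>v. 0)"
proof -
  have "open {x::'a. R < norm x}"
    by (intro open_Collect_less continuous_intros)
  then have "(f has_derivative (\<lambda>v. 0)) (at x)"
    by (intro has_derivative_transform_within_open[OF has_derivative_const, of "{x. R < norm x}"])
       (use assms in auto)
  then show ?thesis using frechet_derivative_at by metis
qed

text \<open>Differentiation under the integral by dominated convergence. A directional derivative of
  the kernel is again smooth to one order less and vanishes outside the same ball, so the induction
  runs over all kernels while \<open>g\<close> stays fixed.\<close>

lemma Ck_convolution:
  fixes g \<eta> :: "'a::euclidean_space \<Rightarrow> real"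
  assumes g: "integrable lborel g" and supp: "\<And>x. R < norm x \<Longrightarrow> \<eta> x = 0" and "Ck k \<eta>"
  shows "Ck k (\<lambda>x. \<integral>y. g y * \<eta> (x - y) \<partial>lborel)"
  using supp \<open>Ck k \<eta>\<close>
proof (induction k arbitrary: \<eta>)
  case 0
  then have c: "continuous_on UNIV \<eta>" by simp
  then have [measurable]: "\<eta> \<in> borel_measurable borel" by (rule borel_measurable_continuous_onI)
  obtain B where B: "\<And>x. \<bar>\<eta> x\<bar> \<le> B" using continuous_compact_support_bounded[OF c 0(1)] by blast
  have "isCont (\<lambda>x. \<integral>y. g y * \<eta> (x - y) \<partial>lborel) x" for x
  proof (rule continuous_at_sequentiallyI)
    fix u assume u: "u \<longlonglongrightarrow> x"
    show "(\<lambda>n. \<integral>y. g y * \<eta> (u n - y) \<partial>lborel) \<longlonglongrightarrow> (\<integral>y. g y * \<eta> (x - y) \<partial>lborel)"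
    proof (rule integral_dominated_convergence[where w = "\<lambda>y. \<bar>g y\<bar> * B"])
      show "integrable lborel (\<lambda>y. \<bar>g y\<bar> * B)" using g by simp
      show "AE y in lborel. (\<lambda>n. g y * \<eta> (u n - y)) \<longlonglongrightarrow> g y * \<eta> (x - y)"
      proof (intro AE_I2 tendsto_intros)
        fix y
        have "isCont \<eta> (x - y)" using c by (simp add: continuous_on_eq_continuous_at)
        then show "(\<lambda>n. \<eta> (u n - y)) \<longlonglongrightarrow> \<eta> (x - y)"
          by (rule isCont_tendsto_compose) (intro tendsto_intros u)
      qed
      show "AE y in lborel. norm (g y * \<eta> (u n - y)) \<le> \<bar>g y\<bar> * B" for n
        using B by (intro AE_I2) (auto simp: abs_mult mult_left_mono)
    qed (use g in measurable)
  qed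
  then show ?case by (simp add: continuous_on_eq_continuous_at)
next
  case (Suc k)
  let ?D = "\<lambda>x. frechet_derivative \<eta> (at x)"
  have D: "(\<eta> has_derivative ?D x) (at x)" for x using Suc.prems(2) by (rule Ck_Suc_has_derivative)
  have DCk: "Ck k (\<lambda>x. ?D x v)" for v using Suc.prems(2) by simp
  have Ck0: "Ck k f \<Longrightarrow> continuous_on UNIV f" for f :: "'a \<Rightarrow> real"
    by (induction k) (auto dest: Ck_SucD simp del: Ck.simps(2))
  have Dc: "continuous_on UNIV (\<lambda>x. ?D x v)" for v using DCk by (rule Ck0)
  have Dsupp: "R < norm x \<Longrightarrow> ?D x v = 0" for x v
    using frechet_derivative_compact_support[of R \<eta> x] Suc.prems(1) by simp
  have "\<exists>B\<ge>0. \<forall>x. \<bar>?D x v\<bar> \<le> B" for v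
    using continuous_compact_support_bounded[of "\<lambda>x. ?D x v" R, OF Dc Dsupp] by metis
  then obtain b where b: "\<And>v. 0 \<le> b v" "\<And>v x. \<bar>?D x v\<bar> \<le> b v" by metis
  \<comment> \<open>Bounds along the finitely many basis directions sum to one bound for the whole
    derivative, which is then also a Lipschitz constant of the kernel.\<close>
  define B where "B = (\<Sum>i\<in>Basis. b i)"
  have B: "\<bar>?D x v\<bar> \<le> B * norm v" for x v
  proof -
    have lin: "linear (?D x)" using D has_derivative_linear by blast
    have "?D x v = ?D x (\<Sum>i\<in>Basis. (v \<bullet> i) *\<^sub>R i)" by (simp add: euclidean_representation)
    also have "\<dots> = (\<Sum>i\<in>Basis. (v \<bullet> i) * ?D x i)"
      using lin by (simp add: linear_sum linear_cmul)
    also have "\<bar>\<dots>\<bar> \<le> (\<Sum>i\<in>Basis. \<bar>(v \<bullet> i) * ?D x i\<bar>)" by (rule sum_abs)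
    also have "\<dots> \<le> (\<Sum>i\<in>Basis. norm v * b i)"
      using b by (intro sum_mono) (auto simp: abs_mult Basis_le_norm intro!: mult_mono)
    finally show ?thesis by (simp add: B_def sum_distrib_left mult.commute)
  qed
  have meas[measurable]: "\<eta> \<in> borel_measurable borel" "\<And>v. (\<lambda>x. ?D x v) \<in> borel_measurable borel"
    using Ck0[OF Ck_SucD[OF Suc.prems(2)]] Dc by (auto intro: borel_measurable_continuous_onI)
  have lip: "\<bar>\<eta> x - \<eta> y\<bar> \<le> B * norm (x - y)" for x y
  proof -
    have "norm (\<eta> x - \<eta> y) \<le> B * norm (x - y)"
    proof (rule differentiable_bound[OF convex_UNIV])
      show "onorm (?D z) \<le> B" for z using B by (intro onorm_bound) (auto simp: B_def sum_nonneg b)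
    qed (use D in auto)
    then show ?thesis by simp
  qed
  have int: "integrable lborel (\<lambda>y. g y * f (x - y))"
    if f: "\<And>x. \<bar>f x\<bar> \<le> C" and [measurable]: "f \<in> borel_measurable borel" for f :: "'a \<Rightarrow> real" and C x
    by (rule integrable_mult_bounded[OF g, where C = C]) (use f in auto)
  obtain Be where Be: "\<And>x. \<bar>\<eta> x\<bar> \<le> Be"
    using continuous_compact_support_bounded[OF Ck0[OF Ck_SucD[OF Suc.prems(2)]] Suc.prems(1)] by blast
  note int\<eta> = int[OF Be meas(1)]
  have intD: "integrable lborel (\<lambda>y. g y * ?D (x - y) v)" for x v
    by (rule int[OF b(2) meas(2)])
  show ?case
  proof (rule Ck_SucI)
    show "Ck k (\<lambda>x. \<integral>y. g y * ?D (x - y) v \<partial>lborel)" for v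
      by (rule Suc.IH[OF Dsupp DCk])
  next
    fix x
    let ?F = "\<lambda>x. \<integral>y. g y * \<eta> (x - y) \<partial>lborel"
    let ?L = "\<lambda>v. \<integral>y. g y * ?D (x - y) v \<partial>lborel"
    show "(?F has_derivative ?L) (at x)"
      unfolding has_derivative_at
    proof
      show "bounded_linear ?L"
      proof (rule bounded_linear_intro)
        have lin: "linear (?D z)" for z using D has_derivative_linear by blast
        show "?L (v + w) = ?L v + ?L w" for v w
          using intD by (simp add: linear_add[OF lin] algebra_simps)
        show "?L (r *\<^sub>R v) = r *\<^sub>R ?L v" for r v
          by (simp add: linear_cmul[OF lin] algebra_simps)
        show "norm (?L v) \<le> norm v * (B * (\<integral>y. \<bar>g y\<bar> \<partial>lborel))" for v
        proof -
          have "\<bar>?L v\<bar> \<le> (\<integral>y. \<bar>g y * ?D (x - y) v\<bar> \<partial>lborel)" by (rule integral_abs_bound)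
          also have "\<dots> \<le> (\<integral>y. \<bar>g y\<bar> * (B * norm v) \<partial>lborel)"
          proof (rule integral_mono)
            show "integrable lborel (\<lambda>y. \<bar>g y * ?D (x - y) v\<bar>)" using intD by (intro integrable_abs)
            show "integrable lborel (\<lambda>y. \<bar>g y\<bar> * (B * norm v))" using g by simp
            show "\<bar>g y * ?D (x - y) v\<bar> \<le> \<bar>g y\<bar> * (B * norm v)" for y
              using B by (simp add: abs_mult mult_left_mono)
          qed
          finally show ?thesis by (simp add: algebra_simps)
        qed
      qed
      show "(\<lambda>h. norm (?F (x + h) - ?F x - ?L h) / norm h) \<midarrow>0\<rightarrow> 0"
        unfolding tendsto_at_iff_sequentially
      proof (intro allI impI)
        fix u :: "nat \<Rightarrow> 'a" assume u0: "\<forall>i. u i \<in> UNIV - {0}" and u: "u \<longlonglongrightarrow> 0"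
        let ?q = "\<lambda>n y. g y * ((\<eta> (x + u n - y) - \<eta> (x - y) - ?D (x - y) (u n)) / norm (u n))"
        have eq: "(?F (x + u n) - ?F x - ?L (u n)) / norm (u n) = (\<integral>y. ?q n y \<partial>lborel)" for n
          using int\<eta> intD by (simp add: algebra_simps diff_divide_distrib)
        have "(\<lambda>n. \<integral>y. ?q n y \<partial>lborel) \<longlonglongrightarrow> (\<integral>y. 0 \<partial>(lborel :: 'a measure))"
        \<comment> \<open>The quotient is at most \<open>2 * B\<close>: one \<open>B\<close> from
          the Lipschitz bound, one from the linear term.\<close>
        proof (rule integral_dominated_convergence[where w = "\<lambda>y. \<bar>g y\<bar> * (2 * B)"])
          show "integrable lborel (\<lambda>y. \<bar>g y\<bar> * (2 * B))" using g by simp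
          show "AE y in lborel. (\<lambda>n. ?q n y) \<longlonglongrightarrow> 0"
          proof (rule AE_I2, rule tendsto_mult_right_zero)
            fix y
            have "(\<lambda>h. norm (\<eta> (x - y + h) - \<eta> (x - y) - ?D (x - y) h) / norm h) \<midarrow>0\<rightarrow> 0"
              using D[of "x - y"] unfolding has_derivative_at by blast
            then have "(\<lambda>n. norm (\<eta> (x - y + u n) - \<eta> (x - y) - ?D (x - y) (u n)) / norm (u n)) \<longlonglongrightarrow> 0"
              using u0 u unfolding tendsto_at_iff_sequentially comp_def by blast
            then have "(\<lambda>n. norm ((\<eta> (x - y + u n) - \<eta> (x - y) - ?D (x - y) (u n)) / norm (u n))) \<longlonglongrightarrow> 0"
              by simp
            then have "(\<lambda>n. (\<eta> (x - y + u n) - \<eta> (x - y) - ?D (x - y) (u n)) / norm (u n)) \<longlonglongrightarrow> 0"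
              by (rule tendsto_norm_zero_cancel)
            then show "(\<lambda>n. (\<eta> (x + u n - y) - \<eta> (x - y) - ?D (x - y) (u n)) / norm (u n)) \<longlonglongrightarrow> 0"
              by (simp add: algebra_simps)
          qed
          show "AE y in lborel. norm (?q n y) \<le> \<bar>g y\<bar> * (2 * B)" for n
          proof (rule AE_I2)
            fix y
            have "\<bar>\<eta> (x + u n - y) - \<eta> (x - y) - ?D (x - y) (u n)\<bar> \<le> B * norm (u n) + B * norm (u n)"
              using lip[of "x + u n - y" "x - y"] B[of "x - y" "u n"] by auto
            then have "\<bar>\<eta> (x + u n - y) - \<eta> (x - y) - ?D (x - y) (u n)\<bar> / norm (u n) \<le> 2 * B"
              using u0 by (auto simp: divide_le_eq)
            then have "\<bar>g y\<bar> * (\<bar>\<eta> (x + u n - y) - \<eta> (x - y) - ?D (x - y) (u n)\<bar> / norm (u n)) \<le> \<bar>g y\<bar> * (2 * B)"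
              by (rule mult_left_mono) simp
            then show "norm (?q n y) \<le> \<bar>g y\<bar> * (2 * B)"
              by (simp add: abs_mult)
          qed
        qed (use g in auto)
        then have "(\<lambda>n. norm (\<integral>y. ?q n y \<partial>lborel)) \<longlonglongrightarrow> norm (0::real)"
          by (intro tendsto_norm) simp
        then have "(\<lambda>n. norm ((?F (x + u n) - ?F x - ?L (u n)) / norm (u n))) \<longlonglongrightarrow> 0"
          unfolding eq by simp
        then show "((\<lambda>h. norm (?F (x + h) - ?F x - ?L h) / norm h) \<circ> u) \<longlonglongrightarrow> 0"
          by (simp add: comp_def)
      qed
    qed
  qed
qed

subsection \<open>Mollification\<close>

text \<open>Not a rescaling of one fixed bump: the radius enters inside \<open>flat_exp\<close>.
  What matters is unit mass, sign, symmetry, smoothness and support in the ball of radius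
  \<open>r\<close>.\<close>

definition mollifier :: "real \<Rightarrow> 'a::euclidean_space \<Rightarrow> real" where
  "mollifier r x = flat_exp 0 (r\<^sup>2 - x \<bullet> x) / (\<integral>y. flat_exp 0 (r\<^sup>2 - y \<bullet> (y::'a)) \<partial>lborel)"

lemma flat_exp_bounds: "0 \<le> flat_exp 0 t" "flat_exp 0 t \<le> 1"
  by (auto simp: flat_exp_def)

lemma flat_exp_norm_eq_0:
  fixes x :: "'a::euclidean_space"
  assumes "0 < r" shows "flat_exp m (r\<^sup>2 - x \<bullet> x) = 0 \<longleftrightarrow> r \<le> norm x"
proof -
  have "x \<bullet> x < r\<^sup>2 \<longleftrightarrow> norm x < r"
    using assms by (auto simp: dot_square_norm intro: power2_less_imp_less power_strict_mono)
  then show ?thesis by (auto simp: flat_exp_def not_less)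
qed

lemma continuous_flat_exp_norm: "continuous_on UNIV (\<lambda>x::'a::euclidean_space. flat_exp m (c - x \<bullet> x))"
  using Ck_flat_exp_norm[of 0] by simp

lemma flat_exp_norm_measurable[measurable]: "(\<lambda>x::'a::euclidean_space. flat_exp m (c - x \<bullet> x)) \<in> borel_measurable borel"
  by (intro borel_measurable_continuous_onI continuous_flat_exp_norm)

lemma integrable_bounded_support:
  fixes f :: "'a::euclidean_space \<Rightarrow> real"
  assumes [measurable]: "f \<in> borel_measurable borel" and b: "\<And>x. \<bar>f x\<bar> \<le> B" and s: "\<And>x. R < norm x \<Longrightarrow> f x = 0"
  shows "integrable lborel f"
proof (rule Bochner_Integration.integrable_bound[of _ "\<lambda>x. B * indicator (cball 0 R) x"])
  have "emeasure lborel (cball (0::'a) R) < \<infinity>" by (intro emeasure_bounded_finite) auto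
  then show "integrable lborel (\<lambda>x::'a. B * indicator (cball 0 R) x)"
    by (intro integrable_mult_right integrable_real_indicator) auto
  show "AE x in lborel. norm (f x) \<le> norm (B * indicator (cball 0 R) x)"
  proof (rule AE_I2)
    fix x
    show "norm (f x) \<le> norm (B * indicator (cball 0 R) x)"
      using b[of x] s[of x] by (auto simp: indicator_def)
  qed
qed auto

lemma integrable_flat_exp_norm:
  assumes "0 < r" shows "integrable lborel (\<lambda>x::'a::euclidean_space. flat_exp 0 (r\<^sup>2 - x \<bullet> x))"
proof (rule integrable_bounded_support[where R = r and B = 1])
  show "flat_exp 0 (r\<^sup>2 - x \<bullet> x) = 0" if "r < norm x" for x :: 'a
    using that flat_exp_norm_eq_0[OF assms, of 0 x] by auto
qed (use flat_exp_bounds in auto)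

lemma integral_flat_exp_norm_pos:
  assumes "0 < r" shows "0 < (\<integral>y. flat_exp 0 (r\<^sup>2 - y \<bullet> y) \<partial>(lborel :: 'a::euclidean_space measure))"
proof -
  have "(\<integral>y. flat_exp 0 (r\<^sup>2 - y \<bullet> y) \<partial>(lborel :: 'a measure)) \<noteq> 0"
  proof
    assume "(\<integral>y. flat_exp 0 (r\<^sup>2 - y \<bullet> y) \<partial>(lborel :: 'a measure)) = 0"
    then have "AE y in (lborel :: 'a measure). flat_exp 0 (r\<^sup>2 - y \<bullet> y) = 0"
      using integral_nonneg_eq_0_iff_AE[OF integrable_flat_exp_norm[OF assms]] flat_exp_bounds by auto
    then have "AE y in (lborel :: 'a measure). y \<notin> ball 0 r"
      by (rule eventually_mono) (use flat_exp_norm_eq_0[OF assms, of 0, where 'a='a] in auto)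
    then have "emeasure lborel (ball (0::'a) r) = 0"
      by (subst (asm) AE_iff_measurable[of "ball 0 r"]) auto
    then show False using assms content_ball_pos[of r "0::'a"] by (simp add: measure_def)
  qed
  moreover have "0 \<le> (\<integral>y. flat_exp 0 (r\<^sup>2 - y \<bullet> y) \<partial>(lborel :: 'a measure))"
    using flat_exp_bounds by (intro Bochner_Integration.integral_nonneg) auto
  ultimately show ?thesis by simp
qed

lemma mollifier_nonneg: "0 < r \<Longrightarrow> 0 \<le> mollifier r (x::'a::euclidean_space)"
  unfolding mollifier_def using integral_flat_exp_norm_pos[of r, where 'a='a] flat_exp_bounds by auto

lemma mollifier_measurable[measurable]: "mollifier r \<in> borel_measurable borel"
  unfolding mollifier_def[abs_def] by measurable

lemma mollifier_eq_0: "0 < r \<Longrightarrow> r \<le> norm x \<Longrightarrow> mollifier r (x::'a::euclidean_space) = 0"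
  unfolding mollifier_def using flat_exp_norm_eq_0[of r 0 x] by simp

lemma integrable_mollifier: "0 < r \<Longrightarrow> integrable lborel (mollifier r :: 'a::euclidean_space \<Rightarrow> real)"
  unfolding mollifier_def[abs_def] by (intro integrable_divide_zero impI integrable_flat_exp_norm)

lemma integral_mollifier: "0 < r \<Longrightarrow> (\<integral>x. mollifier r (x::'a::euclidean_space) \<partial>lborel) = 1"
  unfolding mollifier_def using integral_flat_exp_norm_pos[of r, where 'a='a] by simp

lemma nn_integral_mollifier: "0 < r \<Longrightarrow> (\<integral>\<^sup>+x. ennreal (mollifier r (x::'a::euclidean_space)) \<partial>lborel) = 1"
  using nn_integral_eq_integral[OF integrable_mollifier[of r, where 'a='a]] mollifier_nonneg[of r, where 'a='a]
  by (simp add: integral_mollifier)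

lemma mollifier_minus: "mollifier r (- x) = mollifier r x"
  by (simp add: mollifier_def)

lemma Ck_mollifier: "Ck k (mollifier r)"
  unfolding mollifier_def[abs_def] divide_inverse by (intro Ck_mult Ck_const Ck_flat_exp_norm)

lemma lborel_integral_translation:
  fixes f :: "'a::euclidean_space \<Rightarrow> real"
  assumes "f \<in> borel_measurable borel"
  shows "(\<integral>y. f (c + y) \<partial>lborel) = (\<integral>y. f y \<partial>lborel)"
proof -
  have "(\<integral>y. f y \<partial>lborel) = (\<integral>y. f y \<partial>distr lborel borel ((+) c))" by (simp add: lborel_distr_plus)
  also have "\<dots> = (\<integral>y. f (c + y) \<partial>lborel)" using assms by (intro integral_distr) auto
  finally show ?thesis by simp
qed

lemma lborel_nn_integral_translation:
  fixes f :: "'a::euclidean_space \<Rightarrow> ennreal"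
  assumes "f \<in> borel_measurable borel"
  shows "(\<integral>\<^sup>+y. f (c + y) \<partial>lborel) = (\<integral>\<^sup>+y. f y \<partial>lborel)"
proof -
  have "(\<integral>\<^sup>+y. f y \<partial>lborel) = (\<integral>\<^sup>+y. f y \<partial>distr lborel borel ((+) c))" by (simp add: lborel_distr_plus)
  also have "\<dots> = (\<integral>\<^sup>+y. f (c + y) \<partial>lborel)" using assms by (intro nn_integral_distr) auto
  finally show ?thesis by simp
qed

definition mollify :: "real \<Rightarrow> ('a::euclidean_space \<Rightarrow> real) \<Rightarrow> 'a \<Rightarrow> real" where
  "mollify r g x = (\<integral>y. g y * mollifier r (x - y) \<partial>lborel)"

text \<open>Displays \<open>mollify r g x\<close> as an average of translates of \<open>g\<close>
  with a weight independent of \<open>x\<close>, the form to which Jensen's inequality applies; it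
  rests on the symmetry of the mollifier.\<close>

lemma mollify_alt:
  assumes [measurable]: "g \<in> borel_measurable borel"
  shows "mollify r g x = (\<integral>z. mollifier r z * g (z + x) \<partial>lborel)"
proof -
  have "mollify r g x = (\<integral>z. g (x + z) * mollifier r (x - (x + z)) \<partial>lborel)"
    unfolding mollify_def by (rule lborel_integral_translation[symmetric]) measurable
  also have "\<dots> = (\<integral>z. mollifier r z * g (z + x) \<partial>lborel)"
  proof (rule Bochner_Integration.integral_cong[OF refl])
    fix z
    have "x - (x + z) = - z" by simp
    then show "g (x + z) * mollifier r (x - (x + z)) = mollifier r z * g (z + x)"
      by (simp add: mollifier_minus add.commute)
  qed
  finally show ?thesis .
qed

lemma Ck_mollify: "integrable lborel g \<Longrightarrow> 0 < r \<Longrightarrow> Ck k (mollify r g)"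
  unfolding mollify_def[abs_def]
  by (rule Ck_convolution[where R = r]) (auto simp: mollifier_eq_0 Ck_mollifier)

lemma mollify_measurable[measurable]: "integrable lborel g \<Longrightarrow> 0 < r \<Longrightarrow> mollify r g \<in> borel_measurable borel"
  using Ck_mollify[of g r 0] by (auto intro: borel_measurable_continuous_onI)

lemma mollify_eq_0:
  fixes g :: "'a::euclidean_space \<Rightarrow> real"
  assumes "0 < r" "\<And>y. dist x y < r \<Longrightarrow> g y = 0"
  shows "mollify r g x = 0"
proof -
  have "g y * mollifier r (x - y) = 0" for y
    using assms mollifier_eq_0[of r "x - y"] by (cases "dist x y < r") (auto simp: dist_norm)
  then have "mollify r g x = (\<integral>y. 0 \<partial>(lborel :: 'a measure))"
    unfolding mollify_def by (intro Bochner_Integration.integral_cong refl)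
  then show ?thesis by simp
qed

text \<open>The values at \<open>x\<close> and \<open>y\<close> are averages with the same weight,
  so their difference is an average of differences of translates.\<close>

lemma mollify_jensen:
  fixes g :: "'a::euclidean_space \<Rightarrow> real"
  assumes p: "1 \<le> p" and r: "0 < r" and [measurable]: "g \<in> borel_measurable borel" and B: "\<And>x. \<bar>g x\<bar> \<le> B"
  shows "ennreal (\<bar>mollify r g x - mollify r g y\<bar> powr p)
    \<le> (\<integral>\<^sup>+z. ennreal (mollifier r z) * ennreal (\<bar>g (z + x) - g (z + y)\<bar> powr p) \<partial>lborel)"
proof -
  have int: "integrable lborel (\<lambda>z. mollifier r z * g (z + x))" for x
    by (rule integrable_mult_bounded[OF integrable_mollifier[OF r], where C = B]) (use B in auto)
  have "mollify r g x - mollify r g y = (\<integral>z. mollifier r z * (g (z + x) - g (z + y)) \<partial>lborel)"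
    using int[of x] int[of y] by (simp add: mollify_alt right_diff_distrib)
  moreover have "\<bar>g (z + x) - g (z + y)\<bar> \<le> 2 * B" for z using B[of "z + x"] B[of "z + y"] by linarith
  ultimately show ?thesis
    using jensen_powr[of p "mollifier r" lborel "\<lambda>z. g (z + x) - g (z + y)" "2 * B"] p r
    by (simp add: mollifier_nonneg integrable_mollifier integral_mollifier)
qed

lemma mollify_bounded:
  fixes g :: "'a::euclidean_space \<Rightarrow> real"
  assumes r: "0 < r" and [measurable]: "g \<in> borel_measurable borel" and B: "\<And>x. \<bar>g x\<bar> \<le> B"
  shows "\<bar>mollify r g x\<bar> \<le> B"
proof -
  have B0: "0 \<le> B" using B[of undefined] by linarith
  have int: "integrable lborel (\<lambda>z::'a. mollifier r z * B)" using integrable_mollifier[OF r, where 'a='a] by auto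
  have "\<bar>mollify r g x\<bar> \<le> (\<integral>z. mollifier r z * B \<partial>(lborel :: 'a measure))"
    unfolding mollify_alt[OF assms(2)]
  proof (rule integral_abs_bound_integral)
    show le: "\<bar>mollifier r z * g (z + x)\<bar> \<le> mollifier r z * B" for z
      using B mollifier_nonneg[OF r, of z] by (simp add: abs_mult mult_left_mono)
    show "integrable lborel (\<lambda>z. mollifier r z * g (z + x))"
      using le B0 mollifier_nonneg[OF r, where 'a='a] by (intro Bochner_Integration.integrable_bound[OF int]) (auto simp: abs_mult)
  qed (rule int)
  then show ?thesis using r by (simp add: integral_mollifier)
qed

lemma mollify_continuous_close:
  fixes c :: "'a::euclidean_space \<Rightarrow> real"
  assumes c: "continuous_on UNIV c" and supp: "\<And>x. R < norm x \<Longrightarrow> c x = 0" and e: "0 < e"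
  shows "\<exists>\<delta>>0. \<forall>r. 0 < r \<longrightarrow> r \<le> \<delta> \<longrightarrow> (\<forall>x. \<bar>c x - mollify r c x\<bar> \<le> e)"
proof -
  have [measurable]: "c \<in> borel_measurable borel" using c by (rule borel_measurable_continuous_onI)
  obtain B where B: "\<And>x. \<bar>c x\<bar> \<le> B" using continuous_compact_support_bounded[OF c supp] by blast
  have "uniformly_continuous_on (cball 0 (R + 2)) c"
    by (intro compact_uniformly_continuous continuous_on_subset[OF c]) auto
  then obtain d where d: "d > 0" "\<And>x y. x \<in> cball 0 (R + 2) \<Longrightarrow> y \<in> cball 0 (R + 2) \<Longrightarrow> dist x y < d \<Longrightarrow> dist (c x) (c y) < e"
    using e unfolding uniformly_continuous_on_def by metis
  \<comment> \<open>Two points at distance below 1 either both lie in the ball of radius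
    \<open>R + 2\<close>, where uniform continuity holds, or both lie outside the support.\<close>
  have uc: "\<bar>c x - c y\<bar> \<le> e" if near: "dist x y < min d 1" for x y
  proof -
    have n: "norm y \<le> norm x + dist x y" "norm x \<le> norm y + dist x y"
      using norm_triangle_sub[of x y] norm_triangle_sub[of y x] by (auto simp: dist_norm norm_minus_commute)
    consider "norm x \<le> R + 1" "norm y \<le> R + 2" | "R < norm x" "R < norm y"
      using n near by (cases "norm x \<le> R + 1") auto
    then show ?thesis
    proof cases
      case 1 then show ?thesis using d(2)[of y x] near by (fastforce simp: dist_commute dist_real_def)
    next
      case 2 then show ?thesis using supp e by simp
    qed
  qed
  have "\<bar>c x - mollify r c x\<bar> \<le> e" if r: "0 < r" "r \<le> min d 1" for r x
  proof -
    have int: "integrable lborel (\<lambda>z::'a. mollifier r z * e)" using integrable_mollifier[OF r(1), where 'a='a] by auto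
    have int1: "integrable lborel (\<lambda>z. mollifier r z * c (z + x))"
      by (rule integrable_mult_bounded[OF integrable_mollifier[OF r(1)], where C = B]) (use B in auto)
    have int2: "integrable lborel (\<lambda>z::'a. mollifier r z * c x)" using integrable_mollifier[OF r(1), where 'a='a] by auto
    have "c x - mollify r c x = (\<integral>z. mollifier r z * c x \<partial>(lborel :: 'a measure)) - (\<integral>z. mollifier r z * c (z + x) \<partial>lborel)"
      using r(1) by (simp add: mollify_alt integral_mollifier)
    also have "\<dots> = (\<integral>z. mollifier r z * (c x - c (z + x)) \<partial>lborel)"
      using int1 int2 by (simp add: right_diff_distrib)
    also have "\<bar>\<dots>\<bar> \<le> (\<integral>z. mollifier r z * e \<partial>(lborel :: 'a measure))"
    proof (rule integral_abs_bound_integral[OF _ int])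
      show "integrable lborel (\<lambda>z. mollifier r z * (c x - c (z + x)))"
        using int1 int2 by (simp add: right_diff_distrib)
      fix z
      show "\<bar>mollifier r z * (c x - c (z + x))\<bar> \<le> mollifier r z * e"
      proof (cases "norm z < r")
        case True
        then have "\<bar>c x - c (z + x)\<bar> \<le> e" using r by (intro uc) (auto simp: dist_norm)
        then show ?thesis using mollifier_nonneg[OF r(1), of z] by (simp add: abs_mult mult_left_mono)
      qed (use mollifier_eq_0[OF r(1), of z] in auto)
    qed
    also have "\<dots> = e" using r by (simp add: integral_mollifier)
    finally show ?thesis .
  qed
  then show ?thesis using d(1) by (intro exI[of _ "min d 1"]) auto
qed

text \<open>A measurable function is an almost everywhere limit of continuous functions. Clipping
  these at \<open>B\<close> and multiplying by \<open>cut\<close>, which is 1 on the ball of radius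
  \<open>R\<close>, makes dominated convergence applicable.\<close>

lemma continuous_L1_approx:
  fixes g :: "'a::euclidean_space \<Rightarrow> real"
  assumes g[measurable]: "g \<in> borel_measurable borel" and B: "\<And>x. \<bar>g x\<bar> \<le> B" and supp: "\<And>x. R < norm x \<Longrightarrow> g x = 0" and e: "0 < e"
  shows "\<exists>c. continuous_on UNIV c \<and> (\<forall>x. \<bar>c x\<bar> \<le> B) \<and> (\<forall>x. R + 1 < norm x \<longrightarrow> c x = 0)
    \<and> (\<integral>\<^sup>+x. ennreal \<bar>g x - c x\<bar> \<partial>lborel) < ennreal e"
proof -
  have B0: "0 \<le> B" using B[of undefined] by linarith
  have "g \<in> borel_measurable lebesgue" by (intro measurable_completion) simp
  then have "g measurable_on UNIV" by (rule lebesgue_measurable_imp_measurable_on) auto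
  then obtain N h where N: "negligible N" and h: "\<And>n. continuous_on UNIV (h n)"
    and lim: "\<And>x. x \<notin> N \<Longrightarrow> (\<lambda>n. h n x) \<longlonglongrightarrow> g x"
    unfolding measurable_on_def by auto
  define cut where "cut x = max 0 (min 1 (R + 1 - norm x))" for x :: 'a
  define c where "c n x = cut x * max (- B) (min B (h n x))" for n x
  have cc: "continuous_on UNIV (c n)" for n
    unfolding c_def cut_def by (intro continuous_intros h)
  have cb: "\<bar>c n x\<bar> \<le> B" for n x
  proof -
    have "\<bar>c n x\<bar> \<le> 1 * B" unfolding c_def abs_mult using B0 by (intro mult_mono) (auto simp: cut_def)
    then show ?thesis by simp
  qed
  have cs: "c n x = 0" if "R + 1 < norm x" for n x using that by (simp add: c_def cut_def)
  have [measurable]: "c n \<in> borel_measurable borel" for n by (rule borel_measurable_continuous_onI[OF cc])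
  have "(\<lambda>n. \<integral>\<^sup>+x. ennreal \<bar>g x - c n x\<bar> \<partial>lborel) \<longlonglongrightarrow> (\<integral>\<^sup>+x. 0 \<partial>(lborel :: 'a measure))"
  proof (rule nn_integral_dominated_convergence[where w = "\<lambda>x. ennreal (2 * B) * indicator (cball 0 (R + 1)) x"])
    have "emeasure lborel (cball (0::'a) (R + 1)) < \<infinity>" by (intro emeasure_bounded_finite) auto
    then show "(\<integral>\<^sup>+x. ennreal (2 * B) * indicator (cball (0::'a) (R + 1)) x \<partial>lborel) < \<infinity>"
      by (subst nn_integral_cmult_indicator) (auto simp: ennreal_mult_less_top)
    show "AE x in lborel. ennreal \<bar>g x - c n x\<bar> \<le> ennreal (2 * B) * indicator (cball 0 (R + 1)) x" for n
    proof (rule AE_I2)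
      fix x
      have "\<bar>g x - c n x\<bar> \<le> 2 * B" using B[of x] cb[of n x] by linarith
      moreover have "\<bar>g x - c n x\<bar> = 0" if "R + 1 < norm x" using supp[of x] cs[of x n] that by simp
      ultimately show "ennreal \<bar>g x - c n x\<bar> \<le> ennreal (2 * B) * indicator (cball 0 (R + 1)) x"
        by (auto simp: indicator_def intro!: ennreal_leI)
    qed
    have "indicator (cball (0::'a) (R + 1)) \<in> borel_measurable (lborel :: 'a measure)"
      by (rule borel_measurable_indicator) simp
    then show "(\<lambda>x. ennreal (2 * B) * indicator (cball (0::'a) (R + 1)) x) \<in> borel_measurable lborel"
      by (rule borel_measurable_times_ennreal[OF borel_measurable_const])
    show "(\<lambda>x. ennreal \<bar>g x - c n x\<bar>) \<in> borel_measurable lborel" for n by measurable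
    have "AE x in lebesgue. x \<notin> N" using N by (intro AE_not_in) (simp add: negligible_iff_null_sets)
    then have "AE x in lborel. x \<notin> N" using AE_completion_iff by blast
    then show "AE x in lborel. (\<lambda>n. ennreal \<bar>g x - c n x\<bar>) \<longlonglongrightarrow> 0"
    proof eventually_elim
      fix x assume "x \<notin> N"
      then have "(\<lambda>n. \<bar>g x - c n x\<bar>) \<longlonglongrightarrow> \<bar>g x - cut x * max (- B) (min B (g x))\<bar>"
        unfolding c_def by (intro tendsto_intros lim)
      moreover have "max (- B) (min B (g x)) = g x" using B[of x] by auto
      moreover have "cut x * g x = g x" using supp[of x] by (cases "R < norm x") (auto simp: cut_def)
      ultimately have "(\<lambda>n. \<bar>g x - c n x\<bar>) \<longlonglongrightarrow> 0" by simp
      then have "(\<lambda>n. ennreal \<bar>g x - c n x\<bar>) \<longlonglongrightarrow> ennreal 0" by (rule tendsto_ennrealI)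
      then show "(\<lambda>n. ennreal \<bar>g x - c n x\<bar>) \<longlonglongrightarrow> 0" by simp
    qed
  qed simp
  then have "(\<lambda>n. \<integral>\<^sup>+x. ennreal \<bar>g x - c n x\<bar> \<partial>lborel) \<longlonglongrightarrow> 0" by simp
  then have "\<forall>\<^sub>F n in sequentially. (\<integral>\<^sup>+x. ennreal \<bar>g x - c n x\<bar> \<partial>lborel) < ennreal e"
    using e by (intro order_tendstoD) auto
  then obtain n where "(\<integral>\<^sup>+x. ennreal \<bar>g x - c n x\<bar> \<partial>lborel) < ennreal e"
    using eventually_happens'[OF sequentially_bot] by blast
  then show ?thesis using cc cb cs by (intro exI[of _ "c n"]) simp
qed

text \<open>Jensen's inequality with exponent 1, Tonelli's theorem and translation
  invariance.\<close>

lemma mollify_L1_contract: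
  fixes g :: "'a::euclidean_space \<Rightarrow> real"
  assumes r: "0 < r" and [measurable]: "g \<in> borel_measurable borel" and B: "\<And>x. \<bar>g x\<bar> \<le> B"
  shows "(\<integral>\<^sup>+x. ennreal \<bar>mollify r g x\<bar> \<partial>lborel) \<le> (\<integral>\<^sup>+x. ennreal \<bar>g x\<bar> \<partial>lborel)"
proof -
  have "(\<integral>\<^sup>+x. ennreal \<bar>mollify r g x\<bar> \<partial>lborel) \<le> (\<integral>\<^sup>+x. (\<integral>\<^sup>+z. ennreal (mollifier r z) * ennreal \<bar>g (z + x)\<bar> \<partial>lborel) \<partial>lborel)"
  proof (rule nn_integral_mono)
    fix x
    show "ennreal \<bar>mollify r g x\<bar> \<le> (\<integral>\<^sup>+z. ennreal (mollifier r z) * ennreal \<bar>g (z + x)\<bar> \<partial>lborel)"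
      using jensen_powr[of 1 "mollifier r" lborel "\<lambda>z. g (z + x)" B] r B
      by (simp add: mollifier_nonneg integrable_mollifier integral_mollifier mollify_alt)
  qed
  also have "\<dots> = (\<integral>\<^sup>+z. (\<integral>\<^sup>+x. ennreal (mollifier r z) * ennreal \<bar>g (z + x)\<bar> \<partial>lborel) \<partial>lborel)"
    by (rule lborel_pair.Fubini') measurable
  also have "\<dots> = (\<integral>\<^sup>+z. ennreal (mollifier r z) * (\<integral>\<^sup>+x. ennreal \<bar>g x\<bar> \<partial>lborel) \<partial>(lborel :: 'a measure))"
  proof (rule nn_integral_cong)
    fix z :: 'a
    have "(\<integral>\<^sup>+x. ennreal (mollifier r z) * ennreal \<bar>g (z + x)\<bar> \<partial>lborel) = ennreal (mollifier r z) * (\<integral>\<^sup>+x. ennreal \<bar>g (z + x)\<bar> \<partial>lborel)"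
      by (rule nn_integral_cmult) measurable
    also have "(\<integral>\<^sup>+x. ennreal \<bar>g (z + x)\<bar> \<partial>lborel) = (\<integral>\<^sup>+x. ennreal \<bar>g x\<bar> \<partial>lborel)"
      by (rule lborel_nn_integral_translation) measurable
    finally show "(\<integral>\<^sup>+x. ennreal (mollifier r z) * ennreal \<bar>g (z + x)\<bar> \<partial>lborel) = ennreal (mollifier r z) * (\<integral>\<^sup>+x. ennreal \<bar>g x\<bar> \<partial>lborel)" .
  qed
  also have "\<dots> = (\<integral>\<^sup>+z. ennreal (mollifier r (z::'a)) \<partial>lborel) * (\<integral>\<^sup>+x. ennreal \<bar>g x\<bar> \<partial>lborel)"
    by (rule nn_integral_multc) measurable
  finally show ?thesis using r by (simp add: nn_integral_mollifier)
qed

text \<open>Approximate \<open>g\<close> by a continuous \<open>c\<close>: the error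
  \<open>g - c\<close> is not enlarged by mollification, and \<open>c\<close> is uniformly close to
  its mollification on a bounded set.\<close>

lemma mollify_L1_close:
  fixes g :: "'a::euclidean_space \<Rightarrow> real"
  assumes g[measurable]: "g \<in> borel_measurable borel" and B: "\<And>x. \<bar>g x\<bar> \<le> B" and supp: "\<And>x. R < norm x \<Longrightarrow> g x = 0" and e: "0 < e"
  shows "\<exists>\<delta>>0. \<forall>r. 0 < r \<longrightarrow> r \<le> \<delta> \<longrightarrow> (\<integral>\<^sup>+x. ennreal \<bar>g x - mollify r g x\<bar> \<partial>lborel) < ennreal e"
proof -
  obtain c where c: "continuous_on UNIV c" "\<And>x. \<bar>c x\<bar> \<le> B" "\<And>x. R + 1 < norm x \<Longrightarrow> c x = 0"
    "(\<integral>\<^sup>+x. ennreal \<bar>g x - c x\<bar> \<partial>lborel) < ennreal (e/4)"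
    using continuous_L1_approx[of g B R "e/4", OF g B supp] e by auto
  have cm[measurable]: "c \<in> borel_measurable borel" by (rule borel_measurable_continuous_onI[OF c(1)])
  \<comment> \<open>\<open>c\<close> vanishes beyond radius \<open>R + 1\<close> and mollification
    with \<open>r \<le> 1\<close> spreads it by at most 1, so \<open>V\<close> is the volume that
    carries the uniform error \<open>e'\<close>.\<close>
  define V where "V = measure lborel (cball (0::'a) (R + 2))"
  have V: "emeasure lborel (cball (0::'a) (R + 2)) = ennreal V"
    unfolding V_def by (intro emeasure_eq_ennreal_measure) (use emeasure_bounded_finite[of "cball (0::'a) (R+2)"] in auto)
  have V0: "0 \<le> V" by (simp add: V_def)
  define e' where "e' = e / (4 * (V + 1))"
  have e': "0 < e'" "e' * V \<le> e / 4" using e V0 by (auto simp: e'_def field_simps)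
  obtain \<delta> where \<delta>: "\<delta> > 0" "\<And>r x. 0 < r \<Longrightarrow> r \<le> \<delta> \<Longrightarrow> \<bar>c x - mollify r c x\<bar> \<le> e'"
    using mollify_continuous_close[OF c(1) c(3) e'(1)] by blast
  have gint: "integrable lborel g" by (rule integrable_bounded_support[OF g B supp])
  have cint: "integrable lborel c" by (rule integrable_bounded_support[OF cm c(2) c(3)])
  have "(\<integral>\<^sup>+x. ennreal \<bar>g x - mollify r g x\<bar> \<partial>lborel) < ennreal e" if r: "0 < r" "r \<le> min \<delta> 1" for r
  proof -
    have [measurable]: "mollify r g \<in> borel_measurable borel" "mollify r c \<in> borel_measurable borel"
      "mollify r (\<lambda>x. g x - c x) \<in> borel_measurable borel"
      using gint cint r by (auto intro: mollify_measurable)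
    have diff: "mollify r (\<lambda>x. g x - c x) x = mollify r g x - mollify r c x" for x
    proof -
      have int: "integrable lborel (\<lambda>y. f y * mollifier r (x - y))"
        if fi: "integrable lborel f" for f
      proof (rule continuous_compact_support_bounded[of "mollifier r :: 'a \<Rightarrow> real" r])
        show "continuous_on UNIV (mollifier r :: 'a \<Rightarrow> real)" using Ck_mollifier[of 0 r, where 'a='a] by simp
        show "mollifier r z = 0" if "r < norm z" for z :: 'a using mollifier_eq_0[OF r(1), of z] that by simp
        fix b assume "\<And>z::'a. \<bar>mollifier r z\<bar> \<le> b"
        then show ?thesis by (intro integrable_mult_bounded[OF fi, where C = b]) auto
      qed
      show ?thesis unfolding mollify_def using int[OF gint] int[OF cint] by (simp add: left_diff_distrib)
    qed
    have 1: "(\<integral>\<^sup>+x. ennreal \<bar>c x - mollify r c x\<bar> \<partial>lborel) \<le> ennreal (e/4)"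
    proof -
      have "(\<integral>\<^sup>+x. ennreal \<bar>c x - mollify r c x\<bar> \<partial>lborel) \<le> (\<integral>\<^sup>+x. ennreal e' * indicator (cball 0 (R + 2)) x \<partial>(lborel :: 'a measure))"
      proof (rule nn_integral_mono)
        fix x
        have "c x - mollify r c x = 0" if "R + 2 < norm x"
        proof -
          have "mollify r c x = 0"
          proof (rule mollify_eq_0[OF r(1)])
            fix y assume "dist x y < r"
            then have "norm (x - y) < 1" using r by (simp add: dist_norm)
            then show "c y = 0" using that c(3)[of y] norm_triangle_ineq2[of x y] by simp
          qed
          then show ?thesis using that c(3)[of x] by simp
        qed
        then show "ennreal \<bar>c x - mollify r c x\<bar> \<le> ennreal e' * indicator (cball 0 (R + 2)) x"
          using \<delta>(2)[of r x] r by (auto simp: indicator_def intro!: ennreal_leI)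
      qed
      also have "\<dots> = ennreal (e' * V)" using e' V0 by (subst nn_integral_cmult_indicator) (auto simp: V ennreal_mult)
      also have "\<dots> \<le> ennreal (e/4)" using e' by (intro ennreal_leI)
      finally show ?thesis .
    qed
    have 2: "(\<integral>\<^sup>+x. ennreal \<bar>mollify r (\<lambda>x. g x - c x) x\<bar> \<partial>lborel) \<le> ennreal (e/4)"
    proof -
      have "\<bar>g x - c x\<bar> \<le> 2 * B" for x using B[of x] c(2)[of x] by linarith
      then have "(\<integral>\<^sup>+x. ennreal \<bar>mollify r (\<lambda>x. g x - c x) x\<bar> \<partial>lborel) \<le> (\<integral>\<^sup>+x. ennreal \<bar>g x - c x\<bar> \<partial>lborel)"
        by (intro mollify_L1_contract r(1)) measurable
      then show ?thesis using c(4) by simp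
    qed
    have "(\<integral>\<^sup>+x. ennreal \<bar>g x - mollify r g x\<bar> \<partial>lborel)
      \<le> (\<integral>\<^sup>+x. ennreal \<bar>g x - c x\<bar> + ennreal \<bar>c x - mollify r c x\<bar> + ennreal \<bar>mollify r (\<lambda>x. g x - c x) x\<bar> \<partial>lborel)"
      by (intro nn_integral_mono) (simp add: diff ennreal_plus[symmetric] del: ennreal_plus)
    also have "\<dots> = (\<integral>\<^sup>+x. ennreal \<bar>g x - c x\<bar> \<partial>lborel) + (\<integral>\<^sup>+x. ennreal \<bar>c x - mollify r c x\<bar> \<partial>lborel)
       + (\<integral>\<^sup>+x. ennreal \<bar>mollify r (\<lambda>x. g x - c x) x\<bar> \<partial>lborel)"
      by (subst nn_integral_add; (subst nn_integral_add)?) auto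
    also have "\<dots> \<le> ennreal (e/4) + ennreal (e/4) + ennreal (e/4)"
      using 1 2 c(4) by (intro add_mono) auto
    also have "\<dots> = ennreal (3 * e / 4)" using e by (simp add: ennreal_plus[symmetric] del: ennreal_plus)
    also have "\<dots> < ennreal e" using e by (intro ennreal_lessI) auto
    finally show ?thesis .
  qed
  then show ?thesis using \<delta>(1) by (intro exI[of _ "min \<delta> 1"]) auto
qed

subsection \<open>Energies and approximability\<close>

lemma ennroot_less_top_iff: "ennroot p x < \<infinity> \<longleftrightarrow> x < \<infinity>"
  by (auto simp: ennroot_def top.not_eq_extremum)

lemma ennroot_small:
  assumes "1 \<le> p" "0 < \<epsilon>" "x < ennreal (\<epsilon> powr p)"
  shows "ennroot p x < ennreal \<epsilon>"
proof -
  obtain r where r: "x = ennreal r" "0 \<le> r"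
    using assms(3) by (cases x) auto
  have "r < \<epsilon> powr p" using assms r by (simp add: ennreal_less_iff)
  then have "r powr (1/p) < (\<epsilon> powr p) powr (1/p)"
    using r assms by (intro powr_less_mono2) auto
  also have "\<dots> = \<epsilon>" using assms by (simp add: powr_powr)
  finally show ?thesis using r by (auto simp: ennroot_def ennreal_less_iff)
qed

lemma ennroot_le_imp:
  assumes "1 \<le> p" "0 \<le> \<epsilon>" "ennroot p x < ennreal \<epsilon>"
  shows "x \<le> ennreal (\<epsilon> powr p)"
proof -
  have "x < \<infinity>" using assms(3) ennroot_less_top_iff[of p x] by (metis ennreal_less_top infinity_ennreal_def order_less_trans)
  then obtain r where r: "x = ennreal r" "0 \<le> r" by (cases x) auto
  have "r powr (1/p) < \<epsilon>" using assms(3) r by (simp add: ennroot_def ennreal_less_iff)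
  then have "(r powr (1/p)) powr p \<le> \<epsilon> powr p" using assms by (intro powr_mono2) auto
  then have "r \<le> \<epsilon> powr p" using r assms by (simp add: powr_powr)
  then show ?thesis using r by (simp add: ennreal_leI)
qed

lemma bdist_measurable[measurable]: "bdist \<Omega> \<in> borel_measurable borel"
  unfolding bdist_def[abs_def] by (intro borel_measurable_continuous_onI continuous_intros)

lemma bdist_triangle: "bdist \<Omega> x \<le> bdist \<Omega> y + dist x y"
  unfolding bdist_def by (rule infdist_triangle)

lemma nn_integral_lebesgue_on:
  fixes \<Omega> :: "'a::euclidean_space set"
  assumes "open \<Omega>"
  shows "(\<integral>\<^sup>+x. f x \<partial>lebesgue_on \<Omega>) = (\<integral>\<^sup>+x. f x * indicator \<Omega> x \<partial>lborel)"
  using assms by (subst nn_integral_restrict_space) (auto simp: nn_integral_completion)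

locale wfrac =
  fixes \<Omega> :: "'a::euclidean_space set" and s p \<alpha> \<beta> :: real
  assumes nonempty: "\<Omega> \<noteq> {}" and bounded: "bounded \<Omega>" and open_dom: "open \<Omega>"
    and s_pos: "0 < s" and s_less: "s < 1" and p_ge: "1 \<le> p" and \<alpha>_nonneg: "0 \<le> \<alpha>" and \<beta>_nonneg: "0 \<le> \<beta>"
begin

abbreviation "dw \<equiv> bdist \<Omega>"

definition ker :: "'a \<Rightarrow> 'a \<Rightarrow> real" where
  "ker x y = 1 / dist x y powr (real DIM('a) + s * p) * dw y powr (- \<alpha>) * dw x powr (- \<beta>)"

text \<open>The p-th power of the seminorm, as one integral over a product measure, so that
  Tonelli's theorem and dominated convergence apply to it directly. The indicators replace the
  restriction to \<Omega>.\<close>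

definition en :: "('a \<Rightarrow> real) \<Rightarrow> ennreal" where
  "en g = (\<integral>\<^sup>+z. ennreal (\<bar>g (fst z) - g (snd z)\<bar> powr p * ker (fst z) (snd z))
      * indicator \<Omega> (fst z) * indicator \<Omega> (snd z) \<partial>(lborel \<Otimes>\<^sub>M lborel))"

definition lp :: "('a \<Rightarrow> real) \<Rightarrow> ennreal" where
  "lp g = (\<integral>\<^sup>+x. ennreal (\<bar>g x\<bar> powr p) * indicator \<Omega> x \<partial>lborel)"

lemma open_meas[measurable]: "\<Omega> \<in> sets borel"
  using open_dom by simp

lemma ker_nonneg: "0 \<le> ker x y"
  by (simp add: ker_def)

lemma ker_measurable[measurable]: "(\<lambda>z. ker (fst z) (snd z)) \<in> borel_measurable (borel \<Otimes>\<^sub>M borel)"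
  unfolding ker_def by measurable

lemma en_iterated:
  assumes [measurable]: "g \<in> borel_measurable borel"
  shows "en g = (\<integral>\<^sup>+x. (\<integral>\<^sup>+y. ennreal (\<bar>g x - g y\<bar> powr p * ker x y) * indicator \<Omega> x * indicator \<Omega> y \<partial>lborel) \<partial>lborel)"
  unfolding en_def by (subst lborel.nn_integral_fst[symmetric]) simp_all

lemma frontier_nonempty: "frontier \<Omega> \<noteq> {}"
  using nonempty bounded frontier_eq_empty not_bounded_UNIV by blast

lemma dw_pos: "x \<in> \<Omega> \<Longrightarrow> 0 < dw x"
proof -
  assume x: "x \<in> \<Omega>"
  have "x \<notin> frontier \<Omega>" using x open_dom frontier_disjoint_eq[of \<Omega>] by auto
  then show ?thesis unfolding bdist_def
    using infdist_pos_not_in_closed[OF frontier_closed frontier_nonempty] by blast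
qed

lemma Lp_norm_eq:
  assumes "AE x in lborel. x \<in> \<Omega> \<longrightarrow> f x = g x"
  shows "Lp_norm p \<Omega> f = ennroot p (lp g)"
proof -
  have "(\<integral>\<^sup>+x. ennreal (\<bar>f x\<bar> powr p) * indicator \<Omega> x \<partial>lborel) = lp g"
    unfolding lp_def using assms by (intro nn_integral_cong_AE) (auto elim!: eventually_mono simp: indicator_def)
  then show ?thesis unfolding Lp_norm_def by (simp add: nn_integral_lebesgue_on open_dom)
qed

text \<open>The seminorm is an iterated integral over \<open>lebesgue_on\<close>, where joint
  measurability of the integrand is not at hand. Exchanging \<open>f\<close> for a Borel function in
  each variable separately leads to the product integral \<open>en\<close>.\<close>

lemma W_seminorm_eq:
  assumes AE: "AE x in lborel. x \<in> \<Omega> \<longrightarrow> f x = g x" and [measurable]: "g \<in> borel_measurable borel"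
  shows "W_seminorm s p \<alpha> \<beta> \<Omega> f = ennroot p (en g)"
proof -
  have "(\<integral>\<^sup>+x. (\<integral>\<^sup>+y. ennreal (\<bar>f x - f y\<bar> powr p / dist x y powr (real DIM('a) + s * p)
          * dw y powr (- \<alpha>) * dw x powr (- \<beta>)) \<partial>lebesgue_on \<Omega>) \<partial>lebesgue_on \<Omega>)
     = (\<integral>\<^sup>+x. (\<integral>\<^sup>+y. ennreal (\<bar>f x - f y\<bar> powr p * ker x y) * indicator \<Omega> y \<partial>lborel) * indicator \<Omega> x \<partial>lborel)"
    by (simp add: nn_integral_lebesgue_on open_dom ker_def mult.assoc)
  also have "\<dots> = (\<integral>\<^sup>+x. (\<integral>\<^sup>+y. ennreal (\<bar>g x - g y\<bar> powr p * ker x y) * indicator \<Omega> x * indicator \<Omega> y \<partial>lborel) \<partial>lborel)"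
    using AE
  proof (intro nn_integral_cong_AE, eventually_elim)
    fix x assume x: "x \<in> \<Omega> \<longrightarrow> f x = g x"
    show "(\<integral>\<^sup>+y. ennreal (\<bar>f x - f y\<bar> powr p * ker x y) * indicator \<Omega> y \<partial>lborel) * indicator \<Omega> x
      = (\<integral>\<^sup>+y. ennreal (\<bar>g x - g y\<bar> powr p * ker x y) * indicator \<Omega> x * indicator \<Omega> y \<partial>lborel)"
    proof (cases "x \<in> \<Omega>")
      case True
      have "(\<integral>\<^sup>+y. ennreal (\<bar>f x - f y\<bar> powr p * ker x y) * indicator \<Omega> y \<partial>lborel)
        = (\<integral>\<^sup>+y. ennreal (\<bar>g x - g y\<bar> powr p * ker x y) * indicator \<Omega> y \<partial>lborel)"
        using AE x True by (intro nn_integral_cong_AE) (auto elim!: eventually_mono simp: indicator_def)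
      then show ?thesis using True by simp
    qed simp
  qed
  also have "\<dots> = en g" by (simp add: en_iterated)
  finally show ?thesis unfolding W_seminorm_def by simp
qed

lemma borel_representative:
  fixes f :: "'a \<Rightarrow> real"
  assumes "f \<in> borel_measurable (lebesgue_on \<Omega>)"
  obtains g where "g \<in> borel_measurable borel" "AE x in lborel. x \<in> \<Omega> \<longrightarrow> f x = g x"
proof -
  have "(\<lambda>x. indicator \<Omega> x *\<^sub>R f x) \<in> borel_measurable lebesgue"
    using assms open_dom by (subst (asm) borel_measurable_restrict_space_iff) auto
  from completion_ex_borel_measurable_real[OF this]
  obtain g where g: "g \<in> borel_measurable lborel" "AE x in lborel. indicator \<Omega> x *\<^sub>R f x = g x" by blast
  show ?thesis
  proof (rule that[of g])
    show "g \<in> borel_measurable borel" using g by simp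
    show "AE x in lborel. x \<in> \<Omega> \<longrightarrow> f x = g x"
      using g(2) by (auto elim!: eventually_mono)
  qed
qed

text \<open>Together with its analogue for \<open>en\<close> this replaces Minkowski's inequality;
  the factor \<open>2 powr p\<close> is harmless since only finiteness and smallness are at
  stake.\<close>

lemma lp_add:
  assumes [measurable]: "f \<in> borel_measurable borel" "g \<in> borel_measurable borel"
  shows "lp (\<lambda>x. f x + g x) \<le> ennreal (2 powr p) * (lp f + lp g)"
proof -
  have "lp (\<lambda>x. f x + g x) \<le> (\<integral>\<^sup>+x. ennreal (2 powr p) * (ennreal (\<bar>f x\<bar> powr p) * indicator \<Omega> x + ennreal (\<bar>g x\<bar> powr p) * indicator \<Omega> x) \<partial>lborel)"
    unfolding lp_def
  proof (rule nn_integral_mono)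
    fix x
    have "ennreal (\<bar>f x + g x\<bar> powr p) \<le> ennreal (2 powr p * (\<bar>f x\<bar> powr p + \<bar>g x\<bar> powr p))"
      using p_ge by (intro ennreal_leI abs_add_powr_le) auto
    then show "ennreal (\<bar>f x + g x\<bar> powr p) * indicator \<Omega> x
      \<le> ennreal (2 powr p) * (ennreal (\<bar>f x\<bar> powr p) * indicator \<Omega> x + ennreal (\<bar>g x\<bar> powr p) * indicator \<Omega> x)"
      by (auto simp: indicator_def ennreal_mult ennreal_plus)
  qed
  also have "\<dots> = ennreal (2 powr p) * (lp f + lp g)"
    unfolding lp_def by (subst nn_integral_cmult; (subst nn_integral_add)?) auto
  finally show ?thesis .
qed

lemma en_add:
  assumes [measurable]: "f \<in> borel_measurable borel" "g \<in> borel_measurable borel"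
  shows "en (\<lambda>x. f x + g x) \<le> ennreal (2 powr p) * (en f + en g)"
proof -
  let ?G = "\<lambda>g z. ennreal (\<bar>g (fst z) - g (snd z)\<bar> powr p * ker (fst z) (snd z)) * indicator \<Omega> (fst z) * indicator \<Omega> (snd z)"
  have "en (\<lambda>x. f x + g x) \<le> (\<integral>\<^sup>+z. ennreal (2 powr p) * (?G f z + ?G g z) \<partial>(lborel \<Otimes>\<^sub>M lborel))"
    unfolding en_def
  proof (rule nn_integral_mono)
    fix z :: "'a \<times> 'a"
    let ?a = "f (fst z) - f (snd z)" and ?b = "g (fst z) - g (snd z)" and ?k = "ker (fst z) (snd z)"
    have "\<bar>?a + ?b\<bar> powr p * ?k \<le> 2 powr p * (\<bar>?a\<bar> powr p + \<bar>?b\<bar> powr p) * ?k"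
      using p_ge by (intro mult_right_mono abs_add_powr_le ker_nonneg) auto
    then have "ennreal (\<bar>?a + ?b\<bar> powr p * ?k) \<le> ennreal (2 powr p * (\<bar>?a\<bar> powr p * ?k + \<bar>?b\<bar> powr p * ?k))"
      by (intro ennreal_leI) (simp add: algebra_simps)
    also have "\<dots> = ennreal (2 powr p) * (ennreal (\<bar>?a\<bar> powr p * ?k) + ennreal (\<bar>?b\<bar> powr p * ?k))"
      using ker_nonneg by (simp add: ennreal_mult ennreal_plus)
    finally show "ennreal (\<bar>f (fst z) + g (fst z) - (f (snd z) + g (snd z))\<bar> powr p * ?k) * indicator \<Omega> (fst z) * indicator \<Omega> (snd z)
      \<le> ennreal (2 powr p) * (?G f z + ?G g z)"
      by (auto simp: indicator_def algebra_simps)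
  qed
  also have "\<dots> = ennreal (2 powr p) * (en f + en g)"
    unfolding en_def by (subst nn_integral_cmult; (subst nn_integral_add)?) auto
  finally show ?thesis .
qed

text \<open>No finiteness is asked of the test function: when \<open>g\<close> and
  \<open>g - \<phi>\<close> have finite energy, so does \<phi>, by \<open>en_add\<close>.\<close>

definition approximable :: "('a \<Rightarrow> real) \<Rightarrow> bool" where
  "approximable g \<longleftrightarrow> (\<forall>\<delta>>0. \<exists>\<phi>\<in>Cc_smooth \<Omega>. lp (\<lambda>x. g x - \<phi> x) < ennreal \<delta> \<and> en (\<lambda>x. g x - \<phi> x) < ennreal \<delta>)"

lemma Cc_smooth_measurable: "\<phi> \<in> Cc_smooth \<Omega> \<Longrightarrow> \<phi> \<in> borel_measurable borel"
proof -
  assume "\<phi> \<in> Cc_smooth \<Omega>"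
  then have "Ck 0 \<phi>" unfolding Cc_smooth_def by blast
  then show ?thesis by (auto intro: borel_measurable_continuous_onI)
qed

lemma ennreal_two_powr_small:
  assumes "a < ennreal (\<delta> / (2 * 2 powr p))" "b < ennreal (\<delta> / (2 * 2 powr p))" "0 < \<delta>"
  shows "ennreal (2 powr p) * (a + b) < ennreal \<delta>"
proof -
  obtain r t where r: "a = ennreal r" "0 \<le> r" "b = ennreal t" "0 \<le> t"
    using assms by (cases a; cases b) auto
  then have "r < \<delta> / (2 * 2 powr p)" "t < \<delta> / (2 * 2 powr p)" using assms by (auto simp: ennreal_less_iff)
  then have "r + t < \<delta> / 2 powr p" by (simp add: field_simps)
  then have "2 powr p * (r + t) < \<delta>" by (simp add: field_simps)
  then show ?thesis using r by (simp add: ennreal_mult[symmetric] ennreal_plus[symmetric] ennreal_less_iff del: ennreal_plus)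
qed

text \<open>Closedness of the set of approximable functions; it allows the reductions to bounded and
  then to compactly supported functions to be made separately.\<close>

lemma approximable_limit:
  assumes [measurable]: "g \<in> borel_measurable borel"
    and "\<And>\<delta>. 0 < \<delta> \<Longrightarrow> \<exists>h\<in>borel_measurable borel. approximable h
      \<and> lp (\<lambda>x. g x - h x) < ennreal \<delta> \<and> en (\<lambda>x. g x - h x) < ennreal \<delta>"
  shows "approximable g"
  unfolding approximable_def
proof (intro allI impI)
  fix \<delta> :: real assume \<delta>: "0 < \<delta>"
  then have \<delta>': "0 < \<delta> / (2 * 2 powr p)" by simp
  obtain h where h[measurable]: "h \<in> borel_measurable borel" "approximable h"
      and 1: "lp (\<lambda>x. g x - h x) < ennreal (\<delta> / (2 * 2 powr p))" "en (\<lambda>x. g x - h x) < ennreal (\<delta> / (2 * 2 powr p))"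
    using assms(2)[OF \<delta>'] by blast
  obtain \<phi> where \<phi>: "\<phi> \<in> Cc_smooth \<Omega>"
      and 2: "lp (\<lambda>x. h x - \<phi> x) < ennreal (\<delta> / (2 * 2 powr p))" "en (\<lambda>x. h x - \<phi> x) < ennreal (\<delta> / (2 * 2 powr p))"
    using h(2) \<delta>' unfolding approximable_def by blast
  have [measurable]: "\<phi> \<in> borel_measurable borel" by (rule Cc_smooth_measurable[OF \<phi>])
  have "lp (\<lambda>x. g x - \<phi> x) \<le> ennreal (2 powr p) * (lp (\<lambda>x. g x - h x) + lp (\<lambda>x. h x - \<phi> x))"
    using lp_add[of "\<lambda>x. g x - h x" "\<lambda>x. h x - \<phi> x"] by simp
  also have "\<dots> < ennreal \<delta>" using 1 2 \<delta> by (intro ennreal_two_powr_small)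
  finally have l: "lp (\<lambda>x. g x - \<phi> x) < ennreal \<delta>" .
  have "en (\<lambda>x. g x - \<phi> x) \<le> ennreal (2 powr p) * (en (\<lambda>x. g x - h x) + en (\<lambda>x. h x - \<phi> x))"
    using en_add[of "\<lambda>x. g x - h x" "\<lambda>x. h x - \<phi> x"] by simp
  also have "\<dots> < ennreal \<delta>" using 1 2 \<delta> by (intro ennreal_two_powr_small)
  finally have "en (\<lambda>x. g x - \<phi> x) < ennreal \<delta>" .
  with l \<phi> show "\<exists>\<phi>\<in>Cc_smooth \<Omega>. lp (\<lambda>x. g x - \<phi> x) < ennreal \<delta> \<and> en (\<lambda>x. g x - \<phi> x) < ennreal \<delta>" by blast
qed

lemma lp_diff_commute: "lp (\<lambda>x. f x - g x) = lp (\<lambda>x. g x - f x)"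
  unfolding lp_def by (simp add: abs_minus_commute)

lemma en_diff_commute: "en (\<lambda>x. f x - g x) = en (\<lambda>x. g x - f x)"
proof -
  have "\<bar>f a - g a - (f b - g b)\<bar> = \<bar>g a - f a - (g b - f b)\<bar>" for a b by linarith
  then show ?thesis unfolding en_def by simp
qed

lemma W_space_iff:
  assumes "f \<in> borel_measurable (lebesgue_on \<Omega>)" "g \<in> borel_measurable borel" "AE x in lborel. x \<in> \<Omega> \<longrightarrow> f x = g x"
  shows "f \<in> W_space s p \<alpha> \<beta> \<Omega> \<longleftrightarrow> lp g < \<infinity> \<and> en g < \<infinity>"
  unfolding W_space_def Lp_space_def using assms
  using ennroot_less_top_iff[of p "lp g"] ennroot_less_top_iff[of p "en g"]
  by (simp add: Lp_norm_eq[OF assms(3)] W_seminorm_eq[OF assms(3)])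

lemma borel_imp_lebesgue_on: "g \<in> borel_measurable borel \<Longrightarrow> g \<in> borel_measurable (lebesgue_on \<Omega>)"
  by (intro measurable_restrict_space1 measurable_completion) simp

lemma W_norm_diff:
  assumes "AE x in lborel. x \<in> \<Omega> \<longrightarrow> f x = g x" and [measurable]: "g \<in> borel_measurable borel" "\<phi> \<in> borel_measurable borel"
  shows "W_norm s p \<alpha> \<beta> \<Omega> (\<lambda>x. f x - \<phi> x) = ennroot p (lp (\<lambda>x. g x - \<phi> x)) + ennroot p (en (\<lambda>x. g x - \<phi> x))"
proof -
  have AE: "AE x in lborel. x \<in> \<Omega> \<longrightarrow> f x - \<phi> x = g x - \<phi> x"
    using assms(1) by (auto elim!: eventually_mono)
  show ?thesis unfolding W_norm_def by (simp add: Lp_norm_eq[OF AE] W_seminorm_eq[OF AE])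
qed

lemma W0_eq_W:
  assumes appr: "\<And>g. g \<in> borel_measurable borel \<Longrightarrow> lp g < \<infinity> \<Longrightarrow> en g < \<infinity> \<Longrightarrow> approximable g"
  shows "W0_space s p \<alpha> \<beta> \<Omega> = W_space s p \<alpha> \<beta> \<Omega>"
proof
  show "W0_space s p \<alpha> \<beta> \<Omega> \<subseteq> W_space s p \<alpha> \<beta> \<Omega>" unfolding W0_space_def by blast
  show "W_space s p \<alpha> \<beta> \<Omega> \<subseteq> W0_space s p \<alpha> \<beta> \<Omega>"
  proof
    fix f assume f: "f \<in> W_space s p \<alpha> \<beta> \<Omega>"
    then have fm: "f \<in> borel_measurable (lebesgue_on \<Omega>)" by (simp add: W_space_def Lp_space_def)
    obtain g where g[measurable]: "g \<in> borel_measurable borel" and AE: "AE x in lborel. x \<in> \<Omega> \<longrightarrow> f x = g x"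
      using borel_representative[OF fm] by blast
    have fin: "lp g < \<infinity>" "en g < \<infinity>" using W_space_iff[OF fm g AE] f by auto
    have "\<exists>\<phi>\<in>Cc_smooth \<Omega> \<inter> W_space s p \<alpha> \<beta> \<Omega>. W_norm s p \<alpha> \<beta> \<Omega> (\<lambda>x. f x - \<phi> x) < ennreal \<epsilon>" if \<epsilon>: "0 < \<epsilon>" for \<epsilon>
    proof -
      obtain \<phi> where \<phi>: "\<phi> \<in> Cc_smooth \<Omega>" and l: "lp (\<lambda>x. g x - \<phi> x) < ennreal ((\<epsilon>/2) powr p)"
        and e: "en (\<lambda>x. g x - \<phi> x) < ennreal ((\<epsilon>/2) powr p)"
        using appr[OF g fin] \<epsilon> unfolding approximable_def by (metis half_gt_zero powr_gt_zero less_irrefl)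
      have \<phi>m[measurable]: "\<phi> \<in> borel_measurable borel" by (rule Cc_smooth_measurable[OF \<phi>])
      have "lp \<phi> < \<infinity>" "en \<phi> < \<infinity>"
      proof -
        have fin': "ennreal (2 powr p) * (a + b) < \<infinity>" if "a < ennreal t" "b < \<infinity>" for a b t
          using that order_less_trans[OF that(1) ennreal_less_top] by (simp add: ennreal_mult_less_top)
        show "lp \<phi> < \<infinity>"
          using lp_add[of "\<lambda>x. \<phi> x - g x" g] fin'[OF l fin(1)]
          by (simp add: lp_diff_commute[of \<phi>])
        show "en \<phi> < \<infinity>"
          using en_add[of "\<lambda>x. \<phi> x - g x" g] fin'[OF e fin(2)]
          by (simp add: en_diff_commute[of \<phi>])
      qed
      then have "\<phi> \<in> W_space s p \<alpha> \<beta> \<Omega>"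
        using W_space_iff[OF borel_imp_lebesgue_on \<phi>m] \<phi>m by auto
      moreover have "W_norm s p \<alpha> \<beta> \<Omega> (\<lambda>x. f x - \<phi> x) < ennreal \<epsilon>"
      proof -
        have "ennroot p (lp (\<lambda>x. g x - \<phi> x)) < ennreal (\<epsilon>/2)" "ennroot p (en (\<lambda>x. g x - \<phi> x)) < ennreal (\<epsilon>/2)"
          using l e \<epsilon> p_ge by (auto intro!: ennroot_small)
        then have "W_norm s p \<alpha> \<beta> \<Omega> (\<lambda>x. f x - \<phi> x) < ennreal (\<epsilon>/2) + ennreal (\<epsilon>/2)"
          unfolding W_norm_diff[OF AE g \<phi>m] by (rule add_strict_mono)
        also have "\<dots> = ennreal \<epsilon>" using \<epsilon> by (simp add: ennreal_plus[symmetric] del: ennreal_plus)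
        finally show ?thesis .
      qed
      ultimately show ?thesis using \<phi> by blast
    qed
    with f show "f \<in> W0_space s p \<alpha> \<beta> \<Omega>" unfolding W0_space_def by blast
  qed
qed

end

subsection \<open>Truncation and cutoff\<close>

definition clip :: "real \<Rightarrow> real \<Rightarrow> real" where
  "clip M t = max (- M) (min M t)"

context wfrac
begin

lemma lp_mono:
  assumes "\<And>x. x \<in> \<Omega> \<Longrightarrow> \<bar>f x\<bar> \<le> \<bar>g x\<bar>"
  shows "lp f \<le> lp g"
  unfolding lp_def using assms p_ge
  by (intro nn_integral_mono) (auto simp: indicator_def intro!: ennreal_leI powr_mono2)

lemma en_mono:
  assumes "\<And>x y. x \<in> \<Omega> \<Longrightarrow> y \<in> \<Omega> \<Longrightarrow> \<bar>f x - f y\<bar> \<le> \<bar>g x - g y\<bar>"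
  shows "en f \<le> en g"
  unfolding en_def using assms p_ge
  by (intro nn_integral_mono) (auto simp: indicator_def intro!: ennreal_leI powr_mono2 mult_right_mono ker_nonneg)

lemma lp_dominated_tendsto_0:
  assumes [measurable]: "\<And>n. u n \<in> borel_measurable borel" "g \<in> borel_measurable borel"
    and fin: "lp g < \<infinity>" and le: "\<And>n x. x \<in> \<Omega> \<Longrightarrow> \<bar>u n x\<bar> \<le> \<bar>g x\<bar>"
    and lim: "\<And>x. x \<in> \<Omega> \<Longrightarrow> (\<lambda>n. u n x) \<longlonglongrightarrow> 0"
  shows "(\<lambda>n. lp (u n)) \<longlonglongrightarrow> 0"
proof -
  have "(\<lambda>n. lp (u n)) \<longlonglongrightarrow> (\<integral>\<^sup>+x. 0 \<partial>(lborel :: 'a measure))"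
    unfolding lp_def
  proof (rule nn_integral_dominated_convergence)
    show "(\<integral>\<^sup>+x. ennreal (\<bar>g x\<bar> powr p) * indicator \<Omega> x \<partial>lborel) < \<infinity>" using fin by (simp add: lp_def)
    show "AE x in lborel. ennreal (\<bar>u n x\<bar> powr p) * indicator \<Omega> x \<le> ennreal (\<bar>g x\<bar> powr p) * indicator \<Omega> x" for n
      using le p_ge by (intro AE_I2) (auto simp: indicator_def intro!: ennreal_leI powr_mono2)
    show "AE x in lborel. (\<lambda>n. ennreal (\<bar>u n x\<bar> powr p) * indicator \<Omega> x) \<longlonglongrightarrow> 0"
    proof (rule AE_I2)
      fix x
      show "(\<lambda>n. ennreal (\<bar>u n x\<bar> powr p) * indicator \<Omega> x) \<longlonglongrightarrow> 0"
      proof (cases "x \<in> \<Omega>")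
        case True
        have "(\<lambda>n. \<bar>u n x\<bar> powr p) \<longlonglongrightarrow> 0"
          using lim[OF True] p_ge by (intro tendsto_zero_powrI[where b = p]) (auto simp: tendsto_rabs_zero_iff)
        then have "(\<lambda>n. ennreal (\<bar>u n x\<bar> powr p)) \<longlonglongrightarrow> ennreal 0" by (rule tendsto_ennrealI)
        then show ?thesis using True by simp
      qed simp
    qed
  qed measurable
  then show ?thesis by simp
qed

text \<open>The integrand \<open>v\<close> depends on the pair and need not be a difference of
  values of one function, a generality that \<open>en_mult_cutoff_tendsto_0\<close> relies
  on.\<close>

lemma energy_dominated_tendsto_0:
  fixes v :: "nat \<Rightarrow> 'a \<times> 'a \<Rightarrow> real"
  assumes [measurable]: "\<And>n. v n \<in> borel_measurable (borel \<Otimes>\<^sub>M borel)" "g \<in> borel_measurable borel"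
    and fin: "en g < \<infinity>" and le: "\<And>n x y. x \<in> \<Omega> \<Longrightarrow> y \<in> \<Omega> \<Longrightarrow> \<bar>v n (x, y)\<bar> \<le> \<bar>g x - g y\<bar>"
    and lim: "\<And>x y. x \<in> \<Omega> \<Longrightarrow> y \<in> \<Omega> \<Longrightarrow> (\<lambda>n. v n (x, y)) \<longlonglongrightarrow> 0"
  shows "(\<lambda>n. \<integral>\<^sup>+z. ennreal (\<bar>v n z\<bar> powr p * ker (fst z) (snd z)) * indicator \<Omega> (fst z) * indicator \<Omega> (snd z) \<partial>(lborel \<Otimes>\<^sub>M lborel)) \<longlonglongrightarrow> 0"
proof -
  have "(\<lambda>n. \<integral>\<^sup>+z. ennreal (\<bar>v n z\<bar> powr p * ker (fst z) (snd z)) * indicator \<Omega> (fst z) * indicator \<Omega> (snd z) \<partial>(lborel \<Otimes>\<^sub>M lborel))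
     \<longlonglongrightarrow> (\<integral>\<^sup>+z. 0 \<partial>((lborel :: 'a measure) \<Otimes>\<^sub>M (lborel :: 'a measure)))"
  proof (rule nn_integral_dominated_convergence)
    show "(\<integral>\<^sup>+z. ennreal (\<bar>g (fst z) - g (snd z)\<bar> powr p * ker (fst z) (snd z)) * indicator \<Omega> (fst z) * indicator \<Omega> (snd z) \<partial>(lborel \<Otimes>\<^sub>M lborel)) < \<infinity>"
      using fin by (simp add: en_def)
    show "AE z in lborel \<Otimes>\<^sub>M lborel. ennreal (\<bar>v n z\<bar> powr p * ker (fst z) (snd z)) * indicator \<Omega> (fst z) * indicator \<Omega> (snd z)
       \<le> ennreal (\<bar>g (fst z) - g (snd z)\<bar> powr p * ker (fst z) (snd z)) * indicator \<Omega> (fst z) * indicator \<Omega> (snd z)" for n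
      using le p_ge by (intro AE_I2) (auto simp: indicator_def intro!: ennreal_leI powr_mono2 mult_right_mono ker_nonneg)
    show "AE z in lborel \<Otimes>\<^sub>M lborel. (\<lambda>n. ennreal (\<bar>v n z\<bar> powr p * ker (fst z) (snd z)) * indicator \<Omega> (fst z) * indicator \<Omega> (snd z)) \<longlonglongrightarrow> 0"
    proof (rule AE_I2)
      fix z :: "'a \<times> 'a"
      show "(\<lambda>n. ennreal (\<bar>v n z\<bar> powr p * ker (fst z) (snd z)) * indicator \<Omega> (fst z) * indicator \<Omega> (snd z)) \<longlonglongrightarrow> 0"
      proof (cases "fst z \<in> \<Omega> \<and> snd z \<in> \<Omega>")
        case True
        then have "(\<lambda>n. v n z) \<longlonglongrightarrow> 0" using lim[of "fst z" "snd z"] by simp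
        then have "(\<lambda>n. \<bar>v n z\<bar> powr p) \<longlonglongrightarrow> 0"
          using p_ge by (intro tendsto_zero_powrI[where b = p]) (auto simp: tendsto_rabs_zero_iff)
        then have "(\<lambda>n. \<bar>v n z\<bar> powr p * ker (fst z) (snd z)) \<longlonglongrightarrow> 0" by (rule tendsto_mult_left_zero)
        then have "(\<lambda>n. ennreal (\<bar>v n z\<bar> powr p * ker (fst z) (snd z))) \<longlonglongrightarrow> ennreal 0" by (rule tendsto_ennrealI)
        then show ?thesis using True by simp
      qed auto
    qed
  qed measurable
  then show ?thesis by simp
qed

lemma en_dominated_tendsto_0:
  assumes [measurable]: "\<And>n. u n \<in> borel_measurable borel" "g \<in> borel_measurable borel"
    and fin: "en g < \<infinity>" and le: "\<And>n x y. x \<in> \<Omega> \<Longrightarrow> y \<in> \<Omega> \<Longrightarrow> \<bar>u n x - u n y\<bar> \<le> \<bar>g x - g y\<bar>"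
    and lim: "\<And>x. x \<in> \<Omega> \<Longrightarrow> (\<lambda>n. u n x) \<longlonglongrightarrow> 0"
  shows "(\<lambda>n. en (u n)) \<longlonglongrightarrow> 0"
  unfolding en_def
proof (rule energy_dominated_tendsto_0[where g = g])
  show "(\<lambda>n. u n (fst (x, y)) - u n (snd (x, y))) \<longlonglongrightarrow> 0" if "x \<in> \<Omega>" "y \<in> \<Omega>" for x y
    using tendsto_diff[OF lim[OF that(1)] lim[OF that(2)]] by simp
qed (use fin le in auto)

text \<open>Both \<open>clip M\<close> and its complement \<open>t - clip M t\<close> are
  1-Lipschitz, so truncation does not enlarge the energy and the integrand of \<open>g\<close>
  dominates that of the remainder.\<close>

lemma approximable_truncation:
  assumes g[measurable]: "g \<in> borel_measurable borel" and fin: "lp g < \<infinity>" "en g < \<infinity>"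
    and bd: "\<And>h M. h \<in> borel_measurable borel \<Longrightarrow> (\<And>x. \<bar>h x\<bar> \<le> M) \<Longrightarrow> lp h < \<infinity> \<Longrightarrow> en h < \<infinity> \<Longrightarrow> approximable h"
  shows "approximable g"
proof (rule approximable_limit[OF g])
  fix \<delta> :: real assume \<delta>: "0 < \<delta>"
  have [measurable]: "clip M \<in> borel_measurable borel" for M
    unfolding clip_def[abs_def] by measurable
  have ev: "\<forall>\<^sub>F n in sequentially. g x - clip (real n) (g x) = 0" for x
  proof -
    obtain N :: nat where N: "\<bar>g x\<bar> \<le> real N" using real_arch_simple by blast
    show ?thesis by (rule eventually_sequentiallyI[of N]) (use N in \<open>auto simp: clip_def\<close>)
  qed
  have l0: "(\<lambda>n. lp (\<lambda>x. g x - clip (real n) (g x))) \<longlonglongrightarrow> 0"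
    by (rule lp_dominated_tendsto_0[where g = g]) (use fin ev in \<open>auto simp: clip_def intro: tendsto_eventually\<close>)
  have e0: "(\<lambda>n. en (\<lambda>x. g x - clip (real n) (g x))) \<longlonglongrightarrow> 0"
    by (rule en_dominated_tendsto_0[where g = g]) (use fin ev in \<open>auto simp: clip_def intro: tendsto_eventually\<close>)
  have "\<forall>\<^sub>F n in sequentially. lp (\<lambda>x. g x - clip (real n) (g x)) < ennreal \<delta> \<and> en (\<lambda>x. g x - clip (real n) (g x)) < ennreal \<delta>"
    using order_tendstoD(2)[OF l0, of "ennreal \<delta>"] order_tendstoD(2)[OF e0, of "ennreal \<delta>"] \<delta>
    by (auto intro: eventually_conj)
  then obtain n where n: "lp (\<lambda>x. g x - clip (real n) (g x)) < ennreal \<delta>" "en (\<lambda>x. g x - clip (real n) (g x)) < ennreal \<delta>"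
    using eventually_happens'[OF sequentially_bot] by blast
  have "lp (\<lambda>x. clip (real n) (g x)) \<le> lp g" by (rule lp_mono) (auto simp: clip_def)
  moreover have "en (\<lambda>x. clip (real n) (g x)) \<le> en g" by (rule en_mono) (auto simp: clip_def)
  ultimately have "approximable (\<lambda>x. clip (real n) (g x))"
    using fin by (intro bd[of _ "real n"]) (auto simp: clip_def)
  with n show "\<exists>h\<in>borel_measurable borel. approximable h \<and> lp (\<lambda>x. g x - h x) < ennreal \<delta> \<and> en (\<lambda>x. g x - h x) < ennreal \<delta>"
    by (intro bexI[of _ "\<lambda>x. clip (real n) (g x)"]) auto
qed

text \<open>Discrete product rule: the difference of \<open>g * (1 - w)\<close> between
  \<open>x\<close> and \<open>y\<close> is
  \<open>(g x - g y) * (1 - w x) + g y * (w y - w x)\<close>. Dominated convergence treats the first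
  term; the bound \<open>M\<close> and the energy of \<open>w\<close> treat the second.\<close>

lemma en_mult_cutoff_tendsto_0:
  assumes [measurable]: "g \<in> borel_measurable borel" "\<And>n. w n \<in> borel_measurable borel"
    and M: "\<And>x. \<bar>g x\<bar> \<le> M" and fin: "en g < \<infinity>"
    and w: "\<And>n x. 0 \<le> w n x" "\<And>n x. w n x \<le> 1" and lim: "\<And>x. x \<in> \<Omega> \<Longrightarrow> (\<lambda>n. w n x) \<longlonglongrightarrow> 1"
    and ew: "(\<lambda>n. en (w n)) \<longlonglongrightarrow> 0"
  shows "(\<lambda>n. en (\<lambda>x. g x - g x * w n x)) \<longlonglongrightarrow> 0"
proof -
  define v where "v n z = (g (fst z) - g (snd z)) * (1 - w n (fst z))" for n z
  have [measurable]: "v n \<in> borel_measurable (borel \<Otimes>\<^sub>M borel)" for n unfolding v_def[abs_def] by measurable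
  let ?V = "\<lambda>n. \<integral>\<^sup>+z. ennreal (\<bar>v n z\<bar> powr p * ker (fst z) (snd z)) * indicator \<Omega> (fst z) * indicator \<Omega> (snd z) \<partial>(lborel \<Otimes>\<^sub>M lborel)"
  have "?V \<longlonglongrightarrow> 0"
  proof (rule energy_dominated_tendsto_0[where g = g])
    show "\<bar>v n (x, y)\<bar> \<le> \<bar>g x - g y\<bar>" for n x y
      unfolding v_def abs_mult fst_conv snd_conv using w[of n x] by (intro mult_right_le_one_le) auto
    show "(\<lambda>n. v n (x, y)) \<longlonglongrightarrow> 0" if "x \<in> \<Omega>" for x y
      unfolding v_def using tendsto_mult[OF tendsto_const[of "g x - g y"] tendsto_diff[OF tendsto_const[of 1] lim[OF that]]] by simp
  qed (use fin in auto)
  then have "(\<lambda>n. ennreal (2 powr p) * (?V n + ennreal (M powr p) * en (w n))) \<longlonglongrightarrow> ennreal (2 powr p) * (0 + ennreal (M powr p) * 0)"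
    using ew by (intro tendsto_intros ennreal_tendsto_cmult) auto
  then have L: "(\<lambda>n. ennreal (2 powr p) * (?V n + ennreal (M powr p) * en (w n))) \<longlonglongrightarrow> 0" by simp
  have "en (\<lambda>x. g x - g x * w n x) \<le> ennreal (2 powr p) * (?V n + ennreal (M powr p) * en (w n))" for n
  proof -
    have "en (\<lambda>x. g x - g x * w n x) \<le> (\<integral>\<^sup>+z. ennreal (2 powr p) * (ennreal (\<bar>v n z\<bar> powr p * ker (fst z) (snd z)) * indicator \<Omega> (fst z) * indicator \<Omega> (snd z)
        + ennreal (M powr p) * (ennreal (\<bar>w n (fst z) - w n (snd z)\<bar> powr p * ker (fst z) (snd z)) * indicator \<Omega> (fst z) * indicator \<Omega> (snd z))) \<partial>(lborel \<Otimes>\<^sub>M lborel))"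
      unfolding en_def
    proof (rule nn_integral_mono)
      fix z :: "'a \<times> 'a"
      let ?x = "fst z" and ?y = "snd z"
      let ?k = "ker ?x ?y" and ?b = "g ?y * (w n ?y - w n ?x)"
      have "\<bar>?b\<bar> powr p \<le> (M * \<bar>w n ?x - w n ?y\<bar>) powr p"
        using M[of ?y] p_ge by (intro powr_mono2) (auto simp: abs_mult abs_minus_commute intro!: mult_right_mono)
      also have "\<dots> = M powr p * \<bar>w n ?x - w n ?y\<bar> powr p"
        by (rule powr_mult)
      finally have b: "\<bar>?b\<bar> powr p \<le> M powr p * \<bar>w n ?x - w n ?y\<bar> powr p" .
      have "g ?x - g ?x * w n ?x - (g ?y - g ?y * w n ?y) = v n z + ?b" by (simp add: v_def algebra_simps)
      then have "\<bar>g ?x - g ?x * w n ?x - (g ?y - g ?y * w n ?y)\<bar> powr p \<le> 2 powr p * (\<bar>v n z\<bar> powr p + \<bar>?b\<bar> powr p)"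
        using abs_add_powr_le[of p "v n z" ?b] p_ge by simp
      also have "\<dots> \<le> 2 powr p * (\<bar>v n z\<bar> powr p + M powr p * \<bar>w n ?x - w n ?y\<bar> powr p)"
        using b by (intro mult_left_mono add_left_mono) auto
      finally have "\<bar>g ?x - g ?x * w n ?x - (g ?y - g ?y * w n ?y)\<bar> powr p * ?k
        \<le> 2 powr p * (\<bar>v n z\<bar> powr p + M powr p * \<bar>w n ?x - w n ?y\<bar> powr p) * ?k"
        by (intro mult_right_mono ker_nonneg)
      also have "\<dots> = 2 powr p * (\<bar>v n z\<bar> powr p * ?k + M powr p * (\<bar>w n ?x - w n ?y\<bar> powr p * ?k))"
        by (simp add: algebra_simps)
      finally have "ennreal (\<bar>g ?x - g ?x * w n ?x - (g ?y - g ?y * w n ?y)\<bar> powr p * ?k)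
        \<le> ennreal (2 powr p) * (ennreal (\<bar>v n z\<bar> powr p * ?k) + ennreal (M powr p) * ennreal (\<bar>w n ?x - w n ?y\<bar> powr p * ?k))"
        using ker_nonneg by (simp add: ennreal_mult[symmetric] ennreal_plus[symmetric] ennreal_leI del: ennreal_plus)
      then show "ennreal (\<bar>g ?x - g ?x * w n ?x - (g ?y - g ?y * w n ?y)\<bar> powr p * ?k) * indicator \<Omega> ?x * indicator \<Omega> ?y
        \<le> ennreal (2 powr p) * (ennreal (\<bar>v n z\<bar> powr p * ?k) * indicator \<Omega> ?x * indicator \<Omega> ?y
        + ennreal (M powr p) * (ennreal (\<bar>w n ?x - w n ?y\<bar> powr p * ?k) * indicator \<Omega> ?x * indicator \<Omega> ?y))"
        by (auto simp: indicator_def)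
    qed
    also have "\<dots> = ennreal (2 powr p) * (?V n + ennreal (M powr p) * en (w n))"
      unfolding en_def by (subst nn_integral_cmult; (subst nn_integral_add)?; (subst nn_integral_cmult)?) auto
    finally show ?thesis .
  qed
  then show ?thesis
    by (intro tendsto_sandwich[OF _ _ tendsto_const L]) auto
qed

lemma approximable_cutoff:
  assumes g[measurable]: "g \<in> borel_measurable borel" and w[measurable]: "\<And>n. w n \<in> borel_measurable borel"
    and M: "\<And>x. \<bar>g x\<bar> \<le> M" and fin: "lp g < \<infinity>" "en g < \<infinity>"
    and w01: "\<And>n x. 0 \<le> w n x" "\<And>n x. w n x \<le> 1" and lim: "\<And>x. x \<in> \<Omega> \<Longrightarrow> (\<lambda>n. w n x) \<longlonglongrightarrow> 1"
    and ew: "(\<lambda>n. en (w n)) \<longlonglongrightarrow> 0"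
    and appr: "\<And>n. lp (\<lambda>x. g x * w n x) < \<infinity> \<Longrightarrow> en (\<lambda>x. g x * w n x) < \<infinity> \<Longrightarrow> approximable (\<lambda>x. g x * w n x)"
  shows "approximable g"
proof (rule approximable_limit[OF g])
  fix \<delta> :: real assume \<delta>: "0 < \<delta>"
  have "\<bar>g x - g x * w n x\<bar> \<le> \<bar>g x\<bar>" for n x
  proof -
    have "\<bar>g x - g x * w n x\<bar> = \<bar>g x\<bar> * \<bar>1 - w n x\<bar>" by (simp add: abs_mult[symmetric] algebra_simps)
    also have "\<dots> \<le> \<bar>g x\<bar>" using w01[of n x] by (intro mult_right_le_one_le) auto
    finally show ?thesis .
  qed
  moreover have "(\<lambda>n. g x - g x * w n x) \<longlonglongrightarrow> 0" if "x \<in> \<Omega>" for x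
    using tendsto_diff[OF tendsto_const tendsto_mult[OF tendsto_const lim[OF that]], of "g x" "g x"] by simp
  ultimately have l0: "(\<lambda>n. lp (\<lambda>x. g x - g x * w n x)) \<longlonglongrightarrow> 0"
    using fin by (intro lp_dominated_tendsto_0[where g = g]) auto
  have e0: "(\<lambda>n. en (\<lambda>x. g x - g x * w n x)) \<longlonglongrightarrow> 0"
    using assms by (intro en_mult_cutoff_tendsto_0) auto
  have "\<forall>\<^sub>F n in sequentially. lp (\<lambda>x. g x - g x * w n x) < ennreal \<delta> \<and> en (\<lambda>x. g x - g x * w n x) < ennreal \<delta>"
    using order_tendstoD(2)[OF l0, of "ennreal \<delta>"] order_tendstoD(2)[OF e0, of "ennreal \<delta>"] \<delta>
    by (auto intro: eventually_conj)
  then obtain n where n: "lp (\<lambda>x. g x - g x * w n x) < ennreal \<delta>" "en (\<lambda>x. g x - g x * w n x) < ennreal \<delta>"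
    using eventually_happens'[OF sequentially_bot] by blast
  \<comment> \<open>That the product with the cutoff has finite norms is read off from the smallness
    of the remainder, hence for the chosen \<open>n\<close>.\<close>
  have fin': "ennreal (2 powr p) * (a + b) < \<infinity>" if "a < ennreal t" "b < \<infinity>" for a b t
    using that order_less_trans[OF that(1) ennreal_less_top] by (simp add: ennreal_mult_less_top)
  have "lp (\<lambda>x. g x * w n x) < \<infinity>"
    using lp_add[of "\<lambda>x. g x * w n x - g x" g] fin'[OF n(1) fin(1)]
    by (simp add: lp_diff_commute[of "\<lambda>x. g x * w n x"])
  moreover have "en (\<lambda>x. g x * w n x) < \<infinity>"
    using en_add[of "\<lambda>x. g x * w n x - g x" g] fin'[OF n(2) fin(2)]
    by (simp add: en_diff_commute[of "\<lambda>x. g x * w n x"])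
  ultimately have "approximable (\<lambda>x. g x * w n x)" by (rule appr)
  with n show "\<exists>h\<in>borel_measurable borel. approximable h \<and> lp (\<lambda>x. g x - h x) < ennreal \<delta> \<and> en (\<lambda>x. g x - h x) < ennreal \<delta>"
    by (intro bexI[of _ "\<lambda>x. g x * w n x"]) auto
qed

end

subsection \<open>Mollification of functions supported away from the boundary\<close>

lemma fst_snd_borel[measurable]:
  "(fst :: 'a::euclidean_space \<times> 'a \<Rightarrow> 'a) \<in> borel_measurable borel"
  "(snd :: 'a::euclidean_space \<times> 'a \<Rightarrow> 'a) \<in> borel_measurable borel"
  by (auto intro!: borel_measurable_continuous_onI continuous_intros)

text \<open>Neither weights nor domain occur: the kernel is invariant under translating both
  variables by the same vector, which is what makes mollification contractive.\<close>

definition near_energy :: "real \<Rightarrow> real \<Rightarrow> real \<Rightarrow> ('a::euclidean_space \<Rightarrow> real) \<Rightarrow> ennreal" where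
  "near_energy p q r g = (\<integral>\<^sup>+z. ennreal (\<bar>g (fst z) - g (snd z)\<bar> powr p / dist (fst z) (snd z) powr q)
     * indicator {z. dist (fst z) (snd z) < r} z \<partial>lborel)"

lemma near_set_borel[measurable]: "{z :: 'a::euclidean_space \<times> 'a. dist (fst z) (snd z) < r} \<in> sets borel"
  by (intro borel_open open_Collect_less continuous_intros)

text \<open>Jensen's inequality bounds the integrand by an average over shifts of the pair along the
  diagonal. These preserve distances, so translation invariance of Lebesgue measure on the product
  space gives back the energy of \<open>g\<close>.\<close>

lemma near_energy_mollify_le:
  fixes g :: "'a::euclidean_space \<Rightarrow> real"
  assumes p: "1 \<le> p" and e: "0 < e" and g[measurable]: "g \<in> borel_measurable borel" and B: "\<And>x. \<bar>g x\<bar> \<le> B"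
  shows "near_energy p q r (mollify e g) \<le> near_energy p q r g"
proof -
  define F where "F z = ennreal (\<bar>g (fst z) - g (snd z)\<bar> powr p / dist (fst z) (snd z) powr q)
     * indicator {z. dist (fst z) (snd z) < r} z" for z :: "'a \<times> 'a"
  have [measurable]: "F \<in> borel_measurable borel" unfolding F_def by measurable
  have "near_energy p q r (mollify e g) \<le> (\<integral>\<^sup>+w. (\<integral>\<^sup>+z. ennreal (mollifier e z) * F ((z, z) + w) \<partial>lborel) \<partial>lborel)"
    unfolding near_energy_def
  proof (rule nn_integral_mono)
    fix w :: "'a \<times> 'a"
    obtain x y where w: "w = (x, y)" by (cases w)
    show "ennreal (\<bar>mollify e g (fst w) - mollify e g (snd w)\<bar> powr p / dist (fst w) (snd w) powr q)
      * indicator {z. dist (fst z) (snd z) < r} w \<le> (\<integral>\<^sup>+z. ennreal (mollifier e z) * F ((z, z) + w) \<partial>lborel)"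
    proof (cases "dist x y < r")
      case True
      have "ennreal (\<bar>mollify e g x - mollify e g y\<bar> powr p / dist x y powr q)
        = ennreal (\<bar>mollify e g x - mollify e g y\<bar> powr p) * ennreal (1 / dist x y powr q)"
        by (subst ennreal_mult[symmetric]) auto
      also have "\<dots> \<le> (\<integral>\<^sup>+z. ennreal (mollifier e z) * ennreal (\<bar>g (z + x) - g (z + y)\<bar> powr p) \<partial>lborel) * ennreal (1 / dist x y powr q)"
        by (intro mult_right_mono mollify_jensen[OF p e g B]) auto
      also have "\<dots> = (\<integral>\<^sup>+z. ennreal (mollifier e z) * ennreal (\<bar>g (z + x) - g (z + y)\<bar> powr p) * ennreal (1 / dist x y powr q) \<partial>lborel)"
        by (subst nn_integral_multc) auto
      also have "\<dots> = (\<integral>\<^sup>+z. ennreal (mollifier e z) * F ((z, z) + w) \<partial>lborel)"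
        using True by (intro nn_integral_cong) (simp add: F_def w mult.assoc ennreal_mult[symmetric])
      finally show ?thesis using True w by simp
    qed (simp add: w)
  qed
  also have "\<dots> = (\<integral>\<^sup>+z. (\<integral>\<^sup>+w. ennreal (mollifier e z) * F ((z, z) + w) \<partial>lborel) \<partial>lborel)"
    by (rule lborel_pair.Fubini') measurable
  also have "\<dots> = (\<integral>\<^sup>+z. ennreal (mollifier e z) * near_energy p q r g \<partial>(lborel :: 'a measure))"
  proof (rule nn_integral_cong)
    fix z :: 'a
    have "(\<integral>\<^sup>+w. ennreal (mollifier e z) * F ((z, z) + w) \<partial>lborel) = ennreal (mollifier e z) * (\<integral>\<^sup>+w. F ((z, z) + w) \<partial>lborel)"
      by (rule nn_integral_cmult) measurable
    also have "(\<integral>\<^sup>+w. F ((z, z) + w) \<partial>lborel) = near_energy p q r g"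
      by (subst lborel_nn_integral_translation) (auto simp: near_energy_def F_def[abs_def])
    finally show "(\<integral>\<^sup>+w. ennreal (mollifier e z) * F ((z, z) + w) \<partial>lborel) = ennreal (mollifier e z) * near_energy p q r g" .
  qed
  also have "\<dots> = (\<integral>\<^sup>+z. ennreal (mollifier e z) \<partial>(lborel :: 'a measure)) * near_energy p q r g"
    by (rule nn_integral_multc) measurable
  also have "\<dots> = near_energy p q r g" using e by (simp add: nn_integral_mollifier)
  finally show ?thesis .
qed

lemma near_energy_diff_le:
  fixes f g :: "'a::euclidean_space \<Rightarrow> real"
  assumes p: "1 \<le> p" and [measurable]: "f \<in> borel_measurable borel" "g \<in> borel_measurable borel"
  shows "near_energy p q r (\<lambda>x. f x - g x) \<le> ennreal (2 powr p) * (near_energy p q r f + near_energy p q r g)"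
proof -
  let ?G = "\<lambda>g z. ennreal (\<bar>g (fst z) - g (snd z)\<bar> powr p / dist (fst z) (snd z) powr q) * indicator {z. dist (fst z) (snd z) < r} z"
  have "near_energy p q r (\<lambda>x. f x - g x) \<le> (\<integral>\<^sup>+z. ennreal (2 powr p) * (?G f z + ?G g z) \<partial>lborel)"
    unfolding near_energy_def
  proof (rule nn_integral_mono)
    fix z :: "'a \<times> 'a"
    let ?a = "f (fst z) - f (snd z)" and ?b = "g (snd z) - g (fst z)" and ?k = "dist (fst z) (snd z) powr q"
    have "\<bar>?a + ?b\<bar> powr p / ?k \<le> 2 powr p * (\<bar>?a\<bar> powr p + \<bar>?b\<bar> powr p) / ?k"
      using p by (intro divide_right_mono abs_add_powr_le) auto
    then have "ennreal (\<bar>?a + ?b\<bar> powr p / ?k) \<le> ennreal (2 powr p * (\<bar>?a\<bar> powr p / ?k + \<bar>?b\<bar> powr p / ?k))"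
      by (intro ennreal_leI) (simp add: algebra_simps add_divide_distrib)
    also have "\<dots> = ennreal (2 powr p) * (ennreal (\<bar>?a\<bar> powr p / ?k) + ennreal (\<bar>?b\<bar> powr p / ?k))"
      by (simp add: ennreal_mult ennreal_plus)
    finally show "ennreal (\<bar>f (fst z) - g (fst z) - (f (snd z) - g (snd z))\<bar> powr p / ?k) * indicator {z. dist (fst z) (snd z) < r} z
      \<le> ennreal (2 powr p) * (?G f z + ?G g z)"
      by (auto simp: indicator_def algebra_simps abs_minus_commute)
  qed
  also have "\<dots> = ennreal (2 powr p) * (near_energy p q r f + near_energy p q r g)"
    unfolding near_energy_def by (subst nn_integral_cmult; (subst nn_integral_add)?) auto
  finally show ?thesis .
qed

text \<open>A pair off the diagonal eventually leaves the strip; on the diagonal the integrand is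
  0.\<close>

lemma near_energy_tendsto_0:
  fixes g :: "'a::euclidean_space \<Rightarrow> real"
  assumes g[measurable]: "g \<in> borel_measurable borel" and d: "0 < d" and fin: "near_energy p q d g < \<infinity>" and e: "0 < e"
  shows "\<exists>r. 0 < r \<and> r \<le> d \<and> near_energy p q r g < ennreal e"
proof -
  have "(\<lambda>n. near_energy p q (d / real (Suc n)) g) \<longlonglongrightarrow> (\<integral>\<^sup>+z. 0 \<partial>(lborel :: ('a \<times> 'a) measure))"
    unfolding near_energy_def
  proof (rule nn_integral_dominated_convergence)
    show "(\<integral>\<^sup>+z. ennreal (\<bar>g (fst z) - g (snd z)\<bar> powr p / dist (fst z) (snd z) powr q)
     * indicator {z. dist (fst z) (snd z) < d} z \<partial>lborel) < \<infinity>" using fin by (simp add: near_energy_def)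
    have "d / real (Suc n) \<le> d" for n using d by (simp add: divide_le_eq)
    then show "AE z in lborel. ennreal (\<bar>g (fst z) - g (snd z)\<bar> powr p / dist (fst z) (snd z) powr q) * indicator {z. dist (fst z) (snd z) < d / real (Suc n)} z
      \<le> ennreal (\<bar>g (fst z) - g (snd z)\<bar> powr p / dist (fst z) (snd z) powr q) * indicator {z. dist (fst z) (snd z) < d} z" for n
      by (intro AE_I2 mult_left_mono) (auto simp: indicator_def intro: less_le_trans)
    show "AE z in lborel. (\<lambda>n. ennreal (\<bar>g (fst z) - g (snd z)\<bar> powr p / dist (fst z) (snd z) powr q) * indicator {z. dist (fst z) (snd z) < d / real (Suc n)} z) \<longlonglongrightarrow> 0"
    proof (rule AE_I2)
      fix z :: "'a \<times> 'a"
      show "(\<lambda>n. ennreal (\<bar>g (fst z) - g (snd z)\<bar> powr p / dist (fst z) (snd z) powr q) * indicator {z. dist (fst z) (snd z) < d / real (Suc n)} z) \<longlonglongrightarrow> 0"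
      proof (cases "dist (fst z) (snd z) = 0")
        case True then show ?thesis by simp
      next
        case False
        have "(\<lambda>n. d / real (Suc n)) \<longlonglongrightarrow> 0"
          by (rule LIMSEQ_Suc[of "\<lambda>n. d / real n"]) (rule lim_const_over_n)
        then have "\<forall>\<^sub>F n in sequentially. d / real (Suc n) < dist (fst z) (snd z)"
          using False by (intro order_tendstoD) auto
        then have "\<forall>\<^sub>F n in sequentially. ennreal (\<bar>g (fst z) - g (snd z)\<bar> powr p / dist (fst z) (snd z) powr q) * indicator {z. dist (fst z) (snd z) < d / real (Suc n)} z = 0"
          by (rule eventually_mono) (simp add: indicator_def)
        then show ?thesis by (rule tendsto_eventually)
      qed
    qed
  qed measurable
  then have "(\<lambda>n. near_energy p q (d / real (Suc n)) g) \<longlonglongrightarrow> 0" by simp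
  then have "\<forall>\<^sub>F n in sequentially. near_energy p q (d / real (Suc n)) g < ennreal e"
    using e by (intro order_tendstoD) auto
  then obtain n where "near_energy p q (d / real (Suc n)) g < ennreal e"
    using eventually_happens'[OF sequentially_bot] by blast
  moreover have "d / real (Suc n) \<le> d" using d by (simp add: divide_le_eq)
  ultimately show ?thesis using d by (intro exI[of _ "d / real (Suc n)"]) auto
qed

lemma nn_integral_lincomb3:
  fixes f g h :: "'b \<Rightarrow> ennreal"
  assumes "f \<in> borel_measurable M" "g \<in> borel_measurable M" "h \<in> borel_measurable M"
  shows "(\<integral>\<^sup>+z. a * f z + b * (c * g z + d * h z) \<partial>M) = a * integral\<^sup>N M f + b * (c * integral\<^sup>N M g + d * integral\<^sup>N M h)"
  using assms by (simp add: nn_integral_add nn_integral_cmult)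

context wfrac
begin

text \<open>The ball of radius \<open>dw x\<close> is connected and misses the frontier, so it
  cannot leave \<Omega>.\<close>

lemma mem_if_near:
  assumes "x \<in> \<Omega>" "dist x y < dw x"
  shows "y \<in> \<Omega>"
proof (rule ccontr)
  assume "y \<notin> \<Omega>"
  then have "y \<in> ball x (dw x) - \<Omega>" "x \<in> ball x (dw x) \<inter> \<Omega>"
    using assms le_less_trans[OF zero_le_dist assms(2)] by auto
  then have "ball x (dw x) \<inter> frontier \<Omega> \<noteq> {}"
    using connected_Int_frontier[of "ball x (dw x)" \<Omega>] connected_ball by blast
  then obtain a where "a \<in> frontier \<Omega>" "dist x a < dw x" by auto
  then show False using infdist_le[of a "frontier \<Omega>" x] by (simp add: bdist_def)
qed

lemma dw_bounded: "\<exists>D\<ge>1. \<forall>x\<in>\<Omega>. dw x \<le> D"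
proof -
  obtain a where a: "a \<in> frontier \<Omega>" using frontier_nonempty by blast
  obtain e where e: "\<And>x. x \<in> \<Omega> \<Longrightarrow> dist a x \<le> e" using bounded bounded_any_center[of \<Omega> a] by auto
  have "dw x \<le> max 1 e" if "x \<in> \<Omega>" for x
    using infdist_le[OF a, of x] e[OF that] by (simp add: bdist_def dist_commute)
  then show ?thesis by (intro exI[of _ "max 1 e"]) auto
qed

lemma compact_interior_region: "0 < t \<Longrightarrow> compact {x \<in> \<Omega>. t \<le> dw x}"
proof -
  assume t: "0 < t"
  have "{x \<in> \<Omega>. t \<le> dw x} = closure \<Omega> \<inter> {x. t \<le> dw x}"
  proof -
    have "x \<in> \<Omega>" if "x \<in> closure \<Omega>" "t \<le> dw x" for x
    proof (rule ccontr)
      assume "x \<notin> \<Omega>"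
      then have "x \<in> frontier \<Omega>" using that open_dom by (simp add: frontier_def interior_open)
      then have "dw x = 0" by (simp add: bdist_def)
      then show False using that t by simp
    qed
    then show ?thesis using closure_subset by auto
  qed
  moreover have "closed {x. t \<le> dw x}"
    unfolding bdist_def by (intro closed_Collect_le continuous_intros)
  ultimately show ?thesis using bounded
    by (simp add: compact_Int_closed compact_closure)
qed

text \<open>A pair within distance \<open>d\<close> on which \<open>g\<close> takes different values
  has a point at depth \<open>4 * d\<close>, so both points lie in \<Omega>. There the weights are
  bounded below, because depth is bounded on the bounded set \<Omega>.\<close>

lemma near_energy_le_en:
  assumes d: "0 < d" and g[measurable]: "g \<in> borel_measurable borel"
    and supp: "\<And>x. g x \<noteq> 0 \<Longrightarrow> x \<in> \<Omega> \<and> 4 * d \<le> dw x" and fin: "en g < \<infinity>"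
  shows "near_energy p (real DIM('a) + s * p) d g < \<infinity>"
proof -
  let ?q = "real DIM('a) + s * p"
  obtain D where D: "1 \<le> D" "\<And>x. x \<in> \<Omega> \<Longrightarrow> dw x \<le> D" using dw_bounded by blast
  have "near_energy p ?q d g \<le> (\<integral>\<^sup>+z. ennreal (D powr \<alpha> * D powr \<beta>) * (ennreal (\<bar>g (fst z) - g (snd z)\<bar> powr p * ker (fst z) (snd z))
      * indicator \<Omega> (fst z) * indicator \<Omega> (snd z)) \<partial>lborel)"
    unfolding near_energy_def
  proof (rule nn_integral_mono)
    fix z :: "'a \<times> 'a"
    obtain x y where z: "z = (x, y)" by (cases z)
    show "ennreal (\<bar>g (fst z) - g (snd z)\<bar> powr p / dist (fst z) (snd z) powr ?q) * indicator {z. dist (fst z) (snd z) < d} z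
      \<le> ennreal (D powr \<alpha> * D powr \<beta>) * (ennreal (\<bar>g (fst z) - g (snd z)\<bar> powr p * ker (fst z) (snd z))
      * indicator \<Omega> (fst z) * indicator \<Omega> (snd z))"
    proof (cases "dist x y < d \<and> g x \<noteq> g y")
      case True
      have xy: "x \<in> \<Omega> \<and> y \<in> \<Omega>"
      proof (cases "g x = 0")
        case True
        then have "y \<in> \<Omega>" "4 * d \<le> dw y" using supp[of y] \<open>dist x y < d \<and> g x \<noteq> g y\<close> by auto
        then show ?thesis using mem_if_near[of y x] \<open>dist x y < d \<and> g x \<noteq> g y\<close> d by (simp add: dist_commute)
      next
        case False
        then have "x \<in> \<Omega>" "4 * d \<le> dw x" using supp[of x] by auto
        then show ?thesis using mem_if_near[of x y] \<open>dist x y < d \<and> g x \<noteq> g y\<close> d by simp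
      qed
      have "D powr - \<alpha> \<le> dw y powr - \<alpha>" "D powr - \<beta> \<le> dw x powr - \<beta>"
        using xy D dw_pos \<alpha>_nonneg \<beta>_nonneg by (auto intro!: powr_mono2')
      then have "D powr \<alpha> * D powr - \<alpha> * (D powr \<beta> * D powr - \<beta>) \<le> D powr \<alpha> * dw y powr - \<alpha> * (D powr \<beta> * dw x powr - \<beta>)"
        by (intro mult_mono) auto
      moreover have "D powr \<alpha> * D powr - \<alpha> = 1" "D powr \<beta> * D powr - \<beta> = 1" using D by (auto simp: powr_minus)
      ultimately have 1: "1 \<le> D powr \<alpha> * dw y powr - \<alpha> * (D powr \<beta> * dw x powr - \<beta>)" by simp
      have "\<bar>g x - g y\<bar> powr p / dist x y powr ?q * 1 \<le> \<bar>g x - g y\<bar> powr p / dist x y powr ?q * (D powr \<alpha> * dw y powr - \<alpha> * (D powr \<beta> * dw x powr - \<beta>))"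
        by (rule mult_left_mono[OF 1]) simp
      also have "\<dots> = (D powr \<alpha> * D powr \<beta>) * (\<bar>g x - g y\<bar> powr p * ker x y)"
        by (simp add: ker_def)
      finally have "ennreal (\<bar>g x - g y\<bar> powr p / dist x y powr ?q) \<le> ennreal (D powr \<alpha> * D powr \<beta>) * ennreal (\<bar>g x - g y\<bar> powr p * ker x y)"
        using ker_nonneg by (simp add: ennreal_mult[symmetric] ennreal_leI)
      then show ?thesis using True xy z by simp
    next
      case False
      then show ?thesis using p_ge z by (auto simp: indicator_def)
    qed
  qed
  also have "\<dots> = (\<integral>\<^sup>+z. ennreal (D powr \<alpha> * D powr \<beta>) * (ennreal (\<bar>g (fst z) - g (snd z)\<bar> powr p * ker (fst z) (snd z))
      * indicator \<Omega> (fst z) * indicator \<Omega> (snd z)) \<partial>(lborel \<Otimes>\<^sub>M lborel))"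
    by (simp add: lborel_prod)
  also have "\<dots> = ennreal (D powr \<alpha> * D powr \<beta>) * en g"
    unfolding en_def by (rule nn_integral_cmult) measurable
  also have "\<dots> < \<infinity>" using fin by (simp add: ennreal_mult_less_top)
  finally show ?thesis .
qed

text \<open>Mass of the weight alone: in the energy of a function supported inside \<Omega>, one
  variable stays in the support while the other may come arbitrarily close to the boundary.\<close>

definition wmass :: "real \<Rightarrow> ennreal" where
  "wmass a = (\<integral>\<^sup>+x. ennreal (dw x powr (- a)) * indicator \<Omega> x \<partial>lborel)"

text \<open>For pairs closer than \<open>r\<close> on which \<open>u\<close> differs, both points
  have depth at least \<open>2 * d\<close> and the weights are bounded. For the other pairs the
  singular factor is at most \<open>r powr - q\<close>, and a point with \<open>u\<close> nonzero
  has depth at least \<open>3 * d\<close>, so only the weight at the other point can be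
  large.\<close>

lemma en_le_near_far:
  assumes d: "0 < d" and r: "0 < r" "r \<le> d" and u[measurable]: "u \<in> borel_measurable borel"
    and supp: "\<And>x. u x \<noteq> 0 \<Longrightarrow> x \<in> \<Omega> \<and> 3 * d \<le> dw x"
  defines "q \<equiv> real DIM('a) + s * p"
  shows "en u \<le> ennreal ((2 * d) powr - \<alpha> * (2 * d) powr - \<beta>) * near_energy p q r u
    + ennreal (r powr - q * 2 powr p) * (ennreal ((3 * d) powr - \<beta>) * wmass \<alpha> + ennreal ((3 * d) powr - \<alpha>) * wmass \<beta>)
      * (\<integral>\<^sup>+x. ennreal (\<bar>u x\<bar> powr p) \<partial>lborel)"
proof -
  let ?c = "r powr - q * 2 powr p"
  let ?N = "\<lambda>z. ennreal (\<bar>u (fst z) - u (snd z)\<bar> powr p / dist (fst z) (snd z) powr q) * indicator {z. dist (fst z) (snd z) < r} z"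
  let ?A = "\<lambda>z. ennreal (\<bar>u (fst z)\<bar> powr p) * (ennreal (dw (snd z) powr - \<alpha>) * indicator \<Omega> (snd z))"
  let ?B = "\<lambda>z. ennreal (\<bar>u (snd z)\<bar> powr p) * (ennreal (dw (fst z) powr - \<beta>) * indicator \<Omega> (fst z))"
  let ?U = "\<integral>\<^sup>+x. ennreal (\<bar>u x\<bar> powr p) \<partial>lborel"
  have q0: "0 < q" unfolding q_def using s_pos p_ge by (simp add: add_pos_pos)
  have wle: "\<bar>u x\<bar> powr p * dw x powr - a \<le> \<bar>u x\<bar> powr p * (3 * d) powr - a" if "0 \<le> a" for x a
  proof (cases "u x = 0")
    case False
    then have "dw x powr - a \<le> (3 * d) powr - a" using supp[of x] d that by (intro powr_mono2') auto
    then show ?thesis by (intro mult_left_mono) auto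
  qed (use p_ge in auto)
  have "en u \<le> (\<integral>\<^sup>+z. ennreal ((2 * d) powr - \<alpha> * (2 * d) powr - \<beta>) * ?N z
     + ennreal ?c * (ennreal ((3 * d) powr - \<beta>) * ?A z + ennreal ((3 * d) powr - \<alpha>) * ?B z) \<partial>(lborel \<Otimes>\<^sub>M lborel))"
    unfolding en_def
  proof (rule nn_integral_mono)
    fix z :: "'a \<times> 'a"
    obtain x y where z: "z = (x, y)" by (cases z)
    show "ennreal (\<bar>u (fst z) - u (snd z)\<bar> powr p * ker (fst z) (snd z)) * indicator \<Omega> (fst z) * indicator \<Omega> (snd z)
     \<le> ennreal ((2 * d) powr - \<alpha> * (2 * d) powr - \<beta>) * ?N z
     + ennreal ?c * (ennreal ((3 * d) powr - \<beta>) * ?A z + ennreal ((3 * d) powr - \<alpha>) * ?B z)"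
    proof (cases "x \<in> \<Omega> \<and> y \<in> \<Omega> \<and> u x \<noteq> u y")
      case True
      show ?thesis
      proof (cases "dist x y < r")
        case near: True
        have far: "2 * d \<le> dw x \<and> 2 * d \<le> dw y"
        proof (cases "u x = 0")
          case True
          then have "3 * d \<le> dw y" using supp[of y] \<open>x \<in> \<Omega> \<and> y \<in> \<Omega> \<and> u x \<noteq> u y\<close> by auto
          then show ?thesis using bdist_triangle[of \<Omega> y x] near r d by (auto simp: dist_commute)
        next
          case False
          then have "3 * d \<le> dw x" using supp[of x] by auto
          then show ?thesis using bdist_triangle[of \<Omega> x y] near r d by auto
        qed
        have "dw y powr - \<alpha> * dw x powr - \<beta> \<le> (2 * d) powr - \<alpha> * (2 * d) powr - \<beta>"
          using far d \<alpha>_nonneg \<beta>_nonneg by (intro mult_mono powr_mono2') auto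
        then have "\<bar>u x - u y\<bar> powr p / dist x y powr q * (dw y powr - \<alpha> * dw x powr - \<beta>)
           \<le> \<bar>u x - u y\<bar> powr p / dist x y powr q * ((2 * d) powr - \<alpha> * (2 * d) powr - \<beta>)"
          by (intro mult_left_mono) auto
        then have "\<bar>u x - u y\<bar> powr p * ker x y \<le> (2 * d) powr - \<alpha> * (2 * d) powr - \<beta> * (\<bar>u x - u y\<bar> powr p / dist x y powr q)"
          by (simp add: ker_def q_def mult_ac)
        then have "ennreal (\<bar>u x - u y\<bar> powr p * ker x y) \<le> ennreal ((2 * d) powr - \<alpha> * (2 * d) powr - \<beta>) * ennreal (\<bar>u x - u y\<bar> powr p / dist x y powr q)"
          by (subst ennreal_mult[symmetric]) (auto intro!: ennreal_leI)
        then show ?thesis using near True z by (simp add: add_increasing2)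
      next
        case False
        have "\<bar>u x - u y\<bar> powr p \<le> 2 powr p * (\<bar>u x\<bar> powr p + \<bar>u y\<bar> powr p)"
          using abs_add_powr_le[of p "u x" "- u y"] p_ge by simp
        moreover have "1 / dist x y powr q \<le> r powr - q"
          using False r q0 by (simp add: powr_minus_divide powr_mono2 frac_le)
        ultimately have "\<bar>u x - u y\<bar> powr p * (1 / dist x y powr q) \<le> 2 powr p * (\<bar>u x\<bar> powr p + \<bar>u y\<bar> powr p) * r powr - q"
          by (intro mult_mono) auto
        then have "\<bar>u x - u y\<bar> powr p * (1 / dist x y powr q) * (dw y powr - \<alpha> * dw x powr - \<beta>)
            \<le> 2 powr p * (\<bar>u x\<bar> powr p + \<bar>u y\<bar> powr p) * r powr - q * (dw y powr - \<alpha> * dw x powr - \<beta>)"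
          by (intro mult_right_mono) auto
        then have "\<bar>u x - u y\<bar> powr p * ker x y \<le> ?c * ((\<bar>u x\<bar> powr p * dw x powr - \<beta>) * dw y powr - \<alpha> + (\<bar>u y\<bar> powr p * dw y powr - \<alpha>) * dw x powr - \<beta>)"
          by (simp add: ker_def q_def algebra_simps)
        also have "\<dots> \<le> ?c * ((\<bar>u x\<bar> powr p * (3 * d) powr - \<beta>) * dw y powr - \<alpha> + (\<bar>u y\<bar> powr p * (3 * d) powr - \<alpha>) * dw x powr - \<beta>)"
          by (intro mult_left_mono[OF add_mono[OF mult_right_mono[OF wle] mult_right_mono[OF wle]]] \<alpha>_nonneg \<beta>_nonneg) auto
        also have "\<dots> = ?c * ((3 * d) powr - \<beta> * (\<bar>u x\<bar> powr p * dw y powr - \<alpha>) + (3 * d) powr - \<alpha> * (\<bar>u y\<bar> powr p * dw x powr - \<beta>))"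
          by (simp add: mult_ac)
        finally have "ennreal (\<bar>u x - u y\<bar> powr p * ker x y) \<le> ennreal (?c * ((3 * d) powr - \<beta> * (\<bar>u x\<bar> powr p * dw y powr - \<alpha>) + (3 * d) powr - \<alpha> * (\<bar>u y\<bar> powr p * dw x powr - \<beta>)))"
          by (rule ennreal_leI)
        also have "\<dots> = ennreal ?c * (ennreal ((3 * d) powr - \<beta>) * (ennreal (\<bar>u x\<bar> powr p) * ennreal (dw y powr - \<alpha>)) + ennreal ((3 * d) powr - \<alpha>) * (ennreal (\<bar>u y\<bar> powr p) * ennreal (dw x powr - \<beta>)))"
          by (simp only: ennreal_mult ennreal_plus powr_ge_zero mult_nonneg_nonneg add_nonneg_nonneg)
        finally show ?thesis using False True z by simp
      qed
    next
      case False
      then show ?thesis using p_ge z by (auto simp: indicator_def)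
    qed
  qed
  also have "\<dots> = ennreal ((2 * d) powr - \<alpha> * (2 * d) powr - \<beta>) * (\<integral>\<^sup>+z. ?N z \<partial>(lborel \<Otimes>\<^sub>M lborel))
     + ennreal ?c * (ennreal ((3 * d) powr - \<beta>) * (\<integral>\<^sup>+z. ?A z \<partial>(lborel \<Otimes>\<^sub>M lborel)) + ennreal ((3 * d) powr - \<alpha>) * (\<integral>\<^sup>+z. ?B z \<partial>(lborel \<Otimes>\<^sub>M lborel)))"
  proof -
    have [measurable]: "?N \<in> borel_measurable (lborel \<Otimes>\<^sub>M lborel)"
      "?A \<in> borel_measurable (lborel \<Otimes>\<^sub>M lborel)" "?B \<in> borel_measurable (lborel \<Otimes>\<^sub>M lborel)"
      by (simp_all add: lborel_prod)
    show ?thesis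
      by (rule nn_integral_lincomb3) measurable
  qed
  also have "(\<integral>\<^sup>+z. ?N z \<partial>(lborel \<Otimes>\<^sub>M lborel)) = near_energy p q r u"
    by (simp add: near_energy_def lborel_prod)
  also have "(\<integral>\<^sup>+z. ?A z \<partial>(lborel \<Otimes>\<^sub>M lborel)) = ?U * wmass \<alpha>"
    by (subst lborel.nn_integral_fst[symmetric]) (simp_all add: nn_integral_cmult nn_integral_multc wmass_def)
  also have "(\<integral>\<^sup>+z. ?B z \<partial>(lborel \<Otimes>\<^sub>M lborel)) = ?U * wmass \<beta>"
    by (subst lborel.nn_integral_fst[symmetric]) (simp_all add: nn_integral_cmult nn_integral_multc wmass_def mult.commute)
  finally show ?thesis by (simp add: algebra_simps)
qed

text \<open>The order of choices matters: \<open>r\<close> makes the near energy of \<open>g\<close>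
  small, which bounds that of every mollification as well. Only then is the mollification radius
  chosen, against the constant \<open>K\<close> that depends on \<open>r\<close>.\<close>

lemma approximable_mollify:
  assumes g[measurable]: "g \<in> borel_measurable borel" and M: "\<And>x. \<bar>g x\<bar> \<le> M" and d: "0 < d"
    and supp: "\<And>x. g x \<noteq> 0 \<Longrightarrow> x \<in> \<Omega> \<and> 4 * d \<le> dw x" and fin: "en g < \<infinity>"
    and mass: "wmass \<alpha> < \<infinity>" "wmass \<beta> < \<infinity>"
  shows "approximable g"
  unfolding approximable_def
proof (intro allI impI)
  fix \<eta> :: real assume \<eta>: "0 < \<eta>"
  define q where "q = real DIM('a) + s * p"
  obtain R where R: "\<And>x. x \<in> \<Omega> \<Longrightarrow> norm x \<le> R" using bounded bounded_iff by blast
  have gsupp: "g x = 0" if "R < norm x" for x using R[of x] supp[of x] that by force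
  have gint: "integrable lborel g" by (rule integrable_bounded_support[OF g M gsupp])
  have M0: "0 \<le> M" using M[of undefined] by linarith
  define c where "c = (2 * d) powr - \<alpha> * (2 * d) powr - \<beta>"
  have c0: "0 < c" using d by (simp add: c_def)
  have nfin: "near_energy p q d g < \<infinity>" unfolding q_def by (rule near_energy_le_en[OF d g supp fin])
  \<comment> \<open>Chosen so that the bound for the near part is half of \<eta>: a factor
    \<open>c\<close> for the weights, \<open>2 powr p\<close> for the difference, and 2 because
    \<open>g\<close> and its mollification both count.\<close>
  define \<eta>1 where "\<eta>1 = \<eta> / (2 * c * 2 powr p * 2)"
  have \<eta>1: "0 < \<eta>1" using \<eta> c0 by (simp add: \<eta>1_def)
  obtain r where r: "0 < r" "r \<le> d" and nr: "near_energy p q r g < ennreal \<eta>1"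
    using near_energy_tendsto_0[OF g d nfin \<eta>1] by blast
  define K where "K = ennreal (r powr - q * 2 powr p) * (ennreal ((3 * d) powr - \<beta>) * wmass \<alpha> + ennreal ((3 * d) powr - \<alpha>) * wmass \<beta>)"
  have "K < \<infinity>" using mass by (auto simp: K_def ennreal_mult_less_top)
  then obtain k where k: "K = ennreal k" "0 \<le> k" by (cases K) auto
  \<comment> \<open>Makes the integral of the p-th power of \<open>u\<close> at most
    \<open>\<eta> / (2 * (k + 1))\<close>, which the far constant \<open>k\<close> turns into less
    than half of \<eta>; the added 1s avoid division by zero.\<close>
  define e where "e = \<eta> / (2 * (k + 1) * ((2 * M) powr (p - 1) + 1))"
  have pos: "0 < (2 * M) powr (p - 1) + 1" by (simp add: add_nonneg_pos)
  have e0: "0 < e" using \<eta> k pos by (simp add: e_def)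
  obtain \<delta> where \<delta>: "\<delta> > 0" "\<And>t. 0 < t \<Longrightarrow> t \<le> \<delta> \<Longrightarrow> (\<integral>\<^sup>+x. ennreal \<bar>g x - mollify t g x\<bar> \<partial>lborel) < ennreal e"
    using mollify_L1_close[of g M R e, OF g M gsupp e0] by blast
  define t where "t = min \<delta> d"
  have t: "0 < t" "t \<le> \<delta>" "t \<le> d" using \<delta> d by (auto simp: t_def)
  let ?\<phi> = "mollify t g"
  define u where "u x = g x - ?\<phi> x" for x
  have \<phi>m[measurable]: "?\<phi> \<in> borel_measurable borel" by (rule mollify_measurable[OF gint t(1)])
  have um[measurable]: "u \<in> borel_measurable borel" unfolding u_def[abs_def] by measurable
  have \<phi>supp: "x \<in> \<Omega> \<and> 3 * d \<le> dw x" if "?\<phi> x \<noteq> 0" for x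
  proof -
    obtain y where y: "dist x y < t" "g y \<noteq> 0" using mollify_eq_0[OF t(1), of x g] \<open>?\<phi> x \<noteq> 0\<close> by blast
    then have yd: "y \<in> \<Omega>" "4 * d \<le> dw y" using supp by auto
    then have "x \<in> \<Omega>" using mem_if_near[of y x] y t d by (simp add: dist_commute)
    moreover have "3 * d \<le> dw x" using bdist_triangle[of \<Omega> y x] y yd t by (simp add: dist_commute)
    ultimately show ?thesis by simp
  qed
  have usupp: "x \<in> \<Omega> \<and> 3 * d \<le> dw x" if "u x \<noteq> 0" for x
    using \<phi>supp[of x] supp[of x] that d unfolding u_def by force
  have \<phi>C: "?\<phi> \<in> Cc_smooth \<Omega>"
  proof -
    have "closure {x. ?\<phi> x \<noteq> 0} \<subseteq> {x \<in> \<Omega>. 3 * d \<le> dw x}"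
      using \<phi>supp d by (intro closure_minimal compact_imp_closed compact_interior_region) auto
    moreover have "compact (closure {x. ?\<phi> x \<noteq> 0})"
      using \<phi>supp by (auto simp: compact_closure intro: bounded_subset[OF bounded])
    ultimately show ?thesis using Ck_mollify[OF gint t(1)] unfolding Cc_smooth_def by auto
  qed
  have ub: "\<bar>u x\<bar> \<le> 2 * M" for x
    using M[of x] mollify_bounded[OF t(1) g M, of x] by (simp add: u_def)
  define U where "U = (\<integral>\<^sup>+x. ennreal (\<bar>u x\<bar> powr p) \<partial>lborel)"
  \<comment> \<open>Since \<open>u\<close> is bounded by \<open>2 * M\<close>, closeness in the
    first power gives closeness in the p-th.\<close>
  have "U \<le> (\<integral>\<^sup>+x. ennreal ((2 * M) powr (p - 1)) * ennreal \<bar>u x\<bar> \<partial>lborel)"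
    unfolding U_def
  proof (rule nn_integral_mono)
    fix x
    have "\<bar>u x\<bar> powr p = \<bar>u x\<bar> powr (p - 1) * \<bar>u x\<bar>" by (cases "u x = 0") (auto simp: powr_diff)
    also have "\<dots> \<le> (2 * M) powr (p - 1) * \<bar>u x\<bar>" using ub p_ge by (intro mult_right_mono powr_mono2) auto
    finally show "ennreal (\<bar>u x\<bar> powr p) \<le> ennreal ((2 * M) powr (p - 1)) * ennreal \<bar>u x\<bar>"
      by (simp add: ennreal_mult[symmetric] ennreal_leI)
  qed
  also have "\<dots> = ennreal ((2 * M) powr (p - 1)) * (\<integral>\<^sup>+x. ennreal \<bar>u x\<bar> \<partial>lborel)"
    by (rule nn_integral_cmult) measurable
  also have "\<dots> \<le> ennreal ((2 * M) powr (p - 1)) * ennreal e"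
    using \<delta>(2)[OF t(1,2)] by (intro mult_left_mono) (auto simp: u_def)
  also have "\<dots> = ennreal ((2 * M) powr (p - 1) * e)" using e0 by (simp add: ennreal_mult)
  also have "\<dots> \<le> ennreal (\<eta> / (2 * (k + 1)))"
  proof (rule ennreal_leI)
    have "(2 * M) powr (p - 1) * e \<le> ((2 * M) powr (p - 1) + 1) * e" using e0 by (intro mult_right_mono) auto
    also have "\<dots> = \<eta> / (2 * (k + 1))" using pos k by (simp add: e_def)
    finally show "(2 * M) powr (p - 1) * e \<le> \<eta> / (2 * (k + 1))" .
  qed
  finally have U: "U \<le> ennreal (\<eta> / (2 * (k + 1)))" .
  have "lp u \<le> U"
    unfolding lp_def U_def by (intro nn_integral_mono) (auto simp: indicator_def)
  also note U
  also have "ennreal (\<eta> / (2 * (k + 1))) < ennreal \<eta>"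
    using \<eta> k by (intro ennreal_lessI) (auto simp: field_simps intro: add_pos_nonneg)
  finally have l: "lp u < ennreal \<eta>" .
  have "near_energy p q r u \<le> ennreal (2 powr p) * (near_energy p q r g + near_energy p q r ?\<phi>)"
    unfolding u_def by (rule near_energy_diff_le[OF p_ge g \<phi>m])
  also have "\<dots> \<le> ennreal (2 powr p) * (near_energy p q r g + near_energy p q r g)"
    by (intro mult_left_mono add_left_mono near_energy_mollify_le[OF p_ge t(1) g M]) auto
  also have "\<dots> \<le> ennreal (2 powr p) * (ennreal \<eta>1 + ennreal \<eta>1)"
    using nr by (intro mult_left_mono add_mono) auto
  also have "\<dots> = ennreal (2 powr p * (\<eta>1 + \<eta>1))"
    using \<eta>1 by (simp add: ennreal_mult[symmetric] ennreal_plus[symmetric] del: ennreal_plus)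
  finally have n: "near_energy p q r u \<le> ennreal (2 powr p * (\<eta>1 + \<eta>1))" .
  have "en u \<le> ennreal c * near_energy p q r u + K * U"
    using en_le_near_far[OF d r um usupp] by (simp add: c_def K_def q_def U_def)
  also have "\<dots> \<le> ennreal c * ennreal (2 powr p * (\<eta>1 + \<eta>1)) + ennreal k * ennreal (\<eta> / (2 * (k + 1)))"
    unfolding k using n U by (intro add_mono mult_left_mono) auto
  also have "\<dots> = ennreal (c * (2 powr p * (\<eta>1 + \<eta>1)) + k * (\<eta> / (2 * (k + 1))))"
    using c0 \<eta>1 \<eta> k by (simp add: ennreal_mult[symmetric] ennreal_plus[symmetric] del: ennreal_plus)
  also have "\<dots> < ennreal \<eta>"
  proof (rule ennreal_lessI[OF \<eta>])
    have "c * (2 powr p * (\<eta>1 + \<eta>1)) = \<eta> / 2" using c0 by (simp add: \<eta>1_def)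
    moreover have "k * (\<eta> / (2 * (k + 1))) < \<eta> / 2" using \<eta> k by (simp add: field_simps)
    ultimately show "c * (2 powr p * (\<eta>1 + \<eta>1)) + k * (\<eta> / (2 * (k + 1))) < \<eta>" by linarith
  qed
  finally have "en u < ennreal \<eta>" .
  with l \<phi>C show "\<exists>\<phi>\<in>Cc_smooth \<Omega>. lp (\<lambda>x. g x - \<phi> x) < ennreal \<eta> \<and> en (\<lambda>x. g x - \<phi> x) < ennreal \<eta>"
    unfolding u_def by blast
qed

end

subsection \<open>Logarithmic cutoffs\<close>

text \<open>For the tail of the kernel: used with exponent \<open>s / 2\<close>, it consumes only
  half of the decay at infinity.\<close>

lemma ln_one_plus_le_powr:
  fixes u a :: real
  assumes "1 \<le> u" "0 < a" "a \<le> 1"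
  shows "ln (1 + u) \<le> 2 / a * u powr a"
proof -
  have "ln (1 + u) \<le> (1 + u) powr a / a" using assms by (intro ln_powr_bound) auto
  also have "(1 + u) powr a \<le> (2 * u) powr a" using assms by (intro powr_mono2) auto
  also have "(2 * u) powr a = 2 powr a * u powr a" by (rule powr_mult)
  also have "2 powr a \<le> 2 powr 1" using assms by (intro powr_mono) auto
  finally show ?thesis using assms by (simp add: divide_right_mono mult_right_mono)
qed

lemma two_powr_diff_mult: "(2::real) powr (g - real j * t) = 2 powr g * (2 powr - t) ^ j"
proof -
  have "(2 powr - t) ^ j = (2 powr - t) powr real j" by (simp add: powr_realpow)
  also have "\<dots> = (2::real) powr (- (real j * t))" by (simp add: powr_powr mult.commute)
  finally show ?thesis by (simp add: powr_add[symmetric])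
qed

lemma nn_integral_lincomb2:
  fixes g h :: "'b \<Rightarrow> ennreal"
  assumes "g \<in> borel_measurable M" "h \<in> borel_measurable M"
  shows "(\<integral>\<^sup>+z. b * (c * g z + d * h z) \<partial>M) = b * (c * integral\<^sup>N M g + d * integral\<^sup>N M h)"
  using assms by (simp add: nn_integral_add nn_integral_cmult)

text \<open>The shape of the layer sum for a cutoff: \<open>N\<close> comparable terms, followed by
  a geometric tail.\<close>

lemma suminf_ennreal_initial_geometric_le:
  fixes F :: "nat \<Rightarrow> ennreal" and a r :: real
  assumes r: "0 \<le> r" "r < 1" and a: "0 \<le> a"
    and init: "\<And>k. k < N \<Longrightarrow> F k \<le> ennreal a" and tail: "\<And>k. F (k + N) \<le> ennreal (a * r ^ k)"
  shows "(\<Sum>k. F k) \<le> ennreal (a * (real N + 1 / (1 - r)))"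
proof -
  have "(\<Sum>k. F k) = (\<Sum>k. F (k + N)) + (\<Sum>k<N. F k)"
    by (rule suminf_offset) auto
  also have "(\<Sum>k. F (k + N)) \<le> ennreal (a / (1 - r))"
    by (rule suminf_ennreal_geometric_le[OF r a tail])
  also have "(\<Sum>k<N. F k) \<le> (\<Sum>k<N. ennreal a)" using init by (intro sum_mono) auto
  also have "\<dots> = ennreal (real N * a)" using a by (simp add: ennreal_of_nat_eq_real_of_nat ennreal_mult)
  also have "ennreal (a / (1 - r)) + ennreal (real N * a) = ennreal (a * (real N + 1 / (1 - r)))"
    using a r by (subst ennreal_plus[symmetric]) (auto simp: algebra_simps)
  finally show ?thesis by (auto simp: add_right_mono add_left_mono)
qed

context wfrac
begin

definition "gam = s * p + \<alpha> + \<beta>"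

lemma sp_pos: "0 < s * p" using s_pos p_ge by simp

lemma sp_less: "s * p < p" using s_less p_ge by simp

definition layer :: "nat \<Rightarrow> 'a set" where
  "layer k = {x \<in> \<Omega>. dw x < 2 powr - real k}"

lemma layer_borel[measurable]: "layer k \<in> sets borel"
proof -
  have "layer k = \<Omega> \<inter> {x. dw x < 2 powr - real k}" by (auto simp: layer_def)
  moreover have "open {x. dw x < 2 powr - real k}"
    unfolding bdist_def by (intro open_Collect_less continuous_intros)
  ultimately show ?thesis using open_dom by (simp add: open_Int)
qed

lemma layer_bracket:
  assumes "y \<in> layer N"
  obtains k where "N \<le> k" "y \<in> layer k" "2 powr - real (Suc k) \<le> dw y"
proof -
  have y: "y \<in> \<Omega>" "dw y < 2 powr - real N" using assms by (auto simp: layer_def)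
  have "(2::real) powr - real N \<le> 2 powr 0" by (intro powr_mono) auto
  then have "0 < dw y" "dw y < 1" using y dw_pos by auto
  then obtain k where k: "2 powr - real (Suc k) \<le> dw y" "dw y < 2 powr - real k" using ex_dyadic_bracket by blast
  have "(2::real) powr - real (Suc k) < 2 powr - real N" using k y by linarith
  then have "N \<le> k" by simp
  with k y show ?thesis by (intro that[of k]) (auto simp: layer_def)
qed

text \<open>The logarithmic expression is 1 at depth \<open>2 powr - real N\<close> and 0 at depth
  \<open>2 powr (- 2 * real N)\<close>. For \<open>N = 0\<close> division by zero turns the function
  into the indicator of \<Omega>, which is of no use as a cutoff; sequences therefore run over
  \<open>Suc n\<close>.\<close>

definition cutoff :: "nat \<Rightarrow> 'a \<Rightarrow> real" where
  "cutoff N x = indicator \<Omega> x * max 0 (min 1 (2 + log 2 (dw x) / real N))"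

lemma cutoff_measurable[measurable]: "cutoff N \<in> borel_measurable borel"
  unfolding cutoff_def[abs_def] by measurable

lemma cutoff_bounds: "0 \<le> cutoff N x" "cutoff N x \<le> 1"
  by (auto simp: cutoff_def indicator_def)

lemma log_le_iff_powr: "0 < t \<Longrightarrow> 0 < N \<Longrightarrow> c + log 2 t / real N \<le> e \<longleftrightarrow> t \<le> 2 powr ((e - c) * real N)"
  by (simp add: le_diff_eq[symmetric] pos_divide_le_eq log_le_iff add.commute[of c])

lemma cutoff_nonzero:
  assumes "0 < N" "cutoff N x \<noteq> 0"
  shows "x \<in> \<Omega> \<and> 2 powr (- 2 * real N) \<le> dw x"
proof -
  have x: "x \<in> \<Omega>" using assms by (auto simp: cutoff_def indicator_def split: if_splits)
  have "\<not> 2 + log 2 (dw x) / real N \<le> 0" using assms by (auto simp: cutoff_def max_def min_def split: if_splits)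
  then show ?thesis using log_le_iff_powr[of "dw x" N 2 0] dw_pos[OF x] assms x by auto
qed

lemma cutoff_tendsto: "x \<in> \<Omega> \<Longrightarrow> (\<lambda>N. cutoff N x) \<longlonglongrightarrow> 1"
proof -
  assume x: "x \<in> \<Omega>"
  have "(\<lambda>N. indicator \<Omega> x * max 0 (min 1 (2 + log 2 (dw x) / real N))) \<longlonglongrightarrow> indicator \<Omega> x * max 0 (min 1 (2 + 0))"
    by (intro tendsto_intros lim_const_over_n)
  then show ?thesis using x by (simp add: cutoff_def)
qed

text \<open>The cutoff vanishes up to depth \<open>2 powr (- 2 * real N)\<close>, so
  \<open>y\<close> may be treated as if its depth were \<tau>. The increment is then at most the
  logarithm of \<open>dw x / \<tau>\<close>, normalised, and
  \<open>dw x \<le> \<tau> + dist x y\<close>.\<close>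

lemma cutoff_diff:
  assumes N: "0 < N" and xy: "x \<in> \<Omega>" "y \<in> \<Omega>" "dw y \<le> dw x" and ne: "cutoff N x \<noteq> cutoff N y"
  defines "\<tau> \<equiv> max (dw y) (2 powr (- 2 * real N))"
  shows "y \<in> layer N" and "\<tau> \<le> dw x" and "\<bar>cutoff N x - cutoff N y\<bar> \<le> ln (1 + dist x y / \<tau>) / (real N * ln 2)"
proof -
  define L where "L t = 2 + log 2 t / real N" for t
  have Lmono: "L a \<le> L b" if "0 < a" "a \<le> b" for a b
    using that N by (auto simp: L_def intro!: divide_right_mono)
  have pos: "0 < dw x" "0 < dw y" using xy dw_pos by auto
  have cx: "cutoff N x = max 0 (min 1 (L (dw x)))" "cutoff N y = max 0 (min 1 (L (dw y)))"
    using xy by (auto simp: cutoff_def L_def)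
  have Lxy: "L (dw y) \<le> L (dw x)" using pos xy by (intro Lmono)
  show "y \<in> layer N"
  proof (rule ccontr)
    assume "y \<notin> layer N"
    then have "2 powr (- real N) \<le> dw y" using xy by (auto simp: layer_def)
    then have "L (2 powr (- real N)) \<le> L (dw y)" by (intro Lmono) auto
    then have "1 \<le> L (dw y)" using N by (simp add: L_def)
    then show False using ne Lxy unfolding cx by auto
  qed
  have L0: "L (2 powr (- 2 * real N)) = 0" using N by (simp add: L_def)
  have far: "2 powr (- 2 * real N) \<le> dw x"
  proof (rule ccontr)
    assume "\<not> 2 powr (- 2 * real N) \<le> dw x"
    then have "L (dw x) \<le> L (2 powr (- 2 * real N))" using pos by (intro Lmono) auto
    then show False using ne Lxy L0 unfolding cx by auto
  qed
  then show \<tau>x: "\<tau> \<le> dw x" using xy by (simp add: \<tau>_def)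
  have \<tau>0: "0 < \<tau>" using pos by (simp add: \<tau>_def)
  have cy: "cutoff N y = max 0 (min 1 (L \<tau>))"
  proof (cases "dw y \<le> 2 powr (- 2 * real N)")
    case True
    then have "L (dw y) \<le> 0" using Lmono[OF pos(2) True] L0 by simp
    then show ?thesis using True L0 unfolding cx by (simp add: \<tau>_def)
  qed (simp add: cx \<tau>_def)
  have "L \<tau> \<le> L (dw x)" using \<tau>0 \<tau>x by (rule Lmono)
  then have "\<bar>cutoff N x - cutoff N y\<bar> \<le> L (dw x) - L \<tau>" unfolding cx(1) cy by auto
  also have "\<dots> = (ln (dw x) - ln \<tau>) / (real N * ln 2)"
    using N by (simp add: L_def log_def field_simps)
  also have "ln (dw x) - ln \<tau> = ln (dw x / \<tau>)" using pos \<tau>0 by (simp add: ln_div)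
  also have "\<dots> \<le> ln (1 + dist x y / \<tau>)"
  proof -
    have "dw x \<le> \<tau> + dist x y" using bdist_triangle[of \<Omega> x y] by (simp add: \<tau>_def)
    then have "dw x / \<tau> \<le> 1 + dist x y / \<tau>" using \<tau>0 by (simp add: field_simps)
    then show ?thesis using pos \<tau>0 by (intro ln_mono) auto
  qed
  finally show "\<bar>cutoff N x - cutoff N y\<bar> \<le> ln (1 + dist x y / \<tau>) / (real N * ln 2)"
    by (simp add: divide_right_mono)
qed

section \<open>Energy of the logarithmic cutoffs\<close>

text \<open>The point \<open>y\<close> nearer to the boundary is frozen and the farther point
  \<open>x\<close>, which carries the weight exponent \<open>b\<close>, is integrated out; the depth
  of \<open>y\<close> then sets the scale of the whole slice.\<close>

definition slice :: "nat \<Rightarrow> real \<Rightarrow> 'a \<Rightarrow> ennreal" where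
  "slice N b y = (\<integral>\<^sup>+x. ennreal (\<bar>cutoff N x - cutoff N y\<bar> powr p / dist x y powr (real DIM('a) + s * p) * dw x powr - b)
     * indicator {x \<in> \<Omega>. dw y \<le> dw x} x \<partial>lborel)"

definition slice_const :: real where
  "slice_const = ln 2 powr - p * (inner_const DIM('a) (p - s * p) + (4 / s) powr p * outer_const DIM('a) (s * p / 2))"

lemma slice_const_nonneg: "0 \<le> slice_const"
  unfolding slice_const_def using sp_pos sp_less
  by (intro mult_nonneg_nonneg add_nonneg_nonneg inner_const_nonneg outer_const_nonneg) auto

text \<open>In units of \<tau> the slice is controlled by a fixed integral of a power of
  \<open>ln (1 + u)\<close> against the kernel. Near the centre \<open>ln (1 + u) \<le> u\<close>
  and \<open>s * p < p\<close> give convergence, at infinity the logarithm is below a small power.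
  What remains is the scaling factor \<open>\<tau> powr (- b - s * p)\<close>.\<close>

lemma slice_le:
  assumes N: "0 < N" and y: "y \<in> \<Omega>" and b: "0 \<le> b"
  shows "slice N b y \<le> ennreal (real N powr - p * slice_const * max (dw y) (2 powr (- 2 * real N)) powr (- b - s * p)) * indicator (layer N) y"
proof (cases "y \<in> layer N")
  case False
  have "slice N b y = (\<integral>\<^sup>+x. 0 \<partial>(lborel :: 'a measure))"
    unfolding slice_def
  proof (rule nn_integral_cong)
    fix x
    show "ennreal (\<bar>cutoff N x - cutoff N y\<bar> powr p / dist x y powr (real DIM('a) + s * p) * dw x powr - b)
     * indicator {x \<in> \<Omega>. dw y \<le> dw x} x = 0"
      using cutoff_diff(1)[OF N _ y, of x] False p_ge by (auto simp: indicator_def)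
  qed
  then show ?thesis by simp
next
  case True
  let ?q = "real DIM('a) + s * p"
  define \<tau> where "\<tau> = max (dw y) (2 powr (- 2 * real N))"
  have \<tau>0: "0 < \<tau>" using dw_pos[OF y] by (simp add: \<tau>_def)
  define A where "A = (real N * ln 2) powr - p * \<tau> powr - b"
  let ?I = "\<lambda>x. ennreal (dist y x powr (p - s * p - real DIM('a))) * indicator (ball y \<tau>) x"
  let ?O = "\<lambda>x. ennreal (dist y x powr (- (s * p / 2) - real DIM('a))) * indicator (- ball y \<tau>) x"
  have [measurable]: "(\<lambda>x. indicator (ball y \<tau>) x :: ennreal) \<in> borel_measurable borel"
      "(\<lambda>x. indicator (- ball y \<tau>) x :: ennreal) \<in> borel_measurable borel"
    by (auto intro!: borel_measurable_indicator)
  have "slice N b y \<le> (\<integral>\<^sup>+x. ennreal A * (ennreal (\<tau> powr - p) * ?I x + ennreal ((4 / s) powr p * \<tau> powr - (s * p / 2)) * ?O x) \<partial>lborel)"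
    unfolding slice_def
  proof (rule nn_integral_mono)
    fix x
    show "ennreal (\<bar>cutoff N x - cutoff N y\<bar> powr p / dist x y powr ?q * dw x powr - b) * indicator {x \<in> \<Omega>. dw y \<le> dw x} x
      \<le> ennreal A * (ennreal (\<tau> powr - p) * ?I x + ennreal ((4 / s) powr p * \<tau> powr - (s * p / 2)) * ?O x)"
    proof (cases "x \<in> \<Omega> \<and> dw y \<le> dw x \<and> cutoff N x \<noteq> cutoff N y")
      case False
      then show ?thesis using p_ge by (auto simp: indicator_def)
    next
      case True
      define u where "u = dist x y / \<tau>"
      have "x \<noteq> y" using True by auto
      then have u0: "0 < u" using \<tau>0 by (simp add: u_def)
      have du: "dist y x = u * \<tau>" using \<tau>0 by (simp add: u_def dist_commute)
      have cd: "\<tau> \<le> dw x" "\<bar>cutoff N x - cutoff N y\<bar> \<le> ln (1 + u) / (real N * ln 2)"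
        using cutoff_diff(2,3)[OF N _ y, of x] True by (auto simp: \<tau>_def u_def)
      have "\<bar>cutoff N x - cutoff N y\<bar> powr p \<le> (ln (1 + u) / (real N * ln 2)) powr p"
        using cd p_ge by (intro powr_mono2) auto
      also have "\<dots> = ln (1 + u) powr p * (real N * ln 2) powr - p"
        using u0 N by (subst powr_divide) (simp_all add: powr_minus divide_inverse)
      finally have c: "\<bar>cutoff N x - cutoff N y\<bar> powr p \<le> ln (1 + u) powr p * (real N * ln 2) powr - p" .
      have dwb: "dw x powr - b \<le> \<tau> powr - b" using cd \<tau>0 b by (intro powr_mono2') auto
      have "\<bar>cutoff N x - cutoff N y\<bar> powr p / dist x y powr ?q * dw x powr - b
         \<le> ln (1 + u) powr p * (real N * ln 2) powr - p / dist x y powr ?q * \<tau> powr - b"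
        by (intro mult_mono divide_right_mono c dwb) auto
      also have "\<dots> = A * (ln (1 + u) powr p / dist y x powr ?q)"
        by (simp add: A_def dist_commute)
      finally have 1: "ennreal (\<bar>cutoff N x - cutoff N y\<bar> powr p / dist x y powr ?q * dw x powr - b) \<le> ennreal A * ennreal (ln (1 + u) powr p / dist y x powr ?q)"
        by (subst ennreal_mult[symmetric]) (auto simp: A_def intro!: ennreal_leI)
      have 2: "ennreal (ln (1 + u) powr p / dist y x powr ?q) \<le> ennreal (\<tau> powr - p) * ?I x + ennreal ((4 / s) powr p * \<tau> powr - (s * p / 2)) * ?O x"
      proof (cases "dist y x < \<tau>")
        case True
        have "ln (1 + u) powr p \<le> u powr p" using u0 p_ge by (intro powr_mono2 ln_add_one_self_le_self) auto
        then have "ln (1 + u) powr p / dist y x powr ?q \<le> u powr p / dist y x powr ?q" by (rule divide_right_mono) simp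
        also have "u powr p = dist y x powr p * \<tau> powr - p"
          using \<tau>0 u0 unfolding du by (subst powr_mult) (simp add: powr_minus)
        also have "dist y x powr p * \<tau> powr - p / dist y x powr ?q = \<tau> powr - p * (dist y x powr p / dist y x powr ?q)" by simp
        also have "dist y x powr p / dist y x powr ?q = dist y x powr (p - s * p - real DIM('a))"
          by (subst powr_diff[symmetric]) (rule arg_cong[where f = "\<lambda>e. dist y x powr e"], simp)
        finally show ?thesis using True by (simp add: ennreal_mult[symmetric] ennreal_leI)
      next
        case False
        then have u1: "1 \<le> u" using \<tau>0 by (simp add: u_def dist_commute)
        \<comment> \<open>The p-th power of this bound grows with exponent \<open>s * p / 2\<close>,
          leaving the kernel a decay beyond the dimension of \<open>s * p / 2\<close>, still
          integrable at infinity.\<close>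
        have "ln (1 + u) \<le> 2 / (s/2) * u powr (s/2)" using u1 s_pos s_less by (intro ln_one_plus_le_powr) auto
        then have "ln (1 + u) powr p \<le> (4 / s * u powr (s/2)) powr p" using u0 p_ge by (intro powr_mono2) auto
        also have "\<dots> = (4 / s) powr p * u powr (s * p / 2)"
          by (subst powr_mult) (simp add: powr_powr mult.commute)
        finally have "ln (1 + u) powr p / dist y x powr ?q \<le> (4 / s) powr p * u powr (s * p / 2) / dist y x powr ?q" by (rule divide_right_mono) simp
        also have "u powr (s * p / 2) = dist y x powr (s * p / 2) * \<tau> powr - (s * p / 2)"
          using \<tau>0 u0 unfolding du by (subst powr_mult) (simp add: powr_minus)
        also have "(4 / s) powr p * (dist y x powr (s * p / 2) * \<tau> powr - (s * p / 2)) / dist y x powr ?q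
            = (4 / s) powr p * \<tau> powr - (s * p / 2) * (dist y x powr (s * p / 2) / dist y x powr ?q)" by simp
        also have "dist y x powr (s * p / 2) / dist y x powr ?q = dist y x powr (- (s * p / 2) - real DIM('a))"
          by (subst powr_diff[symmetric]) (rule arg_cong[where f = "\<lambda>e. dist y x powr e"], simp)
        finally show ?thesis using False by (simp add: ennreal_mult[symmetric] ennreal_leI)
      qed
      show ?thesis using True order_trans[OF 1 mult_left_mono[OF 2]] by simp
    qed
  qed
  also have "\<dots> = ennreal A * (ennreal (\<tau> powr - p) * integral\<^sup>N lborel ?I + ennreal ((4 / s) powr p * \<tau> powr - (s * p / 2)) * integral\<^sup>N lborel ?O)"
    by (rule nn_integral_lincomb2) measurable
  also have "\<dots> \<le> ennreal A * (ennreal (\<tau> powr - p) * ennreal (inner_const DIM('a) (p - s * p) * \<tau> powr (p - s * p))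
      + ennreal ((4 / s) powr p * \<tau> powr - (s * p / 2)) * ennreal (outer_const DIM('a) (s * p / 2) * \<tau> powr - (s * p / 2)))"
    using sp_pos sp_less \<tau>0
    by (intro mult_left_mono add_mono nn_integral_inner_powr_le nn_integral_outer_powr_le) auto
  also have "\<dots> = ennreal (A * (\<tau> powr - p * (inner_const DIM('a) (p - s * p) * \<tau> powr (p - s * p))
      + (4 / s) powr p * \<tau> powr - (s * p / 2) * (outer_const DIM('a) (s * p / 2) * \<tau> powr - (s * p / 2))))"
    using inner_const_nonneg[of "p - s * p" "DIM('a)"] outer_const_nonneg[of "s * p / 2" "DIM('a)"] sp_pos sp_less
    by (simp add: ennreal_mult[symmetric] ennreal_plus[symmetric] A_def del: ennreal_plus)
  also have "A * (\<tau> powr - p * (inner_const DIM('a) (p - s * p) * \<tau> powr (p - s * p))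
      + (4 / s) powr p * \<tau> powr - (s * p / 2) * (outer_const DIM('a) (s * p / 2) * \<tau> powr - (s * p / 2)))
      = real N powr - p * slice_const * \<tau> powr (- b - s * p)"
  proof -
    have f1: "\<tau> powr - p * \<tau> powr (p - s * p) = \<tau> powr - (s * p)"
      and f2: "\<tau> powr - (s * p / 2) * \<tau> powr - (s * p / 2) = \<tau> powr - (s * p)"
      by (simp_all add: mult.commute flip: powr_add)
    have e1: "\<tau> powr - p * (I * \<tau> powr (p - s * p)) = I * \<tau> powr - (s * p)" for I
      unfolding f1[symmetric] by simp
    have e2: "c * \<tau> powr - (s * p / 2) * (I * \<tau> powr - (s * p / 2)) = c * (I * \<tau> powr - (s * p))" for I c
      unfolding f2[symmetric] by simp
    have m1: "\<tau> powr (- b - s * p) = \<tau> powr - b * \<tau> powr - (s * p)" by (simp flip: powr_add)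
    have m2: "(real N * ln 2) powr - p = real N powr - p * ln 2 powr - p" by (rule powr_mult)
    have eq: "(n * l * b') * (i * t + c * (j * t)) = n * (l * (i + c * j)) * (b' * t)" for n l b' i t c j :: real
      by (simp add: algebra_simps)
    show ?thesis unfolding e1 e2 A_def slice_const_def m1 m2 by (rule eq)
  qed
  finally show ?thesis using True by (simp add: \<tau>_def)
qed

lemma dw_le_borel[measurable]: "{z :: 'a \<times> 'a. dw (fst z) \<le> dw (snd z)} \<in> sets (borel \<Otimes>\<^sub>M borel)"
  unfolding borel_prod bdist_def by (intro borel_closed closed_Collect_le continuous_intros)

lemma slice_measurable[measurable]: "slice N b \<in> borel_measurable borel"
proof -
  have "slice N b = (\<lambda>y. \<integral>\<^sup>+x. ennreal (\<bar>cutoff N x - cutoff N y\<bar> powr p / dist x y powr (real DIM('a) + s * p) * dw x powr - b)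
     * (indicator \<Omega> x * indicator {z. dw (fst z) \<le> dw (snd z)} (y, x)) \<partial>lborel)"
    unfolding slice_def by (auto simp: indicator_def intro!: nn_integral_cong ext)
  also have "\<dots> \<in> borel_measurable borel" by measurable
  finally show ?thesis .
qed

text \<open>Pairs are sorted by which point is nearer to the boundary; the two halves differ by
  exchanging \<alpha> and \<beta>.\<close>

lemma en_cutoff_le_slices:
  "en (cutoff N) \<le> (\<integral>\<^sup>+y. ennreal (dw y powr - \<alpha>) * slice N \<beta> y * indicator \<Omega> y \<partial>lborel)
     + (\<integral>\<^sup>+x. ennreal (dw x powr - \<beta>) * slice N \<alpha> x * indicator \<Omega> x \<partial>lborel)"
proof -
  let ?q = "real DIM('a) + s * p"
  let ?k = "\<lambda>b x y. ennreal (\<bar>cutoff N x - cutoff N y\<bar> powr p / dist x y powr ?q * dw x powr - b) * indicator {x \<in> \<Omega>. dw y \<le> dw x} x"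
  let ?A = "\<lambda>z. ennreal (dw (snd z) powr - \<alpha>) * ?k \<beta> (fst z) (snd z) * indicator \<Omega> (snd z)"
  let ?B = "\<lambda>z. ennreal (dw (fst z) powr - \<beta>) * ?k \<alpha> (snd z) (fst z) * indicator \<Omega> (fst z)"
  have ind: "(indicator {x \<in> \<Omega>. dw y \<le> dw x} x :: ennreal) = indicator \<Omega> x * indicator {z. dw (fst z) \<le> dw (snd z)} (y, x)" for x y
    by (auto simp: indicator_def)
  have [measurable]: "?A \<in> borel_measurable (lborel \<Otimes>\<^sub>M lborel)" "?B \<in> borel_measurable (lborel \<Otimes>\<^sub>M lborel)"
    unfolding ind by measurable
  have "en (cutoff N) \<le> (\<integral>\<^sup>+z. ?A z + ?B z \<partial>(lborel \<Otimes>\<^sub>M lborel))"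
    unfolding en_def
  proof (rule nn_integral_mono)
    fix z :: "'a \<times> 'a"
    obtain x y where z: "z = (x, y)" by (cases z)
    show "ennreal (\<bar>cutoff N (fst z) - cutoff N (snd z)\<bar> powr p * ker (fst z) (snd z)) * indicator \<Omega> (fst z) * indicator \<Omega> (snd z) \<le> ?A z + ?B z"
    proof (cases "x \<in> \<Omega> \<and> y \<in> \<Omega>")
      case True
      show ?thesis
      proof (cases "dw y \<le> dw x")
        case le: True
        have "ennreal (\<bar>cutoff N x - cutoff N y\<bar> powr p * ker x y) = ?A z"
          using True le z by (simp add: ker_def ennreal_mult[symmetric] mult_ac)
        then show ?thesis using True z by (simp add: add_increasing2)
      next
        case False
        then have "ennreal (\<bar>cutoff N x - cutoff N y\<bar> powr p * ker x y) = ?B z"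
          using True z by (simp add: ker_def ennreal_mult[symmetric] mult_ac dist_commute abs_minus_commute)
        then show ?thesis using True z by (simp add: add_increasing)
      qed
    qed (auto simp: z)
  qed
  also have "\<dots> = (\<integral>\<^sup>+z. ?A z \<partial>(lborel \<Otimes>\<^sub>M lborel)) + (\<integral>\<^sup>+z. ?B z \<partial>(lborel \<Otimes>\<^sub>M lborel))"
    by (rule nn_integral_add) measurable
  also have "(\<integral>\<^sup>+z. ?A z \<partial>(lborel \<Otimes>\<^sub>M lborel)) = (\<integral>\<^sup>+y. (\<integral>\<^sup>+x. ?A (x, y) \<partial>lborel) \<partial>lborel)"
    by (rule lborel_pair.nn_integral_snd[symmetric]) measurable
  also have "\<dots> = (\<integral>\<^sup>+y. ennreal (dw y powr - \<alpha>) * slice N \<beta> y * indicator \<Omega> y \<partial>lborel)"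
    unfolding slice_def by (simp add: ind nn_integral_cmult nn_integral_multc)
  also have "(\<integral>\<^sup>+z. ?B z \<partial>(lborel \<Otimes>\<^sub>M lborel)) = (\<integral>\<^sup>+x. (\<integral>\<^sup>+y. ?B (x, y) \<partial>lborel) \<partial>lborel)"
    by (rule lborel.nn_integral_fst[symmetric]) measurable
  also have "\<dots> = (\<integral>\<^sup>+x. ennreal (dw x powr - \<beta>) * slice N \<alpha> x * indicator \<Omega> x \<partial>lborel)"
    unfolding slice_def by (simp add: ind nn_integral_cmult nn_integral_multc)
  finally show ?thesis .
qed

definition layer_const :: real where
  "layer_const = 2 powr gam * (1 + 1 / (1 - 2 powr - (s * p)))"

lemma two_powr_sp: "0 \<le> 2 powr - (s * p)" "2 powr - (s * p) < (1::real)"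
  using sp_pos powr_less_mono[of "- (s * p)" 0 "2::real"] by auto

lemma layer_const_nonneg: "0 \<le> layer_const"
  unfolding layer_const_def using two_powr_sp by auto

text \<open>On layers \<open>N\<close> to \<open>2 * N - 1\<close> the weight, of order
  \<open>2 powr (k * gam)\<close>, cancels the volume, so each contributes a constant times \<eta>.
  Beyond them the maximum is frozen at \<open>2 powr (- 2 * real N)\<close>, only the factor with
  exponent \<open>a\<close> keeps growing, and the volume wins geometrically since
  \<open>a \<le> gam - s * p\<close>.\<close>

lemma layer_integral_le:
  assumes N: "0 < N" and ab: "0 \<le> a" "0 \<le> b" "a + b + s * p = gam" and \<eta>: "0 \<le> \<eta>"
    and vol: "\<And>k. N \<le> k \<Longrightarrow> emeasure lborel (layer k) \<le> ennreal (\<eta> * 2 powr - (real k * gam))"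
  shows "(\<integral>\<^sup>+y. ennreal (dw y powr - a * max (dw y) (2 powr (- 2 * real N)) powr (- b - s * p)) * indicator (layer N) y \<partial>lborel)
    \<le> ennreal (layer_const * real N * \<eta>)"
proof -
  let ?T = "2 powr (- 2 * real N)"
  define m where "m j = max (2 powr - real (Suc (j + N))) ?T" for j :: nat
  define c where "c j = ennreal ((2 powr - real (Suc (j + N))) powr - a * m j powr (- b - s * p))" for j
  have "(\<integral>\<^sup>+y. ennreal (dw y powr - a * max (dw y) ?T powr (- b - s * p)) * indicator (layer N) y \<partial>lborel)
     \<le> (\<Sum>j. c j * emeasure lborel (layer (j + N)))"
  proof (rule nn_integral_le_suminf_layers)
    fix y assume "ennreal (dw y powr - a * max (dw y) ?T powr (- b - s * p)) * indicator (layer N) y \<noteq> 0"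
    then have y: "y \<in> layer N" by (auto simp: indicator_def split: if_splits)
    then obtain k where k: "N \<le> k" "y \<in> layer k" "2 powr - real (Suc k) \<le> dw y" using layer_bracket by blast
    have "dw y powr - a * max (dw y) ?T powr (- b - s * p) \<le> (2 powr - real (Suc k)) powr - a * max (2 powr - real (Suc k)) ?T powr (- b - s * p)"
      using k ab sp_pos by (intro mult_mono powr_mono2') (auto simp: less_max_iff_disj)
    then show "\<exists>j. y \<in> layer (j + N) \<and> ennreal (dw y powr - a * max (dw y) ?T powr (- b - s * p)) * indicator (layer N) y \<le> c j"
      using k y by (intro exI[of _ "k - N"]) (auto simp: c_def m_def intro!: ennreal_leI)
  qed simp
  also have "\<dots> \<le> ennreal (2 powr gam * \<eta> * (real N + 1 / (1 - 2 powr - (s * p))))"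
  proof (rule suminf_ennreal_initial_geometric_le)
    have cv: "c j * emeasure lborel (layer (j + N)) \<le> ennreal ((2 powr - real (Suc (j + N))) powr - a * m j powr (- b - s * p) * (\<eta> * 2 powr - (real (j + N) * gam)))" for j
    proof -
      have "c j * emeasure lborel (layer (j + N)) \<le> c j * ennreal (\<eta> * 2 powr - (real (j + N) * gam))"
        by (intro mult_left_mono vol) auto
      then show ?thesis using \<eta> by (simp add: c_def ennreal_mult)
    qed
    show "c j * emeasure lborel (layer (j + N)) \<le> ennreal (2 powr gam * \<eta>)" if "j < N" for j
    proof -
      have "m j powr (- b - s * p) \<le> (2 powr - real (Suc (j + N))) powr (- b - s * p)"
        using ab sp_pos by (intro powr_mono2') (auto simp: m_def)
      then have "(2 powr - real (Suc (j + N))) powr - a * m j powr (- b - s * p) * (\<eta> * 2 powr - (real (j + N) * gam))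
        \<le> (2 powr - real (Suc (j + N))) powr - a * (2 powr - real (Suc (j + N))) powr (- b - s * p) * (\<eta> * 2 powr - (real (j + N) * gam))"
        using \<eta> by (intro mult_right_mono mult_left_mono) auto
      also have "\<dots> = ((2 powr - real (Suc (j + N))) powr (- gam) * 2 powr - (real (j + N) * gam)) * \<eta>"
      proof -
        have "- a + (- b - s * p) = - gam" using ab(3) by simp
        then have "(2 powr - real (Suc (j + N))) powr - a * (2 powr - real (Suc (j + N))) powr (- b - s * p) = (2 powr - real (Suc (j + N))) powr (- gam)"
          by (subst powr_add[symmetric]) (rule arg_cong)
        then show ?thesis by simp
      qed
      also have "((2::real) powr - real (Suc (j + N))) powr (- gam) * 2 powr - (real (j + N) * gam) = 2 powr gam"
        by (simp only: powr_powr flip: powr_add) (simp add: algebra_simps)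
      finally show ?thesis using order_trans[OF cv[of j] ennreal_leI] by simp
    qed
    show "c (j + N) * emeasure lborel (layer (j + N + N)) \<le> ennreal (2 powr gam * \<eta> * (2 powr - (s * p)) ^ j)" for j
    proof -
      have "m (j + N) powr (- b - s * p) \<le> ?T powr (- b - s * p)"
        using ab sp_pos by (intro powr_mono2') (auto simp: m_def)
      then have "(2 powr - real (Suc (j + N + N))) powr - a * m (j + N) powr (- b - s * p) * (\<eta> * 2 powr - (real (j + N + N) * gam))
        \<le> (2 powr - real (Suc (j + N + N))) powr - a * ?T powr (- b - s * p) * (\<eta> * 2 powr - (real (j + N + N) * gam))"
        using \<eta> by (intro mult_right_mono mult_left_mono) auto
      also have "\<dots> = ((2 powr - real (Suc (j + N + N))) powr - a * ?T powr (- b - s * p) * 2 powr - (real (j + N + N) * gam)) * \<eta>"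
        by simp
      also have "(2 powr - real (Suc (j + N + N))) powr - a * ?T powr (- b - s * p) * 2 powr - (real (j + N + N) * gam)
        = (2::real) powr (real (Suc (j + N + N)) * a + 2 * real N * (b + s * p) - real (j + N + N) * gam)"
        by (simp only: powr_powr flip: powr_add) (simp add: algebra_simps)
      also have "real (Suc (j + N + N)) * a + 2 * real N * (b + s * p) - real (j + N + N) * gam = a - real j * (b + s * p)"
        unfolding ab(3)[symmetric] by (simp add: algebra_simps)
      \<comment> \<open>The decay is weakened to the ratio \<open>2 powr - (s * p)\<close>, which
        does not depend on how \<open>gam\<close> is shared between \<open>a\<close> and
        \<open>b\<close>; thus one constant serves both halves of the energy.\<close>
      also have "(2::real) powr (a - real j * (b + s * p)) \<le> 2 powr (gam - real j * (s * p))"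
      proof (rule powr_mono)
        have "0 \<le> real j * b" "a \<le> gam" using ab sp_pos by auto
        then show "a - real j * (b + s * p) \<le> gam - real j * (s * p)" by (simp add: distrib_left)
      qed simp
      also have "(2::real) powr (gam - real j * (s * p)) = 2 powr gam * (2 powr - (s * p)) ^ j"
        by (rule two_powr_diff_mult)
      finally have "(2 powr - real (Suc (j + N + N))) powr - a * m (j + N) powr (- b - s * p) * (\<eta> * 2 powr - (real (j + N + N) * gam))
        \<le> 2 powr gam * \<eta> * (2 powr - (s * p)) ^ j" using \<eta> by (simp add: mult_right_mono mult_ac)
      then show ?thesis using order_trans[OF cv[of "j + N"] ennreal_leI] by blast
    qed
  qed (use \<eta> two_powr_sp in auto)
  also have "\<dots> \<le> ennreal (layer_const * real N * \<eta>)"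
  proof (rule ennreal_leI)
    \<comment> \<open>The tail constant is absorbed into the number of layers, as \<open>N\<close>
      is at least 1.\<close>
    have "1 / (1 - 2 powr - (s * p)) * 1 \<le> 1 / (1 - 2 powr - (s * p)) * real N"
      using N two_powr_sp by (intro mult_left_mono) auto
    then have "real N + 1 / (1 - 2 powr - (s * p)) \<le> (1 + 1 / (1 - 2 powr - (s * p))) * real N"
      by (simp add: algebra_simps)
    then have "2 powr gam * \<eta> * (real N + 1 / (1 - 2 powr - (s * p))) \<le> 2 powr gam * \<eta> * ((1 + 1 / (1 - 2 powr - (s * p))) * real N)"
      using \<eta> by (intro mult_left_mono) auto
    then show "2 powr gam * \<eta> * (real N + 1 / (1 - 2 powr - (s * p))) \<le> layer_const * real N * \<eta>"
      by (simp add: layer_const_def mult_ac)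
  qed
  finally show ?thesis .
qed

lemma en_cutoff_le:
  assumes N: "0 < N" and \<eta>: "0 \<le> \<eta>"
    and vol: "\<And>k. N \<le> k \<Longrightarrow> emeasure lborel (layer k) \<le> ennreal (\<eta> * 2 powr - (real k * gam))"
  shows "en (cutoff N) \<le> ennreal (2 * slice_const * layer_const * (real N powr (1 - p) * \<eta>))"
proof -
  let ?T = "2 powr (- 2 * real N)"
  \<comment> \<open>Used for the pair \<alpha>, \<beta> and for the pair \<beta>, \<alpha>. The
    factor \<open>real N powr - p\<close> comes from the increments of the cutoff, a further
    \<open>real N\<close> from the number of layers.\<close>
  have half: "(\<integral>\<^sup>+y. ennreal (dw y powr - a) * slice N b y * indicator \<Omega> y \<partial>lborel) \<le> ennreal (slice_const * layer_const * (real N powr (1 - p) * \<eta>))"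
    if ab: "0 \<le> a" "0 \<le> b" "a + b + s * p = gam" for a b
  proof -
    have "(\<integral>\<^sup>+y. ennreal (dw y powr - a) * slice N b y * indicator \<Omega> y \<partial>lborel)
      \<le> (\<integral>\<^sup>+y. ennreal (real N powr - p * slice_const) * (ennreal (dw y powr - a * max (dw y) ?T powr (- b - s * p)) * indicator (layer N) y) \<partial>lborel)"
    proof (rule nn_integral_mono)
      fix y
      show "ennreal (dw y powr - a) * slice N b y * indicator \<Omega> y \<le> ennreal (real N powr - p * slice_const) * (ennreal (dw y powr - a * max (dw y) ?T powr (- b - s * p)) * indicator (layer N) y)"
      proof (cases "y \<in> \<Omega>")
        case True
        have "ennreal (dw y powr - a) * slice N b y \<le> ennreal (dw y powr - a) * (ennreal (real N powr - p * slice_const * max (dw y) ?T powr (- b - s * p)) * indicator (layer N) y)"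
          by (intro mult_left_mono slice_le N True ab) auto
        also have "\<dots> = ennreal (real N powr - p * slice_const) * (ennreal (dw y powr - a * max (dw y) ?T powr (- b - s * p)) * indicator (layer N) y)"
          using slice_const_nonneg by (simp add: ennreal_mult mult_ac)
        finally show ?thesis using True by simp
      qed simp
    qed
    also have "\<dots> = ennreal (real N powr - p * slice_const) * (\<integral>\<^sup>+y. ennreal (dw y powr - a * max (dw y) ?T powr (- b - s * p)) * indicator (layer N) y \<partial>lborel)"
      by (rule nn_integral_cmult) measurable
    also have "\<dots> \<le> ennreal (real N powr - p * slice_const) * ennreal (layer_const * real N * \<eta>)"
      by (intro mult_left_mono layer_integral_le N ab \<eta> vol) auto
    also have "\<dots> = ennreal (real N powr - p * slice_const * (layer_const * real N * \<eta>))"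
      using slice_const_nonneg layer_const_nonneg \<eta> by (simp add: ennreal_mult)
    also have "real N powr - p * slice_const * (layer_const * real N * \<eta>) = slice_const * layer_const * (real N powr (1 - p) * \<eta>)"
      using N by (simp add: powr_diff powr_minus field_simps)
    finally show ?thesis .
  qed
  have "en (cutoff N) \<le> ennreal (slice_const * layer_const * (real N powr (1 - p) * \<eta>)) + ennreal (slice_const * layer_const * (real N powr (1 - p) * \<eta>))"
    using \<alpha>_nonneg \<beta>_nonneg
    by (intro order_trans[OF en_cutoff_le_slices] add_mono half) (auto simp: gam_def)
  also have "\<dots> = ennreal (2 * slice_const * layer_const * (real N powr (1 - p) * \<eta>))"
    using slice_const_nonneg layer_const_nonneg \<eta> by (simp add: ennreal_plus[symmetric] del: ennreal_plus)
  finally show ?thesis .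
qed

text \<open>Without the singular kernel the weight stays below the critical exponent by at least
  \<open>s * p\<close>, so the layers sum geometrically; away from the boundary the weight is
  bounded.\<close>

lemma wmass_finite:
  assumes a: "0 \<le> a" "a + s * p \<le> gam" and \<eta>: "0 \<le> \<eta>"
    and vol: "\<And>k. N \<le> k \<Longrightarrow> emeasure lborel (layer k) \<le> ennreal (\<eta> * 2 powr - (real k * gam))"
  shows "wmass a < \<infinity>"
proof -
  have \<Omega>fin: "emeasure lborel \<Omega> < \<infinity>" using bounded by (rule emeasure_bounded_finite)
  define c where "c j = ennreal ((2 powr - real (Suc (j + N))) powr - a)" for j :: nat
  have "wmass a \<le> (\<integral>\<^sup>+y. ennreal (dw y powr - a) * indicator (layer N) y + ennreal ((2 powr - real N) powr - a) * indicator \<Omega> y \<partial>lborel)"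
    unfolding wmass_def
  proof (rule nn_integral_mono)
    fix x
    have "dw x powr - a \<le> (2 powr - real N) powr - a" if "x \<in> \<Omega>" "x \<notin> layer N"
      using that a by (intro powr_mono2') (auto simp: layer_def)
    then show "ennreal (dw x powr - a) * indicator \<Omega> x \<le> ennreal (dw x powr - a) * indicator (layer N) x + ennreal ((2 powr - real N) powr - a) * indicator \<Omega> x"
      by (auto simp: indicator_def layer_def intro!: ennreal_leI)
  qed
  also have "\<dots> = (\<integral>\<^sup>+y. ennreal (dw y powr - a) * indicator (layer N) y \<partial>lborel) + ennreal ((2 powr - real N) powr - a) * emeasure lborel \<Omega>"
    using open_meas by (simp add: nn_integral_add nn_integral_cmult_indicator)
  also have "(\<integral>\<^sup>+y. ennreal (dw y powr - a) * indicator (layer N) y \<partial>lborel) \<le> (\<Sum>j. c j * emeasure lborel (layer (j + N)))"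
  proof (rule nn_integral_le_suminf_layers)
    fix y assume "ennreal (dw y powr - a) * indicator (layer N) y \<noteq> 0"
    then have y: "y \<in> layer N" by (auto simp: indicator_def split: if_splits)
    then obtain k where k: "N \<le> k" "y \<in> layer k" "2 powr - real (Suc k) \<le> dw y" using layer_bracket by blast
    have "dw y powr - a \<le> (2 powr - real (Suc k)) powr - a"
      using k a by (intro powr_mono2') auto
    then show "\<exists>j. y \<in> layer (j + N) \<and> ennreal (dw y powr - a) * indicator (layer N) y \<le> c j"
      using k y by (intro exI[of _ "k - N"]) (auto simp: c_def intro!: ennreal_leI)
  qed simp
  also have "(\<Sum>j. c j * emeasure lborel (layer (j + N))) \<le> ennreal ((2 powr gam * \<eta>) / (1 - 2 powr - (s * p)))"
  proof (rule suminf_ennreal_geometric_le)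
    fix j
    have "c j * emeasure lborel (layer (j + N)) \<le> c j * ennreal (\<eta> * 2 powr - (real (j + N) * gam))"
      by (intro mult_left_mono vol) auto
    also have "\<dots> = ennreal (\<eta> * ((2 powr - real (Suc (j + N))) powr - a * 2 powr - (real (j + N) * gam)))"
      using \<eta> by (simp add: c_def ennreal_mult mult_ac)
    also have "(2 powr - real (Suc (j + N))) powr - a * 2 powr - (real (j + N) * gam) = (2::real) powr (a + (real (j + N) * (a - gam)))"
      by (simp only: powr_powr flip: powr_add) (simp add: algebra_simps)
    also have "ennreal (\<eta> * 2 powr (a + (real (j + N) * (a - gam)))) \<le> ennreal (2 powr gam * \<eta> * (2 powr - (s * p)) ^ j)"
    proof (rule ennreal_leI)
      have "real (j + N) * (a - gam) \<le> real (j + N) * (- (s * p))" using a by (intro mult_left_mono) auto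
      also have "\<dots> \<le> real j * (- (s * p))" using sp_pos by (intro mult_right_mono_neg) auto
      finally have "a + (real (j + N) * (a - gam)) \<le> gam - real j * (s * p)" using a sp_pos by simp
      then have "(2::real) powr (a + (real (j + N) * (a - gam))) \<le> 2 powr (gam - real j * (s * p))" by (intro powr_mono) auto
      also have "(2::real) powr (gam - real j * (s * p)) = 2 powr gam * (2 powr - (s * p)) ^ j"
        by (rule two_powr_diff_mult)
      finally show "\<eta> * 2 powr (a + (real (j + N) * (a - gam))) \<le> 2 powr gam * \<eta> * (2 powr - (s * p)) ^ j"
        using \<eta> by (simp add: mult_left_mono mult_ac)
    qed
    finally show "c j * emeasure lborel (layer (j + N)) \<le> ennreal (2 powr gam * \<eta> * (2 powr - (s * p)) ^ j)" .
  qed (use \<eta> two_powr_sp in auto)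
  finally have "wmass a \<le> ennreal ((2 powr gam * \<eta>) / (1 - 2 powr - (s * p))) + ennreal ((2 powr - real N) powr - a) * emeasure lborel \<Omega>"
    by (auto simp: add_right_mono)
  also have "\<dots> < \<infinity>" using \<Omega>fin by (simp add: ennreal_mult_less_top)
  finally show ?thesis .
qed

text \<open>A common interface in which \<eta> may depend on \<epsilon>. For \<open>p = 1\<close> it
  must itself be small; for \<open>p > 1\<close> a fixed \<eta> works once \<open>N\<close> is
  large.\<close>

lemma W0_eq_W_of_layers:
  assumes vol: "\<And>\<epsilon>. 0 < \<epsilon> \<Longrightarrow> \<exists>\<eta> N0. 0 \<le> \<eta> \<and> (\<forall>k\<ge>N0. emeasure lborel (layer k) \<le> ennreal (\<eta> * 2 powr - (real k * gam)))
      \<and> (\<forall>N\<ge>N0. real N powr (1 - p) * \<eta> \<le> \<epsilon>)"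
  shows "W0_space s p \<alpha> \<beta> \<Omega> = W_space s p \<alpha> \<beta> \<Omega>"
proof (rule W0_eq_W)
  fix g assume g: "g \<in> borel_measurable borel" "lp g < \<infinity>" "en g < \<infinity>"
  obtain \<eta> N0 where \<eta>: "0 \<le> \<eta>" "\<And>k. N0 \<le> k \<Longrightarrow> emeasure lborel (layer k) \<le> ennreal (\<eta> * 2 powr - (real k * gam))"
    using vol[of 1] by auto
  have mass: "wmass \<alpha> < \<infinity>" "wmass \<beta> < \<infinity>"
    by (rule wmass_finite[where N = N0 and \<eta> = \<eta>]; use \<alpha>_nonneg \<beta>_nonneg \<eta> in \<open>simp add: gam_def\<close>)+
  define C where "C = 2 * slice_const * layer_const"
  have C0: "0 \<le> C" using slice_const_nonneg layer_const_nonneg by (simp add: C_def)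
  have "(\<lambda>n. en (cutoff (Suc n))) \<longlonglongrightarrow> 0"
  proof (rule order_tendstoI)
    fix a :: ennreal assume a: "0 < a"
    obtain e where e: "0 < e" "ennreal e < a"
    proof (cases a)
      case (real r)
      then show ?thesis using a that[of "r / 2"] by (simp add: ennreal_less_iff)
    next
      case top
      then show ?thesis using that[of 1] by simp
    qed
    have "0 < e / (C + 1)" using e C0 by simp
    from vol[OF this] obtain \<eta> N0 where v: "0 \<le> \<eta>" "\<And>k. N0 \<le> k \<Longrightarrow> emeasure lborel (layer k) \<le> ennreal (\<eta> * 2 powr - (real k * gam))"
      "\<And>N. N0 \<le> N \<Longrightarrow> real N powr (1 - p) * \<eta> \<le> e / (C + 1)" by blast
    show "\<forall>\<^sub>F n in sequentially. en (cutoff (Suc n)) < a"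
    proof (rule eventually_sequentiallyI[of N0])
      fix n assume n: "N0 \<le> n"
      have "en (cutoff (Suc n)) \<le> ennreal (C * (real (Suc n) powr (1 - p) * \<eta>))"
        unfolding C_def using v n by (intro en_cutoff_le) auto
      also have "\<dots> \<le> ennreal e"
      proof (rule ennreal_leI)
        have "C * (real (Suc n) powr (1 - p) * \<eta>) \<le> C * (e / (C + 1))" using n C0 by (intro mult_left_mono v) auto
        also have "\<dots> \<le> e" using C0 e by (simp add: field_simps)
        finally show "C * (real (Suc n) powr (1 - p) * \<eta>) \<le> e" .
      qed
      finally show "en (cutoff (Suc n)) < a" using e by simp
    qed
  qed simp
  then have cut: "(\<lambda>n. en (cutoff (Suc n))) \<longlonglongrightarrow> 0" .
  show "approximable g"
  proof (rule approximable_truncation[OF g])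
    fix h M assume h: "h \<in> borel_measurable borel" "\<And>x. \<bar>h x\<bar> \<le> M" "lp h < \<infinity>" "en h < \<infinity>"
    show "approximable h"
    proof (rule approximable_cutoff[where w = "\<lambda>n. cutoff (Suc n)" and M = M])
      show "(\<lambda>n. cutoff (Suc n) x) \<longlonglongrightarrow> 1" if "x \<in> \<Omega>" for x
        using cutoff_tendsto[OF that] by (rule LIMSEQ_Suc)
      fix n assume fin: "en (\<lambda>x. h x * cutoff (Suc n) x) < \<infinity>"
      show "approximable (\<lambda>x. h x * cutoff (Suc n) x)"
      \<comment> \<open>The support of the cutoff lies at depth at least
        \<open>2 powr (- 2 * real (Suc n))\<close>, which has to equal \<open>4 * d\<close>.\<close>
      proof (rule approximable_mollify[where M = M and d = "2 powr (- 2 * real (Suc n)) / 4"])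
        show "\<bar>h x * cutoff (Suc n) x\<bar> \<le> M" for x
        proof -
          have "\<bar>h x * cutoff (Suc n) x\<bar> \<le> \<bar>h x\<bar>"
            unfolding abs_mult using cutoff_bounds[of "Suc n" x] by (intro mult_right_le_one_le) auto
          then show ?thesis using h(2)[of x] by linarith
        qed
        show "x \<in> \<Omega> \<and> 4 * (2 powr (- 2 * real (Suc n)) / 4) \<le> dw x" if "h x * cutoff (Suc n) x \<noteq> 0" for x
          using cutoff_nonzero[of "Suc n" x] that by simp
      qed (use h fin mass in auto)
    qed (use h cut cutoff_bounds in auto)
  qed
qed

end

subsection \<open>Small boundaries\<close>

context wfrac
begin

lemma emeasure_layer_le:
  assumes "layer k \<subseteq> S" "closed S"
  shows "emeasure lborel (layer k) \<le> emeasure lebesgue S"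
proof -
  have "S \<in> sets borel" using assms by simp
  then have "emeasure lebesgue S = emeasure lborel S" by simp
  with assms show ?thesis by (auto intro: emeasure_mono)
qed

text \<open>The strict inequality leaves room for an exponent \<open>t\<close> with vanishing
  limsup. The volume of a layer is then eventually at most \<epsilon> times
  \<open>r powr (real DIM('a) - t)\<close>, and \<open>gam < real DIM('a) - t\<close> with
  \<open>r \<le> 1\<close>; so \<eta> is \<epsilon> itself.\<close>

lemma W0_eq_W_minkowski:
  assumes "ereal gam < ereal (real DIM('a)) - upper_minkowski_dim (frontier \<Omega>)"
  shows "W0_space s p \<alpha> \<beta> \<Omega> = W_space s p \<alpha> \<beta> \<Omega>"
proof (rule W0_eq_W_of_layers)
  fix \<epsilon> :: real assume \<epsilon>: "0 < \<epsilon>"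
  have "upper_minkowski_dim (frontier \<Omega>) < ereal (real DIM('a) - gam)"
    using assms by (cases "upper_minkowski_dim (frontier \<Omega>)") auto
  then obtain t where t: "t < real DIM('a) - gam"
    "Limsup (at_right 0) (\<lambda>r. emeasure lebesgue (thickening (frontier \<Omega>) r) * ennreal (r powr (t - real DIM('a)))) = 0"
    unfolding upper_minkowski_dim_def Inf_less_iff by auto
  have "\<forall>\<^sub>F r in at_right 0. emeasure lebesgue (thickening (frontier \<Omega>) r) * ennreal (r powr (t - real DIM('a))) < ennreal \<epsilon>"
    using t(2) \<epsilon> by (intro Limsup_lessD) auto
  then obtain b where b: "0 < b" "\<And>r. 0 < r \<Longrightarrow> r < b \<Longrightarrow>
      emeasure lebesgue (thickening (frontier \<Omega>) r) * ennreal (r powr (t - real DIM('a))) < ennreal \<epsilon>"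
    unfolding eventually_at_right_field by auto
  obtain m :: nat where m: "(1/2) ^ m < b" using real_arch_pow_inv[of b "1/2"] b by auto
  have vol: "emeasure lborel (layer k) \<le> ennreal (\<epsilon> * 2 powr - (real k * gam))" if k: "max m 1 \<le> k" for k
  proof -
    define r where "r = (2::real) powr - real k"
    have "r = (1/2) ^ k" by (simp add: r_def powr_minus powr_realpow power_one_over inverse_eq_divide)
    also have "\<dots> \<le> (1/2) ^ m" using k by (intro power_decreasing) auto
    finally have r: "0 < r" "r < b" using m by (auto simp: r_def)
    have "r \<le> 2 powr 0" unfolding r_def by (intro powr_mono) auto
    then have r1: "r \<le> 1" by simp
    let ?V = "emeasure lebesgue (thickening (frontier \<Omega>) r)"
    have "closed (thickening (frontier \<Omega>) r)"
      unfolding thickening_def by (intro closed_Collect_le continuous_intros)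
    then have "emeasure lborel (layer k) \<le> ?V"
      by (intro emeasure_layer_le) (auto simp: layer_def thickening_def bdist_def r_def)
    also have "?V = ?V * (ennreal (r powr (t - real DIM('a))) * ennreal (r powr (real DIM('a) - t)))"
      using r by (simp add: ennreal_mult[symmetric] powr_add[symmetric])
    also have "\<dots> \<le> ennreal \<epsilon> * ennreal (r powr (real DIM('a) - t))"
      using b(2)[OF r] unfolding mult.assoc[symmetric] by (intro mult_right_mono) auto
    also have "\<dots> \<le> ennreal \<epsilon> * ennreal (r powr gam)"
      using r r1 t by (intro mult_left_mono ennreal_leI powr_mono') auto
    also have "r powr gam = 2 powr - (real k * gam)" by (simp add: r_def powr_powr)
    finally show ?thesis using \<epsilon> by (simp add: ennreal_mult)
  qed
  have "real N powr (1 - p) * \<epsilon> \<le> \<epsilon>" if "max m 1 \<le> N" for N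
  proof -
    have "real N powr (1 - p) \<le> real N powr 0" using that p_ge by (intro powr_mono) auto
    then show ?thesis using that \<epsilon> by simp
  qed
  with vol \<epsilon> show "\<exists>\<eta> N0. 0 \<le> \<eta> \<and> (\<forall>k\<ge>N0. emeasure lborel (layer k) \<le> ennreal (\<eta> * 2 powr - (real k * gam)))
      \<and> (\<forall>N\<ge>N0. real N powr (1 - p) * \<eta> \<le> \<epsilon>)"
    by (intro exI[of _ \<epsilon>] exI[of _ "max m 1"]) auto
qed

text \<open>Homogeneity is used with the ratio \<open>D / r\<close>, for which the ball of radius
  \<open>D\<close> contains \<Omega>. The powers of \<open>r\<close> then combine to
  \<open>r powr gam\<close>, with a constant that need not be small because
  \<open>p > 1\<close>.\<close>

lemma W0_eq_W_homogeneous: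
  assumes hom: "homogeneous (real DIM('a) - gam) (frontier \<Omega>)" and p: "1 < p"
  shows "W0_space s p \<alpha> \<beta> \<Omega> = W_space s p \<alpha> \<beta> \<Omega>"
proof (rule W0_eq_W_of_layers)
  fix \<epsilon> :: real assume \<epsilon>: "0 < \<epsilon>"
  obtain L where L: "\<And>x \<mu> r. x \<in> frontier \<Omega> \<Longrightarrow> 1 \<le> \<mu> \<Longrightarrow> 0 < r \<Longrightarrow>
      measure lebesgue {y. infdist y (frontier \<Omega>) \<le> r \<and> dist x y \<le> \<mu> * r} \<le> L * r ^ DIM('a) * \<mu> powr (real DIM('a) - gam)"
    using hom unfolding homogeneous_def by blast
  obtain a where a: "a \<in> frontier \<Omega>" using frontier_nonempty by blast
  obtain e where e: "\<And>x. x \<in> \<Omega> \<Longrightarrow> dist a x \<le> e" using bounded bounded_any_center[of \<Omega> a] by auto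
  define D where "D = max 1 e"
  have D: "1 \<le> D" "\<And>x. x \<in> \<Omega> \<Longrightarrow> dist a x \<le> D" using e by (auto simp: D_def intro: max.coboundedI2)
  \<comment> \<open>The sign of \<open>L\<close> is unknown, while \<eta> has to be
    nonnegative.\<close>
  define \<eta> where "\<eta> = \<bar>L\<bar> * D powr (real DIM('a) - gam)"
  have \<eta>: "0 \<le> \<eta>" by (simp add: \<eta>_def)
  have vol: "emeasure lborel (layer k) \<le> ennreal (\<eta> * 2 powr - (real k * gam))" for k
  proof -
    define r where "r = (2::real) powr - real k"
    have "r \<le> 2 powr 0" unfolding r_def by (intro powr_mono) auto
    then have r: "0 < r" "r \<le> 1" by (auto simp: r_def)
    let ?S = "{y. infdist y (frontier \<Omega>) \<le> r \<and> dist a y \<le> D / r * r}"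
    have "?S = {y. infdist y (frontier \<Omega>) \<le> r} \<inter> cball a D" using r by (auto simp: dist_commute)
    moreover have "closed {y. infdist y (frontier \<Omega>) \<le> r}" by (intro closed_Collect_le continuous_intros)
    ultimately have S: "closed ?S" "bounded ?S" by (auto simp: closed_Int bounded_Int)
    then have "?S \<in> lmeasurable" by (intro lmeasurable_compact) (simp add: compact_eq_bounded_closed)
    then have fin: "emeasure lebesgue ?S = ennreal (measure lebesgue ?S)"
      by (intro emeasure_eq_ennreal_measure) (auto simp: fmeasurable_def)
    have "emeasure lborel (layer k) \<le> emeasure lebesgue ?S"
      using D r by (intro emeasure_layer_le S) (auto simp: layer_def bdist_def r_def)
    also have "\<dots> \<le> ennreal (L * r ^ DIM('a) * (D / r) powr (real DIM('a) - gam))"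
      unfolding fin using D r by (intro ennreal_leI L a) (auto simp: field_simps)
    also have "\<dots> \<le> ennreal (\<eta> * r powr gam)"
    proof (rule ennreal_leI)
      have "r ^ DIM('a) * (D / r) powr (real DIM('a) - gam) = D powr (real DIM('a) - gam) * (r powr real DIM('a) / r powr (real DIM('a) - gam))"
        using r D by (simp add: powr_divide powr_realpow)
      also have "r powr real DIM('a) / r powr (real DIM('a) - gam) = r powr gam"
        by (simp add: powr_diff[symmetric])
      finally have "L * r ^ DIM('a) * (D / r) powr (real DIM('a) - gam) = L * (D powr (real DIM('a) - gam) * r powr gam)" by simp
      also have "\<dots> \<le> \<bar>L\<bar> * (D powr (real DIM('a) - gam) * r powr gam)" by (intro mult_right_mono) auto
      finally show "L * r ^ DIM('a) * (D / r) powr (real DIM('a) - gam) \<le> \<eta> * r powr gam" by (simp add: \<eta>_def mult_ac)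
    qed
    also have "r powr gam = 2 powr - (real k * gam)" by (simp add: r_def powr_powr)
    finally show ?thesis .
  qed
  have "(\<lambda>N. real N powr (1 - p) * \<eta>) \<longlonglongrightarrow> 0 * \<eta>"
    using p by (intro tendsto_intros tendsto_neg_powr filterlim_real_sequentially) auto
  then have "\<forall>\<^sub>F N in sequentially. real N powr (1 - p) * \<eta> < \<epsilon>"
    using \<epsilon> by (intro order_tendstoD) auto
  then obtain N0 where "\<And>N. N0 \<le> N \<Longrightarrow> real N powr (1 - p) * \<eta> < \<epsilon>"
    unfolding eventually_sequentially by blast
  with vol \<eta> show "\<exists>\<eta> N0. 0 \<le> \<eta> \<and> (\<forall>k\<ge>N0. emeasure lborel (layer k) \<le> ennreal (\<eta> * 2 powr - (real k * gam)))
      \<and> (\<forall>N\<ge>N0. real N powr (1 - p) * \<eta> \<le> \<epsilon>)"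
    by (intro exI[of _ \<eta>] exI[of _ N0]) (auto intro: less_imp_le)
qed

end

subsection \<open>Local energies\<close>

text \<open>Jensen's inequality once in each variable, rather than once for the product
  weight.\<close>

lemma jensen_average_diff:
  fixes u w1 w2 :: "'a::euclidean_space \<Rightarrow> real"
  assumes p: "1 \<le> p" and [measurable]: "u \<in> borel_measurable borel" and M: "\<And>x. \<bar>u x\<bar> \<le> M"
    and w1: "\<And>x. 0 \<le> w1 x" "integrable lborel w1" "(\<integral>x. w1 x \<partial>lborel) = 1"
    and w2: "\<And>x. 0 \<le> w2 x" "integrable lborel w2" "(\<integral>x. w2 x \<partial>lborel) = 1"
  shows "ennreal (\<bar>(\<integral>x. w1 x * u x \<partial>lborel) - (\<integral>x. w2 x * u x \<partial>lborel)\<bar> powr p)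
    \<le> (\<integral>\<^sup>+x. ennreal (w1 x) * (\<integral>\<^sup>+y. ennreal (w2 y) * ennreal (\<bar>u x - u y\<bar> powr p) \<partial>lborel) \<partial>lborel)"
proof -
  have int: "integrable lborel (\<lambda>x. w x * u x)" if "integrable lborel w" for w
    by (rule integrable_mult_bounded[OF that _ M]) measurable
  have diff: "(\<integral>x. w x * u x \<partial>lborel) - c = (\<integral>x. w x * (u x - c) \<partial>lborel)"
    if "integrable lborel w" "(\<integral>x. w x \<partial>lborel) = 1" for w c
    using int[OF that(1)] that by (simp add: right_diff_distrib)
  let ?a = "\<integral>x. w2 x * u x \<partial>lborel"
  have inner: "ennreal (\<bar>u x - ?a\<bar> powr p) \<le> (\<integral>\<^sup>+y. ennreal (w2 y) * ennreal (\<bar>u x - u y\<bar> powr p) \<partial>lborel)" for x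
  proof -
    have "\<bar>u y - u x\<bar> \<le> 2 * M" for y using M[of x] M[of y] by linarith
    then have "ennreal (\<bar>\<integral>y. w2 y * (u y - u x) \<partial>lborel\<bar> powr p) \<le> (\<integral>\<^sup>+y. ennreal (w2 y) * ennreal (\<bar>u y - u x\<bar> powr p) \<partial>lborel)"
      by (intro jensen_powr p w2) auto
    then show ?thesis unfolding diff[OF w2(2,3), symmetric] by (simp add: abs_minus_commute)
  qed
  have "\<bar>u x - ?a\<bar> \<le> M + \<bar>?a\<bar>" for x using M[of x] by linarith
  then have "ennreal (\<bar>\<integral>x. w1 x * (u x - ?a) \<partial>lborel\<bar> powr p) \<le> (\<integral>\<^sup>+x. ennreal (w1 x) * ennreal (\<bar>u x - ?a\<bar> powr p) \<partial>lborel)"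
    by (intro jensen_powr p w1) auto
  also have "\<dots> \<le> (\<integral>\<^sup>+x. ennreal (w1 x) * (\<integral>\<^sup>+y. ennreal (w2 y) * ennreal (\<bar>u x - u y\<bar> powr p) \<partial>lborel) \<partial>lborel)"
    by (intro nn_integral_mono mult_left_mono inner) auto
  finally show ?thesis unfolding diff[OF w1(2,3)] .
qed

definition ball_weight :: "'a::euclidean_space \<Rightarrow> real \<Rightarrow> 'a \<Rightarrow> real" where
  "ball_weight z r x = indicator (ball z r) x / measure lborel (ball z r)"

lemma ball_weight:
  fixes z :: "'a::euclidean_space"
  assumes "0 < r"
  shows "0 \<le> ball_weight z r x" "integrable lborel (ball_weight z r)" "(\<integral>x. ball_weight z r x \<partial>lborel) = 1"
proof -
  have fin: "emeasure lborel (ball z r) < \<infinity>" by (intro emeasure_bounded_finite) auto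
  have i: "integrable lborel (indicator (ball z r) :: 'a \<Rightarrow> real)"
    by (rule integrable_real_indicator) (use fin in auto)
  show "0 \<le> ball_weight z r x" by (simp add: ball_weight_def)
  show "integrable lborel (ball_weight z r)" unfolding ball_weight_def[abs_def] using i by (intro integrable_divide_zero impI)
  have "0 < measure lborel (ball z r)" using assms by (simp add: content_ball)
  then show "(\<integral>x. ball_weight z r x \<partial>lborel) = 1"
    unfolding ball_weight_def by simp
qed

lemma ex_power_half_less: "0 < (e::real) \<Longrightarrow> \<exists>k\<ge>m. (1/2) ^ k < e"
proof -
  assume "0 < e"
  then obtain k where k: "(1/2) ^ k < e" using real_arch_pow_inv[of e "1/2"] by auto
  have "(1/2::real) ^ (max k m) \<le> (1/2) ^ k" by (intro power_decreasing) auto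
  then show ?thesis using le_less_trans[OF _ k] by (intro exI[of _ "max k m"]) auto
qed

text \<open>Greedy choice: as long as the balls of radius \<open>8 * r\<close> around the points chosen so far do not
  cover the thickened set, one more point can be added.\<close>

lemma ex_separated_points:
  fixes E :: "'a::euclidean_space set"
  assumes E: "closed E" "E \<noteq> {}" and r: "0 < r"
    and n: "real (n - 1) * (unit_ball_vol DIM('a) * (8 * r) ^ DIM('a)) < measure lebesgue (thickening E r \<inter> ball x R)"
  shows "\<exists>P. finite P \<and> card P = n \<and> P \<subseteq> E \<inter> ball x (R + r) \<and> (\<forall>a\<in>P. \<forall>b\<in>P. a \<noteq> b \<longrightarrow> 6 * r \<le> dist a b)"
  using n
proof (induction n)
  case 0
  show ?case by (intro exI[of _ "{}"]) auto
next
  case (Suc n)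
  let ?v = "unit_ball_vol (real DIM('a)) * (8 * r) ^ DIM('a)"
  let ?T = "thickening E r \<inter> ball x R"
  have v0: "0 \<le> ?v" using r by simp
  have "real (n - 1) * ?v \<le> real n * ?v" using v0 by (intro mult_right_mono) auto
  also have "\<dots> < measure lebesgue ?T" using Suc.prems by simp
  finally obtain P where P: "finite P" "card P = n" "P \<subseteq> E \<inter> ball x (R + r)" "\<forall>a\<in>P. \<forall>b\<in>P. a \<noteq> b \<longrightarrow> 6 * r \<le> dist a b"
    using Suc.IH by blast
  have "\<not> ?T \<subseteq> (\<Union>a\<in>P. ball a (8 * r))"
  proof
    assume sub: "?T \<subseteq> (\<Union>a\<in>P. ball a (8 * r))"
    have "closed (thickening E r)"
      unfolding thickening_def by (intro closed_Collect_le continuous_intros)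
    then have T: "?T \<in> sets lebesgue" by (intro sets.Int) auto
    have "measure lebesgue ?T \<le> measure lebesgue (\<Union>a\<in>P. ball a (8 * r))"
      using sub T P(1) by (intro measure_mono_fmeasurable fmeasurable.finite_UN) auto
    also have "\<dots> \<le> (\<Sum>a\<in>P. measure lebesgue (ball a (8 * r)))"
      using P(1) by (intro measure_UNION_le) auto
    also have "\<dots> = real n * ?v" using r P(2) by (simp add: content_ball)
    finally show False using Suc.prems by simp
  qed
  then obtain y where y: "infdist y E \<le> r" "dist x y < R" "\<And>a. a \<in> P \<Longrightarrow> 8 * r \<le> dist a y"
  proof -
    from \<open>\<not> ?T \<subseteq> _\<close> obtain y where "y \<in> ?T" "y \<notin> (\<Union>a\<in>P. ball a (8 * r))" by blast
    then show ?thesis by (intro that[of y]) (auto simp: thickening_def not_less)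
  qed
  \<comment> \<open>The new point is a nearest point of \<open>E\<close> to \<open>y\<close>. It is
    within \<open>r\<close> of \<open>y\<close>, hence at least \<open>7 * r\<close> from the
    earlier points; \<open>6 * r\<close> is what makes balls of radius \<open>3 * r\<close> disjoint
    later.\<close>
  obtain e where e: "e \<in> E" "infdist y E = dist y e" using infdist_attains_inf[OF E] by blast
  have sep: "6 * r \<le> dist a e" if "a \<in> P" for a
    using y(3)[OF that] y(1) e(2) dist_triangle[of a y e] dist_commute[of e y] r by linarith
  have "e \<notin> P" using sep[of e] r by auto
  moreover have "dist x e < R + r" using y e dist_triangle[of x e y] by linarith
  ultimately show ?case using P e(1) sep
    by (intro exI[of _ "insert e P"]) (auto simp: dist_commute)
qed

context wfrac
begin

definition enS :: "('a \<Rightarrow> real) \<Rightarrow> 'a set \<Rightarrow> ennreal" where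
  "enS u S = (\<integral>\<^sup>+z. ennreal (\<bar>u (fst z) - u (snd z)\<bar> powr p * ker (fst z) (snd z))
      * indicator \<Omega> (fst z) * indicator \<Omega> (snd z) * indicator (S \<times> S) z \<partial>(lborel \<Otimes>\<^sub>M lborel))"

lemma enS_le_en: "enS u S \<le> en u"
  unfolding enS_def en_def by (intro nn_integral_mono) (auto simp: indicator_def)

lemma enS_mono: "S \<subseteq> T \<Longrightarrow> enS u S \<le> enS u T"
  unfolding enS_def by (intro nn_integral_mono) (auto simp: indicator_def)

text \<open>Disjoint sets have disjoint squares; the interaction between different sets is
  discarded.\<close>

lemma sum_enS_le:
  assumes P: "finite P" and [measurable]: "u \<in> borel_measurable borel" and S: "\<And>a. a \<in> P \<Longrightarrow> S a \<in> sets borel" "\<And>a. a \<in> P \<Longrightarrow> S a \<subseteq> T"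
    and disj: "\<And>a b. a \<in> P \<Longrightarrow> b \<in> P \<Longrightarrow> a \<noteq> b \<Longrightarrow> S a \<inter> S b = {}"
  shows "(\<Sum>a\<in>P. enS u (S a)) \<le> enS u T"
proof -
  let ?F = "\<lambda>z. ennreal (\<bar>u (fst z) - u (snd z)\<bar> powr p * ker (fst z) (snd z)) * indicator \<Omega> (fst z) * indicator \<Omega> (snd z)"
  have [measurable]: "?F \<in> borel_measurable (lborel \<Otimes>\<^sub>M lborel)" by measurable
  have "(\<Sum>a\<in>P. enS u (S a)) = (\<integral>\<^sup>+z. (\<Sum>a\<in>P. ?F z * indicator (S a \<times> S a) z) \<partial>(lborel \<Otimes>\<^sub>M lborel))"
    unfolding enS_def
  proof (rule nn_integral_sum[symmetric])
    fix a assume a: "a \<in> P"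
    have "S a \<times> S a \<in> sets (lborel \<Otimes>\<^sub>M lborel)" using S(1)[OF a] by (intro pair_measureI) auto
    then show "(\<lambda>z. ?F z * indicator (S a \<times> S a) z) \<in> borel_measurable (lborel \<Otimes>\<^sub>M lborel)"
      by (intro borel_measurable_times_ennreal borel_measurable_indicator) auto
  qed
  also have "\<dots> \<le> enS u T"
    unfolding enS_def
  proof (rule nn_integral_mono)
    fix z :: "'a \<times> 'a"
    show "(\<Sum>a\<in>P. ?F z * indicator (S a \<times> S a) z) \<le> ?F z * indicator (T \<times> T) z"
    proof (cases "\<exists>a\<in>P. z \<in> S a \<times> S a")
      case True
      then obtain a where a: "a \<in> P" "z \<in> S a \<times> S a" by blast
      have "(\<Sum>b\<in>P. ?F z * indicator (S b \<times> S b) z) = (\<Sum>b\<in>{a}. ?F z * indicator (S b \<times> S b) z)"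
      proof (rule sum.mono_neutral_right[OF P])
        show "\<forall>b\<in>P - {a}. ?F z * indicator (S b \<times> S b) z = 0"
        proof
          fix b assume b: "b \<in> P - {a}"
          then have "S a \<inter> S b = {}" using disj[of a b] a by auto
          then have "z \<notin> S b \<times> S b" using a(2) by auto
          then show "?F z * indicator (S b \<times> S b) z = 0" by simp
        qed
      qed (use a in auto)
      also have "\<dots> \<le> ?F z * indicator (T \<times> T) z" using a S(2)[OF a(1)] by (auto simp: indicator_def)
      finally show ?thesis .
    next
      case False
      then have "(\<Sum>a\<in>P. ?F z * indicator (S a \<times> S a) z) = 0" by (intro sum.neutral) auto
      then show ?thesis by simp
    qed
  qed
  finally show ?thesis .
qed

text \<open>In the ball of radius \<open>2 * r\<close> around a boundary point, mutual distances are
  at most \<open>4 * r\<close> and depths at most \<open>2 * r\<close>, which bounds the kernel from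
  below. The denominator is the product of the volumes over which the averages are taken.\<close>

lemma average_diff_le_enS:
  assumes a: "a \<in> frontier \<Omega>" and r: "0 < r" and u[measurable]: "u \<in> borel_measurable borel" and M: "\<And>x. \<bar>u x\<bar> \<le> M"
    and t: "0 < t1" "0 < t2" and sub: "ball z1 t1 \<subseteq> \<Omega> \<inter> ball a (2 * r)" "ball z2 t2 \<subseteq> \<Omega> \<inter> ball a (2 * r)"
  shows "ennreal (\<bar>(\<integral>x. ball_weight z1 t1 x * u x \<partial>lborel) - (\<integral>x. ball_weight z2 t2 x * u x \<partial>lborel)\<bar> powr p)
    \<le> ennreal ((4 * r) powr (real DIM('a) + s * p) * (2 * r) powr \<alpha> * (2 * r) powr \<beta>
        / (unit_ball_vol DIM('a) ^ 2 * t1 ^ DIM('a) * t2 ^ DIM('a))) * enS u (ball a (2 * r))"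
proof -
  let ?q = "real DIM('a) + s * p"
  let ?S = "ball a (2 * r)"
  define C where "C = (4 * r) powr ?q * (2 * r) powr \<alpha> * (2 * r) powr \<beta>"
  define V1 where "V1 = measure lborel (ball z1 t1)"
  define V2 where "V2 = measure lborel (ball z2 t2)"
  have V: "V1 = unit_ball_vol DIM('a) * t1 ^ DIM('a)" "V2 = unit_ball_vol DIM('a) * t2 ^ DIM('a)"
    using t by (auto simp: V1_def V2_def content_ball)
  have V0: "0 < V1" "0 < V2" using t by (auto simp: V intro!: mult_pos_pos)
  have q0: "0 < ?q" using sp_pos by (simp add: add_pos_pos)
  have dwS: "dw x \<le> 2 * r" if "x \<in> ?S" for x
    using that infdist_le[OF a, of x] by (auto simp: bdist_def dist_commute)
  have key: "\<bar>u x - u y\<bar> powr p \<le> C * (\<bar>u x - u y\<bar> powr p * ker x y)"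
    if "x \<in> \<Omega>" "x \<in> ?S" "y \<in> \<Omega>" "y \<in> ?S" for x y
  proof (cases "x = y")
    case True then show ?thesis using p_ge by simp
  next
    case False
    have d: "dist x y \<le> 4 * r" using that dist_triangle2[of x y a] by (auto simp: dist_commute)
    have 1: "1 \<le> (4 * r) powr ?q * (1 / dist x y powr ?q)"
      using d False q0 by (simp add: powr_mono2)
    have w: "1 \<le> (2 * r) powr e * dw v powr - e" if "v \<in> \<Omega>" "v \<in> ?S" "0 \<le> e" for v e
      using dwS[of v] dw_pos[of v] that by (simp add: powr_minus_divide powr_mono2)
    have "1 * 1 * 1 \<le> ((4 * r) powr ?q * (1 / dist x y powr ?q)) * ((2 * r) powr \<alpha> * dw y powr - \<alpha>) * ((2 * r) powr \<beta> * dw x powr - \<beta>)"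
      using that \<alpha>_nonneg \<beta>_nonneg by (intro mult_mono 1 w) auto
    also have "\<dots> = C * ker x y" by (simp add: C_def ker_def)
    finally have "\<bar>u x - u y\<bar> powr p * 1 \<le> \<bar>u x - u y\<bar> powr p * (C * ker x y)" by (intro mult_left_mono) auto
    then show ?thesis by (simp add: mult_ac)
  qed
  have "ennreal (\<bar>(\<integral>x. ball_weight z1 t1 x * u x \<partial>lborel) - (\<integral>x. ball_weight z2 t2 x * u x \<partial>lborel)\<bar> powr p)
    \<le> (\<integral>\<^sup>+x. ennreal (ball_weight z1 t1 x) * (\<integral>\<^sup>+y. ennreal (ball_weight z2 t2 y) * ennreal (\<bar>u x - u y\<bar> powr p) \<partial>lborel) \<partial>lborel)"
    by (rule jensen_average_diff[OF p_ge u M]) (use ball_weight t in auto)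
  also have "\<dots> \<le> (\<integral>\<^sup>+x. (\<integral>\<^sup>+y. ennreal (C / (V1 * V2)) * (ennreal (\<bar>u x - u y\<bar> powr p * ker x y)
      * indicator \<Omega> x * indicator \<Omega> y * indicator (?S \<times> ?S) (x, y)) \<partial>lborel) \<partial>lborel)"
  proof (rule nn_integral_mono)
    fix x
    have [measurable]: "ball_weight z2 t2 \<in> borel_measurable borel" using ball_weight(2)[OF t(2), of z2] by auto
    have "ennreal (ball_weight z1 t1 x) * (\<integral>\<^sup>+y. ennreal (ball_weight z2 t2 y) * ennreal (\<bar>u x - u y\<bar> powr p) \<partial>lborel)
      = (\<integral>\<^sup>+y. ennreal (ball_weight z1 t1 x) * (ennreal (ball_weight z2 t2 y) * ennreal (\<bar>u x - u y\<bar> powr p)) \<partial>lborel)"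
      by (rule nn_integral_cmult[symmetric]) measurable
    also have "\<dots> \<le> (\<integral>\<^sup>+y. ennreal (C / (V1 * V2)) * (ennreal (\<bar>u x - u y\<bar> powr p * ker x y)
      * indicator \<Omega> x * indicator \<Omega> y * indicator (?S \<times> ?S) (x, y)) \<partial>lborel)"
    proof (rule nn_integral_mono)
      fix y
      show "ennreal (ball_weight z1 t1 x) * (ennreal (ball_weight z2 t2 y) * ennreal (\<bar>u x - u y\<bar> powr p))
        \<le> ennreal (C / (V1 * V2)) * (ennreal (\<bar>u x - u y\<bar> powr p * ker x y)
      * indicator \<Omega> x * indicator \<Omega> y * indicator (?S \<times> ?S) (x, y))"
      proof (cases "x \<in> ball z1 t1 \<and> y \<in> ball z2 t2")
        case True
        then have xy: "x \<in> \<Omega>" "x \<in> ?S" "y \<in> \<Omega>" "y \<in> ?S" using sub by auto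
        have "ennreal (ball_weight z1 t1 x) * (ennreal (ball_weight z2 t2 y) * ennreal (\<bar>u x - u y\<bar> powr p))
          = ennreal (1 / (V1 * V2) * \<bar>u x - u y\<bar> powr p)"
          using True V0 by (simp add: ball_weight_def V1_def[symmetric] V2_def[symmetric] ennreal_mult[symmetric] del: mem_ball)
        also have "\<dots> \<le> ennreal (1 / (V1 * V2) * (C * (\<bar>u x - u y\<bar> powr p * ker x y)))"
          using V0 by (intro ennreal_leI mult_left_mono key xy) auto
        also have "\<dots> = ennreal (C / (V1 * V2)) * ennreal (\<bar>u x - u y\<bar> powr p * ker x y)"
          using V0 ker_nonneg by (subst ennreal_mult[symmetric]) (auto simp: C_def)
        finally show ?thesis using xy by simp
      next
        case False
        then have "ball_weight z1 t1 x = 0 \<or> ball_weight z2 t2 y = 0" by (auto simp: ball_weight_def)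
        then show ?thesis by auto
      qed
    qed
    finally show "ennreal (ball_weight z1 t1 x) * (\<integral>\<^sup>+y. ennreal (ball_weight z2 t2 y) * ennreal (\<bar>u x - u y\<bar> powr p) \<partial>lborel)
      \<le> (\<integral>\<^sup>+y. ennreal (C / (V1 * V2)) * (ennreal (\<bar>u x - u y\<bar> powr p * ker x y)
      * indicator \<Omega> x * indicator \<Omega> y * indicator (?S \<times> ?S) (x, y)) \<partial>lborel)" .
  qed
  also have "\<dots> = ennreal (C / (V1 * V2)) * enS u ?S"
  proof -
    have SS: "?S \<times> ?S \<in> sets (lborel \<Otimes>\<^sub>M lborel)" by (intro pair_measureI) auto
    have [measurable]: "(\<lambda>z. indicator (?S \<times> ?S) z :: ennreal) \<in> borel_measurable (lborel \<Otimes>\<^sub>M lborel)"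
      using SS by (rule borel_measurable_indicator)
    let ?G = "\<lambda>z. ennreal (\<bar>u (fst z) - u (snd z)\<bar> powr p * ker (fst z) (snd z)) * indicator \<Omega> (fst z) * indicator \<Omega> (snd z) * indicator (?S \<times> ?S) z"
    have [measurable]: "?G \<in> borel_measurable (lborel \<Otimes>\<^sub>M lborel)" by measurable
    have "(\<integral>\<^sup>+x. (\<integral>\<^sup>+y. ennreal (C / (V1 * V2)) * ?G (x, y) \<partial>lborel) \<partial>lborel) = (\<integral>\<^sup>+z. ennreal (C / (V1 * V2)) * ?G z \<partial>(lborel \<Otimes>\<^sub>M lborel))"
      by (rule lborel.nn_integral_fst) measurable
    also have "\<dots> = ennreal (C / (V1 * V2)) * enS u ?S"
      unfolding enS_def by (rule nn_integral_cmult) measurable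
    finally show ?thesis by simp
  qed
  also have "V1 * V2 = unit_ball_vol DIM('a) ^ 2 * t1 ^ DIM('a) * t2 ^ DIM('a)"
    by (simp add: V power2_eq_square)
  finally show ?thesis by (simp add: C_def)
qed

text \<open>Each of two opposite rays from a point of \<Omega> must leave the bounded set, which
  yields two distinct boundary points. Positivity guarantees admissible scales in the definition of
  the codimension.\<close>

lemma frontier_diameter_pos: "0 < diameter (frontier \<Omega>)"
proof -
  obtain x where x: "x \<in> \<Omega>" using nonempty by blast
  obtain b :: 'a where b: "b \<in> Basis" using nonempty_Basis by blast
  have ray: "\<exists>t>0. x + t *\<^sub>R v \<in> frontier \<Omega>" if v: "norm v = 1" for v
  proof -
    let ?S = "(\<lambda>t. x + t *\<^sub>R v) ` {0..}"
    have "connected ?S" by (intro connected_continuous_image continuous_intros) auto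
    moreover have "x \<in> ?S \<inter> \<Omega>" using x by (auto intro!: image_eqI[of _ _ 0])
    moreover have "\<not> ?S \<subseteq> \<Omega>"
    proof
      assume sub: "?S \<subseteq> \<Omega>"
      obtain e where e: "\<And>y. y \<in> \<Omega> \<Longrightarrow> dist x y \<le> e" using bounded bounded_any_center[of \<Omega> x] by auto
      have "x + (\<bar>e\<bar> + 1) *\<^sub>R v \<in> ?S" by (rule imageI) auto
      then have "dist x (x + (\<bar>e\<bar> + 1) *\<^sub>R v) \<le> e" using sub by (intro e) auto
      then show False using v by (simp add: dist_norm)
    qed
    ultimately have "?S \<inter> frontier \<Omega> \<noteq> {}" using connected_Int_frontier[of ?S \<Omega>] by blast
    then obtain t where t: "0 \<le> t" "x + t *\<^sub>R v \<in> frontier \<Omega>" by auto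
    moreover have "t \<noteq> 0" using t(2) x open_dom frontier_disjoint_eq[of \<Omega>] by auto
    ultimately show ?thesis by (intro exI[of _ t]) auto
  qed
  obtain t1 where t1: "0 < t1" "x + t1 *\<^sub>R b \<in> frontier \<Omega>" using ray[of b] b by auto
  obtain t2 where t2: "0 < t2" "x + t2 *\<^sub>R (- b) \<in> frontier \<Omega>" using ray[of "- b"] b by auto
  have "0 < dist (x + t1 *\<^sub>R b) (x + t2 *\<^sub>R (- b))"
  proof -
    have "(x + t1 *\<^sub>R b) - (x + t2 *\<^sub>R (- b)) = (t1 + t2) *\<^sub>R b" by (simp add: algebra_simps)
    then show ?thesis using t1 t2 b by (simp add: dist_norm)
  qed
  also have "\<dots> \<le> diameter (frontier \<Omega>)"
    using t1 t2 bounded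
    by (intro diameter_bounded_bound bounded_subset[OF bounded_closure[OF bounded]]) (auto simp: frontier_def)
  finally show ?thesis .
qed

lemma diameter_pos: "0 < diameter \<Omega>"
proof -
  obtain x where x: "x \<in> \<Omega>" using nonempty by blast
  obtain e where e: "0 < e" "ball x e \<subseteq> \<Omega>" using open_dom x openE by blast
  obtain b :: 'a where b: "b \<in> Basis" using nonempty_Basis by blast
  have "x + (e/2) *\<^sub>R b \<in> \<Omega>" using e b by (intro subsetD[OF e(2)]) (simp add: dist_norm)
  then have "dist x (x + (e/2) *\<^sub>R b) \<le> diameter \<Omega>" using x bounded by (intro diameter_bounded_bound) auto
  then show ?thesis using e b by (simp add: dist_norm)
qed

end

subsection \<open>Fat boundaries\<close>

text \<open>Otherwise the increments from \<open>k\<close> to \<open>K\<close> would sum to at most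
  1/4, while the total drop is at least 1/2; the factor \<open>(1 - \<rho>) / 4\<close> normalises
  the geometric series.\<close>

lemma ex_large_increment:
  fixes a :: "nat \<Rightarrow> real" and \<rho> :: real
  assumes \<rho>: "0 < \<rho>" "\<rho> < 1" and k: "k \<le> K" and a: "1 / 2 \<le> a k" "a K = 0"
  shows "\<exists>j. k \<le> j \<and> j < K \<and> (1 - \<rho>) / 4 * \<rho> ^ (j - k) \<le> \<bar>a j - a (Suc j)\<bar>"
proof (rule ccontr)
  assume "\<not> ?thesis"
  then have less: "\<bar>a j - a (Suc j)\<bar> < (1 - \<rho>) / 4 * \<rho> ^ (j - k)" if "k \<le> j" "j < K" for j
    using that not_le by blast
  have tel: "(\<Sum>i<n. a (k + i) - a (Suc (k + i))) = a k - a (k + n)" for n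
    by (induction n) auto
  define n where "n = K - k"
  have "1 / 2 \<le> a k - a (k + n)" using a k by (simp add: n_def)
  also have "\<dots> = (\<Sum>i<n. a (k + i) - a (Suc (k + i)))"
    by (rule tel[symmetric])
  also have "\<dots> \<le> (\<Sum>i<n. (1 - \<rho>) / 4 * \<rho> ^ i)"
  proof (rule sum_mono)
    fix i assume "i \<in> {..<n}"
    then have "\<bar>a (k + i) - a (Suc (k + i))\<bar> < (1 - \<rho>) / 4 * \<rho> ^ i"
      using less[of "k + i"] by (simp add: n_def)
    then show "a (k + i) - a (Suc (k + i)) \<le> (1 - \<rho>) / 4 * \<rho> ^ i" by linarith
  qed
  also have "\<dots> = (1 - \<rho>) / 4 * ((1 - \<rho> ^ n) / (1 - \<rho>))"
  proof -
    have "(\<Sum>i<n. \<rho> ^ i) = (1 - \<rho> ^ n) / (1 - \<rho>)" using \<rho> by (simp add: sum_gp_strict)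
    then show ?thesis by (simp only: sum_distrib_left[symmetric])
  qed
  also have "\<dots> = (1 - \<rho> ^ n) / 4"
  proof -
    have "c / 4 * (x / c) = x / 4" if "c \<noteq> 0" for c x :: real using that by simp
    then show ?thesis using \<rho> by (metis less_irrefl right_minus_eq)
  qed
  also have "\<dots> \<le> 1 / 4" using \<rho> by simp
  finally show False by simp
qed

lemma half_power_powr: "((1/2::real) ^ k) powr e = (2 powr - e) ^ k"
proof -
  have "((1/2::real) ^ k) powr e = 2 powr (- e * real k)"
    by (simp add: powr_minus_divide power_one_over powr_divide powr_powr powr_realpow[symmetric] mult.commute)
  also have "\<dots> = (2 powr - e) powr real k" by (simp only: powr_powr)
  finally show ?thesis by (simp add: powr_realpow)
qed

context wfrac
begin

text \<open>A lower dimension bound at the single ratio \<open>(1/2) ^ l\<close>: the count is at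
  least that ratio to the power \<open>- t\<close>. It is written in the form in which bounds at
  scale \<open>m + l\<close> add up to the one at scale \<open>m\<close>.\<close>

definition separated_at :: "nat \<Rightarrow> real \<Rightarrow> nat \<Rightarrow> bool" where
  "separated_at k0 t l \<longleftrightarrow> (\<forall>a\<in>frontier \<Omega>. \<forall>m\<ge>k0. \<exists>P. finite P \<and> 1 \<le> real (card P) * ((1/2) ^ l) powr t
     \<and> P \<subseteq> frontier \<Omega> \<inter> ball a ((1/2) ^ m / 2)
     \<and> (\<forall>x\<in>P. \<forall>y\<in>P. x \<noteq> y \<longrightarrow> 6 * (1/2) ^ (m + l) \<le> dist x y))"

text \<open>Volume counting: the codimension bounds the thickened boundary from below with exponent
  \<open>q\<close>, and each chosen point accounts for at most a ball of eight times the thickness.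
  This yields the wanted number of points up to a constant, and since \<open>t\<close> is strictly
  below the dimension minus \<open>q\<close>, a small ratio \<rho> absorbs the constant.\<close>

lemma ex_separated_at:
  assumes codim: "upper_assouad_codim (frontier \<Omega>) < ereal \<gamma>" and k0: "(1/2) ^ k0 < diameter (frontier \<Omega>)"
  shows "\<exists>q<\<gamma>. \<forall>t<real DIM('a) - q. \<exists>l\<ge>1. separated_at k0 t l"
proof -
  let ?d = "real DIM('a)" and ?E = "frontier \<Omega>"
  let ?v = "unit_ball_vol ?d"
  obtain q c where q: "q < \<gamma>" "0 \<le> q" and c: "0 < c" and
    low: "\<And>x r R. x \<in> ?E \<Longrightarrow> 0 < r \<Longrightarrow> r < R \<Longrightarrow> R < diameter ?E \<Longrightarrow>
        c * measure lebesgue (ball x R) * (r / R) powr q \<le> measure lebesgue (thickening ?E r \<inter> ball x R)"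
    using codim unfolding upper_assouad_codim_def Inf_less_iff by auto
  have "\<exists>l\<ge>1. separated_at k0 t l" if t: "t < ?d - q" for t
  proof -
    define g where "g = ?d - q - t"
    have g0: "0 < g" using t by (simp add: g_def)
    \<comment> \<open>The threshold for \<open>\<rho> powr g\<close>. The lower bound is used at
      radius \<open>R / 4\<close>, which accounts for \<open>4 powr q\<close> and a factor 4 in 32;
      the remaining 8 comes from the balls of radius \<open>8 * (\<rho> * R)\<close>.\<close>
    define b where "b = c * 4 powr q / 32 ^ DIM('a)"
    have b0: "0 < b" using c by (simp add: b_def)
    have "0 < b powr (1 / g)" using b0 by simp
    \<comment> \<open>\<open>3 \<le> l\<close> makes \<rho> at most 1/8, so points within
      \<open>R / 4 + \<rho> * R\<close> of \<open>a\<close> stay within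
      \<open>R / 2\<close>.\<close>
    then obtain l where l: "3 \<le> l" "(1/2) ^ l < b powr (1 / g)" using ex_power_half_less by blast
    define \<rho> where "\<rho> = (1/2::real) ^ l"
    have "\<rho> \<le> (1/2) ^ 3" unfolding \<rho>_def using l by (intro power_decreasing) auto
    moreover have "(1/2::real) ^ 3 = 1/8" by (simp add: power_divide)
    ultimately have \<rho>: "0 < \<rho>" "\<rho> \<le> 1/8" unfolding \<rho>_def by (simp, linarith)
    have "\<rho> powr g \<le> (b powr (1 / g)) powr g" using l g0 \<rho> by (intro powr_mono2) (auto simp: \<rho>_def)
    then have \<rho>g: "\<rho> powr g \<le> b" using b0 g0 by (simp add: powr_powr)
    \<comment> \<open>The ceiling serves both sides: \<open>n\<close> reaches the required count,
      while \<open>n - 1\<close>, which enters the volume comparison, is still below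
      \<open>\<rho> powr - t\<close>.\<close>
    define n where "n = nat \<lceil>\<rho> powr - t\<rceil>"
    have n1: "\<rho> powr - t \<le> real n" unfolding n_def by (rule real_nat_ceiling_ge)
    have n2: "real (n - 1) < \<rho> powr - t"
    proof (cases n)
      case 0 then show ?thesis using \<rho> by simp
    next
      case (Suc m)
      then have "real m < \<rho> powr - t" unfolding n_def by linarith
      then show ?thesis using Suc by simp
    qed
    have "separated_at k0 t l"
      unfolding separated_at_def
    proof (intro ballI allI impI)
      fix a m assume a: "a \<in> ?E" and m: "k0 \<le> m"
      define R where "R = (1/2::real) ^ m"
      have "R \<le> (1/2) ^ k0" unfolding R_def using m by (intro power_decreasing) auto
      then have R: "0 < R" "R < diameter ?E" using k0 by (simp add: R_def, linarith)
      have "real (n - 1) * (?v * (8 * (\<rho> * R)) ^ DIM('a)) < measure lebesgue (thickening ?E (\<rho> * R) \<inter> ball a (R / 4))"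
      proof -
        have "real (n - 1) * (?v * (8 * (\<rho> * R)) ^ DIM('a)) < \<rho> powr - t * (?v * (8 * (\<rho> * R)) ^ DIM('a))"
          using n2 \<rho> R by (intro mult_strict_right_mono) auto
        also have "\<dots> = \<rho> powr g * (?v * (8 * R) ^ DIM('a) * \<rho> powr q)"
        proof -
          have "\<rho> powr - t * \<rho> ^ DIM('a) = \<rho> powr - t * \<rho> powr ?d" using \<rho> by (simp add: powr_realpow)
          also have "\<dots> = \<rho> powr g * \<rho> powr q" by (simp flip: powr_add add: g_def)
          finally show ?thesis by (simp add: power_mult_distrib mult_ac)
        qed
        also have "\<dots> \<le> b * (?v * (8 * R) ^ DIM('a) * \<rho> powr q)"
          using \<rho>g R by (intro mult_right_mono) auto
        also have "\<dots> = c * (?v * (R / 4) ^ DIM('a)) * (4 * \<rho>) powr q"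
        proof -
          have "(32::real) ^ DIM('a) = 8 ^ DIM('a) * 4 ^ DIM('a)" by (simp flip: power_mult_distrib)
          then show ?thesis using \<rho> by (simp add: b_def power_mult_distrib power_divide powr_mult field_simps)
        qed
        also have "\<dots> = c * measure lebesgue (ball a (R / 4)) * ((\<rho> * R) / (R / 4)) powr q"
          using R \<rho> by (simp add: content_ball mult.commute)
        also have "\<dots> \<le> measure lebesgue (thickening ?E (\<rho> * R) \<inter> ball a (R / 4))"
          using R \<rho> by (intro low a) (auto simp: field_simps)
        finally show ?thesis .
      qed
      from ex_separated_points[OF frontier_closed frontier_nonempty _ this]
      obtain P where P: "finite P" "card P = n" "P \<subseteq> ?E \<inter> ball a (R / 4 + \<rho> * R)" "\<forall>x\<in>P. \<forall>y\<in>P. x \<noteq> y \<longrightarrow> 6 * (\<rho> * R) \<le> dist x y"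
        using \<rho> R by auto
      have "\<rho> powr - t * \<rho> powr t \<le> real n * \<rho> powr t" using n1 by (intro mult_right_mono) auto
      then have "1 \<le> real (card P) * \<rho> powr t" using \<rho> P by (simp add: powr_minus)
      moreover have "\<rho> * R \<le> 1/8 * R" using \<rho> R by (intro mult_right_mono) auto
      then have "ball a (R / 4 + \<rho> * R) \<subseteq> ball a (R / 2)" using R(1) by (intro subset_ball) linarith
      moreover have "\<rho> * R = (1/2) ^ (m + l)" by (simp add: \<rho>_def R_def power_add)
      ultimately show "\<exists>P. finite P \<and> 1 \<le> real (card P) * ((1/2) ^ l) powr t
       \<and> P \<subseteq> ?E \<inter> ball a ((1/2) ^ m / 2)
       \<and> (\<forall>x\<in>P. \<forall>y\<in>P. x \<noteq> y \<longrightarrow> 6 * (1/2) ^ (m + l) \<le> dist x y)"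
        using P unfolding R_def[symmetric] \<rho>_def[symmetric] by (intro exI[of _ P]) auto
    qed
    with l show ?thesis by (intro exI[of _ l]) auto
  qed
  with q show ?thesis by blast
qed

text \<open>Downward induction on the scale: either some point near \<open>a\<close> is good at a scale comparable
  with \<open>2 powr -m\<close>, or the estimate at the finer scale \<open>m + l\<close> is summed over separated points.\<close>

lemma enS_lower_bound:
  assumes sep: "separated_at k0 t l" and l: "1 \<le> l" and u: "u \<in> borel_measurable borel" and c: "0 \<le> c"
    and a: "a \<in> frontier \<Omega>" and m: "k0 \<le> m"
    and good: "\<And>x. x \<in> frontier \<Omega> \<inter> ball a ((1/2) ^ m) \<Longrightarrow>
      \<exists>j. m \<le> j \<and> j < K \<and> ennreal (c * ((1/2) ^ j) powr t) \<le> enS u (ball x (2 * (1/2) ^ j))"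
  shows "ennreal (c * min 1 (((1/2) ^ l) powr t) * ((1/2) ^ m) powr t) \<le> enS u (ball a (3 * (1/2) ^ m))"
  using a m good
proof (induction "K - m" arbitrary: a m rule: less_induct)
  case less
  let ?R = "(1/2::real) ^ m" and ?\<rho> = "(1/2::real) ^ l"
  let ?c = "c * min 1 (?\<rho> powr t)"
  have R: "0 < ?R" by simp
  \<comment> \<open>The hypothesis at \<open>a\<close> itself forces \<open>m < K\<close>, so
    \<open>K - m\<close> decreases; this takes the place of a base case.\<close>
  have mK: "m < K" using less.prems(3)[of a] less.prems(1) R by force
  have pl: "?\<rho> \<le> 1/2" using power_decreasing[OF l, of "1/2::real"] by simp
  show ?case
  proof (cases "\<exists>x\<in>frontier \<Omega> \<inter> ball a ?R. \<exists>j. m \<le> j \<and> j < m + l \<and> ennreal (c * ((1/2) ^ j) powr t) \<le> enS u (ball x (2 * (1/2) ^ j))")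
    case True
    then obtain x j where x: "x \<in> ball a ?R" and j: "m \<le> j" "j < m + l" "ennreal (c * ((1/2) ^ j) powr t) \<le> enS u (ball x (2 * (1/2) ^ j))" by blast
    have "(1/2::real) ^ j = (1/2) ^ (j - m) * ?R" using j by (simp flip: power_add)
    then have "((1/2::real) ^ j) powr t = ((1/2) ^ (j - m)) powr t * ?R powr t" by (simp add: powr_mult)
    \<comment> \<open>The sign of \<open>t\<close> is not known: for nonnegative \<open>t\<close>
      the power is smallest at the ratio \<rho>, for negative \<open>t\<close> it is at least
      1.\<close>
    moreover have "min 1 (?\<rho> powr t) \<le> ((1/2) ^ (j - m)) powr t"
    proof (cases "0 \<le> t")
      case True
      have "?\<rho> \<le> (1/2) ^ (j - m)" using j by (intro power_decreasing) auto
      then have "?\<rho> powr t \<le> ((1/2) ^ (j - m)) powr t" using True by (intro powr_mono2) auto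
      then show ?thesis by simp
    next
      case False
      have "((1/2::real) ^ (j - m)) powr 0 \<le> ((1/2) ^ (j - m)) powr t" using False by (intro powr_mono') (auto simp: power_le_one)
      then show ?thesis by simp
    qed
    ultimately have "?c * ?R powr t \<le> c * ((1/2) ^ j) powr t"
      using c by (simp add: mult.assoc mult_left_mono mult_right_mono)
    then have "ennreal (?c * ?R powr t) \<le> ennreal (c * ((1/2) ^ j) powr t)" by (rule ennreal_leI)
    also note j(3)
    also have "enS u (ball x (2 * (1/2) ^ j)) \<le> enS u (ball a (3 * ?R))"
    proof (rule enS_mono)
      have "(1/2::real) ^ j \<le> ?R" using j by (intro power_decreasing) auto
      then show "ball x (2 * (1/2) ^ j) \<subseteq> ball a (3 * ?R)"
        using x unfolding ball_subset_ball_iff mem_ball dist_commute[of x a] by linarith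
    qed
    finally show ?thesis .
  next
    case False
    let ?r = "(1/2::real) ^ (m + l)"
    have r: "?r = ?\<rho> * ?R" by (simp add: power_add)
    have r2: "?r \<le> ?R / 2" using mult_right_mono[OF pl, of ?R] by (simp add: r)
    obtain P where P: "finite P" "1 \<le> real (card P) * ?\<rho> powr t" "P \<subseteq> frontier \<Omega> \<inter> ball a (?R / 2)"
      and far: "\<And>x y. x \<in> P \<Longrightarrow> y \<in> P \<Longrightarrow> x \<noteq> y \<Longrightarrow> 6 * ?r \<le> dist x y"
      using sep less.prems(1,2) unfolding separated_at_def by meson
    have IH: "ennreal (?c * ?r powr t) \<le> enS u (ball x (3 * ?r))" if x: "x \<in> P" for x
    proof (rule less.hyps)
      show "K - (m + l) < K - m" using mK l by simp
      show "x \<in> frontier \<Omega>" using x P by auto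
      show "k0 \<le> m + l" using less.prems(2) by simp
      fix y assume y: "y \<in> frontier \<Omega> \<inter> ball x ?r"
      have "dist a y < ?R" using y x P(3) r2 dist_triangle[of a y x] by fastforce
      then obtain j where j: "m \<le> j" "j < K" "ennreal (c * ((1/2) ^ j) powr t) \<le> enS u (ball y (2 * (1/2) ^ j))"
        using less.prems(3)[of y] y by auto
      \<comment> \<open>A coarser scale would make \<open>y\<close> a witness for the first case,
        since \<open>y\<close> is still within \<open>(1/2) ^ m\<close> of \<open>a\<close>.\<close>
      have "m + l \<le> j"
      proof (rule ccontr)
        assume "\<not> m + l \<le> j"
        then have "j < m + l" by simp
        moreover have "y \<in> frontier \<Omega> \<inter> ball a ?R" using y \<open>dist a y < ?R\<close> by simp
        ultimately show False using False j by blast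
      qed
      then show "\<exists>j\<ge>m + l. j < K \<and> ennreal (c * ((1/2) ^ j) powr t) \<le> enS u (ball y (2 * (1/2) ^ j))" using j by blast
    qed
    have c0: "0 \<le> ?c" using c by simp
    \<comment> \<open>The number of points compensates the passage from scale \<open>m\<close> to
      \<open>m + l\<close>, so the constant does not deteriorate along the induction.\<close>
    have "?c * ?R powr t * 1 \<le> ?c * ?R powr t * (real (card P) * ?\<rho> powr t)"
      using P(2) c0 by (intro mult_left_mono) auto
    also have "\<dots> = real (card P) * (?c * ?r powr t)" by (simp add: r powr_mult)
    finally have "ennreal (?c * ?R powr t) \<le> ennreal (real (card P) * (?c * ?r powr t))" by (intro ennreal_leI) simp
    also have "\<dots> = (\<Sum>x\<in>P. ennreal (?c * ?r powr t))" using c0 by (simp add: ennreal_mult ennreal_of_nat_eq_real_of_nat)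
    also have "\<dots> \<le> (\<Sum>x\<in>P. enS u (ball x (3 * ?r)))" using IH by (intro sum_mono)
    also have "\<dots> \<le> enS u (ball a (3 * ?R))"
    proof (rule sum_enS_le[OF P(1) u])
      show "ball x (3 * ?r) \<subseteq> ball a (3 * ?R)" if "x \<in> P" for x
        using that P(3) r2 R unfolding ball_subset_ball_iff by (force simp: dist_commute)
      show "ball x (3 * ?r) \<inter> ball y (3 * ?r) = {}" if "x \<in> P" "y \<in> P" "x \<noteq> y" for x y
        using far[OF that] by (intro disjoint_ballI) simp
    qed simp
    finally show ?thesis .
  qed
qed

lemma en_one: "en (\<lambda>x. 1) = 0"
  unfolding en_def using p_ge by simp

text \<open>All constants up to \<theta> and \<eta> are fixed before the test function appears. Of
  the scales only the final one, \<open>K\<close>, depends on it, and the lower bound does not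
  involve \<open>K\<close>.\<close>

lemma W0_neq_W_plump:
  assumes plump: "plump \<kappa> \<Omega>" and codim: "upper_assouad_codim (frontier \<Omega>) < ereal gam"
  shows "W0_space s p \<alpha> \<beta> \<Omega> \<noteq> W_space s p \<alpha> \<beta> \<Omega>"
proof
  assume eq: "W0_space s p \<alpha> \<beta> \<Omega> = W_space s p \<alpha> \<beta> \<Omega>"
  let ?d = "real DIM('a)" and ?E = "frontier \<Omega>"
  let ?v = "unit_ball_vol ?d"
  have \<kappa>: "0 < \<kappa>" "\<kappa> < 1" using plump by (auto simp: plump_def)
  have "0 < min (diameter ?E) (diameter \<Omega>)" using frontier_diameter_pos diameter_pos by simp
  then obtain k0 where k0: "(1/2) ^ k0 < diameter ?E" "(1/2) ^ k0 < diameter \<Omega>"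
    using ex_power_half_less[of "min (diameter ?E) (diameter \<Omega>)" 0] by auto
  obtain q where q: "q < gam" and sepq: "\<And>t. t < ?d - q \<Longrightarrow> \<exists>l\<ge>1. separated_at k0 t l"
    using ex_separated_at[OF codim k0(1)] by blast
  \<comment> \<open>Half of the gap between \<open>q\<close> and \<open>gam\<close>, divided by
    \<open>p\<close> because the jump enters with its p-th power.\<close>
  define \<epsilon> where "\<epsilon> = (gam - q) / (2 * p)"
  have \<epsilon>: "0 < \<epsilon>" using q p_ge by (simp add: \<epsilon>_def)
  \<comment> \<open>The kernel at scale \<open>r\<close> contributes the exponent
    \<open>?d - gam\<close>, and the decaying jump adds \<open>\<epsilon> * p\<close>.\<close>
  define t where "t = ?d - gam + \<epsilon> * p"
  have "\<epsilon> * p = (gam - q) / 2" using p_ge by (simp add: \<epsilon>_def)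
  then have "t < ?d - q" using q by (simp add: t_def)
  then obtain l where l: "1 \<le> l" "separated_at k0 t l" using sepq by blast
  have "\<exists>z. dist a z \<le> (1/2) ^ j \<and> ball z (\<kappa> * (1/2) ^ j) \<subseteq> \<Omega>" if "a \<in> ?E" "k0 \<le> j" for a j
  proof -
    have "(1/2::real) ^ j \<le> (1/2) ^ k0" using that by (intro power_decreasing) auto
    then have "(1/2) ^ j < diameter \<Omega>" using k0(2) by linarith
    moreover have "a \<in> closure \<Omega>" using that by (simp add: frontier_def)
    moreover have "0 < (1/2::real) ^ j" by simp
    ultimately obtain z where "z \<in> cball a ((1/2) ^ j)" "ball z (\<kappa> * (1/2) ^ j) \<subseteq> \<Omega>"
      using plump unfolding plump_def by blast
    then show ?thesis by auto
  qed
  then obtain z where z: "\<And>a j. a \<in> ?E \<Longrightarrow> k0 \<le> j \<Longrightarrow> dist a (z a j) \<le> (1/2) ^ j"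
    "\<And>a j. a \<in> ?E \<Longrightarrow> k0 \<le> j \<Longrightarrow> ball (z a j) (\<kappa> * (1/2) ^ j) \<subseteq> \<Omega>" by metis
  have zsub: "ball (z a j) (\<kappa> * (1/2) ^ j) \<subseteq> ball a (2 * (1/2) ^ j)" if "a \<in> ?E" "k0 \<le> j" for a j
  proof -
    have "\<kappa> * (1/2) ^ j \<le> 1 * (1/2) ^ j" using \<kappa> by (intro mult_right_mono) auto
    then show ?thesis using z(1)[OF that] unfolding ball_subset_ball_iff dist_commute[of _ a] by linarith
  qed
  define \<rho> where "\<rho> = 2 powr - \<epsilon>"
  have \<rho>: "0 < \<rho>" "\<rho> < 1" using \<epsilon> powr_less_mono[of "- \<epsilon>" 0 "2::real"] by (auto simp: \<rho>_def)
  \<comment> \<open>The constant of \<open>average_diff_le_enS\<close> with the powers of the scale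
    removed; \<open>2 ^ DIM('a)\<close> comes from the second ball, whose radius is halved.\<close>
  define C where "C = 4 powr (?d + s * p) * 2 powr \<alpha> * 2 powr \<beta> * 2 ^ DIM('a) / (?v ^ 2 * \<kappa> ^ (2 * DIM('a)))"
  have v0: "0 < ?v" by simp
  have C0: "0 < C" unfolding C_def using \<kappa> v0 by (intro divide_pos_pos mult_pos_pos zero_less_power) auto
  define c where "c = ((1 - \<rho>) / 4) powr p / C"
  have c0: "0 < c" using C0 \<rho> by (simp add: c_def)
  define \<theta> where "\<theta> = c * min 1 (((1/2) ^ l) powr t) * ((1/2) ^ k0) powr t"
  have \<theta>: "0 < \<theta>" using c0 by (simp add: \<theta>_def)
  define V where "V = ?v * (\<kappa> * (1/2) ^ k0) ^ DIM('a)"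
  have V: "0 < V" using v0 \<kappa> by (simp add: V_def)
  \<comment> \<open>The first bound keeps the average at scale \<open>k0\<close> within 1/2 of 1,
    the second keeps the energy below \<theta>.\<close>
  define \<eta> where "\<eta> = min (V powr (1/p) / 2) ((\<theta> / 2) powr (1/p))"
  have \<eta>: "0 < \<eta>" using V \<theta> by (simp add: \<eta>_def)
  have \<eta>p: "\<eta> powr p \<le> V * (1/2) powr p" "\<eta> powr p < \<theta>"
  proof -
    have "\<eta> powr p \<le> (V powr (1/p) * (1/2)) powr p" using \<eta> p_ge by (intro powr_mono2) (auto simp: \<eta>_def)
    also have "\<dots> = V * (1/2) powr p" using V p_ge by (subst powr_mult) (simp add: powr_powr)
    finally show "\<eta> powr p \<le> V * (1/2) powr p" .
    have "\<eta> powr p \<le> ((\<theta> / 2) powr (1/p)) powr p" using \<eta> p_ge by (intro powr_mono2) (auto simp: \<eta>_def)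
    also have "\<dots> = \<theta> / 2" using \<theta> p_ge by (simp add: powr_powr)
    finally show "\<eta> powr p < \<theta>" using \<theta> by simp
  qed
  have "lp (\<lambda>x. 1) < \<infinity>"
    using emeasure_bounded_finite[OF bounded] open_dom by (simp add: lp_def)
  then have "(\<lambda>x. 1) \<in> W_space s p \<alpha> \<beta> \<Omega>"
    using W_space_iff[of "\<lambda>x. 1" "\<lambda>x. 1"] by (simp add: en_one)
  then have "(\<lambda>x. 1) \<in> W0_space s p \<alpha> \<beta> \<Omega>" by (simp only: eq)
  then have "\<exists>\<phi>\<in>Cc_smooth \<Omega> \<inter> W_space s p \<alpha> \<beta> \<Omega>. W_norm s p \<alpha> \<beta> \<Omega> (\<lambda>x. 1 - \<phi> x) < ennreal \<eta>"
    using \<eta> unfolding W0_space_def by simp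
  then obtain \<phi> where \<phi>: "\<phi> \<in> Cc_smooth \<Omega>" and small: "W_norm s p \<alpha> \<beta> \<Omega> (\<lambda>x. 1 - \<phi> x) < ennreal \<eta>"
    by (auto simp only: Int_iff)
  have \<phi>m[measurable]: "\<phi> \<in> borel_measurable borel" by (rule Cc_smooth_measurable[OF \<phi>])
  have "W_norm s p \<alpha> \<beta> \<Omega> (\<lambda>x. 1 - \<phi> x) = ennroot p (lp (\<lambda>x. 1 - \<phi> x)) + ennroot p (en (\<lambda>x. 1 - \<phi> x))"
    by (rule W_norm_diff) auto
  then have "ennroot p (lp (\<lambda>x. 1 - \<phi> x)) < ennreal \<eta>" "ennroot p (en (\<lambda>x. 1 - \<phi> x)) < ennreal \<eta>"
    using small by (auto intro: le_less_trans[OF _ small] simp: add_increasing add_increasing2)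
  then have lpe: "lp (\<lambda>x. 1 - \<phi> x) \<le> ennreal (\<eta> powr p)" and ene: "en (\<lambda>x. 1 - \<phi> x) \<le> ennreal (\<eta> powr p)"
    using \<eta> p_ge by (auto intro: ennroot_le_imp)
  have "en (\<lambda>x. 1 - \<phi> x) = en \<phi>"
    unfolding en_def by (simp add: abs_minus_commute)
  with ene have en\<phi>: "en \<phi> \<le> ennreal (\<eta> powr p)" by simp
  obtain M where M: "\<And>x. \<bar>\<phi> x\<bar> \<le> M"
  proof -
    have c: "continuous_on UNIV \<phi>" using \<phi> unfolding Cc_smooth_def by (metis (mono_tags, lifting) Ck.simps(1) mem_Collect_eq)
    obtain R where R: "\<And>x. x \<in> \<Omega> \<Longrightarrow> norm x \<le> R" using bounded bounded_iff by blast
    have "\<phi> x = 0" if "R < norm x" for x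
      using R[of x] that \<phi> closure_subset[of "{x. \<phi> x \<noteq> 0}"] unfolding Cc_smooth_def by force
    with continuous_compact_support_bounded[OF c] that show ?thesis by metis
  qed
  obtain \<delta> where \<delta>: "0 < \<delta>" "\<And>x. \<phi> x \<noteq> 0 \<Longrightarrow> \<delta> \<le> dw x"
  proof (cases "{x. \<phi> x \<noteq> 0} = {}")
    case True then show ?thesis using that[of 1] by auto
  next
    case False
    let ?K = "closure {x. \<phi> x \<noteq> 0}"
    have K: "compact ?K" "?K \<subseteq> \<Omega>" using \<phi> by (auto simp: Cc_smooth_def)
    have "?K \<noteq> {}" using False by simp
    moreover have "continuous_on ?K dw" unfolding bdist_def by (intro continuous_intros)
    ultimately obtain x0 where x0: "x0 \<in> ?K" "\<And>y. y \<in> ?K \<Longrightarrow> dw x0 \<le> dw y"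
      using continuous_attains_inf[OF K(1)] by blast
    show ?thesis
    proof (rule that[of "dw x0"])
      show "0 < dw x0" using x0 K dw_pos by blast
      show "dw x0 \<le> dw x" if "\<phi> x \<noteq> 0" for x
        using x0(2)[of x] closure_subset[of "{x. \<phi> x \<noteq> 0}"] that by auto
    qed
  qed
  \<comment> \<open>At scale \<open>K\<close> the interior ball lies within
    \<open>2 * (1/2) ^ K\<close>, hence within \<delta>, of a boundary point, where the test
    function vanishes.\<close>
  obtain K where K: "k0 \<le> K" "(1/2) ^ K < \<delta> / 2" using ex_power_half_less[of "\<delta> / 2" k0] \<delta> by auto
  define av where "av a j = (\<integral>x. ball_weight (z a j) (\<kappa> * (1/2) ^ j) x * \<phi> x \<partial>lborel)" for a j
  have \<kappa>j: "0 < \<kappa> * (1/2) ^ j" for j using \<kappa> by simp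
  have avK: "av a K = 0" if a: "a \<in> ?E" for a
  proof -
    have "ball_weight (z a K) (\<kappa> * (1/2) ^ K) x * \<phi> x = 0" for x
    proof (cases "x \<in> ball (z a K) (\<kappa> * (1/2) ^ K)")
      case True
      then have "dist a x < 2 * (1/2) ^ K" using zsub[OF a K(1)] by auto
      then have "dw x < \<delta>" using infdist_le[OF a, of x] K(2) by (simp add: bdist_def dist_commute)
      then show ?thesis using \<delta>(2)[of x] by auto
    qed (simp add: ball_weight_def)
    then have "av a K = (\<integral>x. 0 \<partial>(lborel :: 'a measure))"
      unfolding av_def by (intro Bochner_Integration.integral_cong refl)
    then show ?thesis by simp
  qed
  have av0: "1 / 2 \<le> av a k0" if a: "a \<in> ?E" for a
  proof -
    let ?w = "ball_weight (z a k0) (\<kappa> * (1/2) ^ k0)"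
    note w = ball_weight[OF \<kappa>j, of "z a k0" k0]
    have wm[measurable]: "?w \<in> borel_measurable borel" using w(2) by auto
    have bd: "\<bar>1 - \<phi> x\<bar> \<le> 1 + M" for x using M[of x] by linarith
    have "integrable lborel (\<lambda>x. ?w x * \<phi> x)"
      by (rule integrable_mult_bounded[OF w(2) _ M]) measurable
    then have "1 - av a k0 = (\<integral>x. ?w x * (1 - \<phi> x) \<partial>lborel)"
      using w by (simp add: av_def right_diff_distrib)
    then have "ennreal (\<bar>1 - av a k0\<bar> powr p) \<le> (\<integral>\<^sup>+x. ennreal (?w x) * ennreal (\<bar>1 - \<phi> x\<bar> powr p) \<partial>lborel)"
      using jensen_powr[of p ?w lborel "\<lambda>x. 1 - \<phi> x" "1 + M", OF p_ge w(1,2,3) _ bd] by simp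
    also have "\<dots> \<le> (\<integral>\<^sup>+x. ennreal (1 / V) * (ennreal (\<bar>1 - \<phi> x\<bar> powr p) * indicator \<Omega> x) \<partial>lborel)"
    proof (rule nn_integral_mono)
      fix x
      show "ennreal (?w x) * ennreal (\<bar>1 - \<phi> x\<bar> powr p) \<le> ennreal (1 / V) * (ennreal (\<bar>1 - \<phi> x\<bar> powr p) * indicator \<Omega> x)"
      proof (cases "x \<in> ball (z a k0) (\<kappa> * (1/2) ^ k0)")
        case True
        then have "x \<in> \<Omega>" using z(2)[OF a order_refl] by auto
        moreover have "?w x = 1 / V" using True \<kappa>j[of k0] by (simp add: ball_weight_def content_ball V_def del: mem_ball)
        ultimately show ?thesis by simp
      qed (simp add: ball_weight_def)
    qed
    also have "\<dots> = ennreal (1 / V) * lp (\<lambda>x. 1 - \<phi> x)"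
      unfolding lp_def by (rule nn_integral_cmult) measurable
    also have "\<dots> \<le> ennreal (1 / V) * ennreal (\<eta> powr p)" by (intro mult_left_mono lpe) auto
    also have "\<dots> = ennreal (1 / V * \<eta> powr p)" using V by (intro ennreal_mult[symmetric]) auto
    finally have "\<bar>1 - av a k0\<bar> powr p \<le> 1 / V * \<eta> powr p" using V by (simp add: ennreal_le_iff)
    also have "\<dots> \<le> 1 / V * (V * (1/2) powr p)" using \<eta>p V by (intro mult_left_mono) auto
    also have "\<dots> = (1/2) powr p" using V by simp
    finally have "\<bar>1 - av a k0\<bar> powr p \<le> (1/2) powr p" .
    then have "\<bar>1 - av a k0\<bar> \<le> 1/2"
      using powr_less_mono2[of p "1/2" "\<bar>1 - av a k0\<bar>"] p_ge by (force simp: not_le[symmetric])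
    then show ?thesis by linarith
  qed
  have good: "\<exists>j. k0 \<le> j \<and> j < K \<and> ennreal (c * ((1/2) ^ j) powr t) \<le> enS \<phi> (ball x (2 * (1/2) ^ j))" if x: "x \<in> ?E" for x
  proof -
    obtain j where j: "k0 \<le> j" "j < K" "(1 - \<rho>) / 4 * \<rho> ^ (j - k0) \<le> \<bar>av x j - av x (Suc j)\<bar>"
      using ex_large_increment[OF \<rho> K(1), of "av x"] av0[OF x] avK[OF x] by blast
    let ?r = "(1/2::real) ^ j"
    have r: "0 < ?r" by simp
    have half: "(1/2) ^ Suc j = ?r / 2" by simp
    have sub: "ball (z x j) (\<kappa> * ?r) \<subseteq> \<Omega> \<inter> ball x (2 * ?r)" "ball (z x (Suc j)) (\<kappa> * (1/2) ^ Suc j) \<subseteq> \<Omega> \<inter> ball x (2 * ?r)"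
      using z(2)[OF x j(1)] zsub[OF x j(1)] z(2)[OF x, of "Suc j"] zsub[OF x, of "Suc j"] j(1) subset_ball[of "2 * (1/2) ^ Suc j" "2 * ?r" x]
      by auto
    let ?F = "(4 * ?r) powr (?d + s * p) * (2 * ?r) powr \<alpha> * (2 * ?r) powr \<beta> / (?v ^ 2 * (\<kappa> * ?r) ^ DIM('a) * (\<kappa> * (1/2) ^ Suc j) ^ DIM('a))"
    have F: "?F = C * ?r powr (gam - ?d)"
    proof -
      have e1: "(4 * ?r) powr (?d + s * p) * (2 * ?r) powr \<alpha> * (2 * ?r) powr \<beta> = 4 powr (?d + s * p) * 2 powr \<alpha> * 2 powr \<beta> * ?r powr (gam + ?d)"
        by (simp add: powr_mult gam_def powr_add)
      have e2: "?v ^ 2 * (\<kappa> * ?r) ^ DIM('a) * (\<kappa> * (1/2) ^ Suc j) ^ DIM('a) = ?v ^ 2 * \<kappa> ^ (2 * DIM('a)) / 2 ^ DIM('a) * (?r ^ DIM('a) * ?r ^ DIM('a))"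
        unfolding half by (simp add: power_mult_distrib power_divide power_mult power2_eq_square mult_ac)
      have e3: "?r powr (gam + ?d) / (?r ^ DIM('a) * ?r ^ DIM('a)) = ?r powr (gam - ?d)"
      proof -
        have "?r ^ DIM('a) * ?r ^ DIM('a) = ?r powr (?d + ?d)" unfolding powr_add using r by (simp add: powr_realpow)
        then show ?thesis by (simp add: powr_diff[symmetric])
      qed
      have "?F = (4 powr (?d + s * p) * 2 powr \<alpha> * 2 powr \<beta> * 2 ^ DIM('a) / (?v ^ 2 * \<kappa> ^ (2 * DIM('a)))) * (?r powr (gam + ?d) / (?r ^ DIM('a) * ?r ^ DIM('a)))"
        unfolding e1 e2 by simp
      then show ?thesis unfolding e3 C_def .
    qed
    have "((1 - \<rho>) / 4 * \<rho> ^ (j - k0)) powr p \<le> \<bar>av x j - av x (Suc j)\<bar> powr p"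
      using j(3) \<rho> p_ge by (intro powr_mono2) auto
    then have "ennreal (((1 - \<rho>) / 4 * \<rho> ^ (j - k0)) powr p) \<le> ennreal (\<bar>av x j - av x (Suc j)\<bar> powr p)" by (rule ennreal_leI)
    also have "\<dots> \<le> ennreal ?F * enS \<phi> (ball x (2 * ?r))"
      unfolding av_def by (rule average_diff_le_enS[OF x r \<phi>m M \<kappa>j \<kappa>j sub])
    finally have main: "ennreal (((1 - \<rho>) / 4 * \<rho> ^ (j - k0)) powr p) \<le> ennreal (C * ?r powr (gam - ?d)) * enS \<phi> (ball x (2 * ?r))"
      unfolding F .
    have "c * ?r powr t \<le> 1 / (C * ?r powr (gam - ?d)) * ((1 - \<rho>) / 4 * \<rho> ^ (j - k0)) powr p"
    proof -
      \<comment> \<open>Dropping the offset \<open>k0\<close> only weakens the bound and turns the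
        jump into a pure power of the scale.\<close>
      have "\<rho> ^ j \<le> \<rho> ^ (j - k0)" using \<rho> by (intro power_decreasing) auto
      moreover have "\<rho> ^ j = ?r powr \<epsilon>" by (simp add: half_power_powr \<rho>_def)
      ultimately have "(?r powr \<epsilon>) powr p \<le> (\<rho> ^ (j - k0)) powr p" using p_ge by (intro powr_mono2) auto
      then have "((1 - \<rho>) / 4) powr p / C * (?r powr - (gam - ?d) * (?r powr \<epsilon>) powr p) \<le> ((1 - \<rho>) / 4) powr p / C * (?r powr - (gam - ?d) * (\<rho> ^ (j - k0)) powr p)"
        using C0 by (intro mult_left_mono) auto
      moreover have "?r powr - (gam - ?d) * (?r powr \<epsilon>) powr p = ?r powr t"
        by (simp add: powr_powr t_def flip: powr_add)
      moreover have "((1 - \<rho>) / 4) powr p / C * (?r powr - (gam - ?d) * (\<rho> ^ (j - k0)) powr p) = 1 / (C * ?r powr (gam - ?d)) * ((1 - \<rho>) / 4 * \<rho> ^ (j - k0)) powr p"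
        by (subst powr_mult, subst powr_minus_divide) simp
      ultimately show ?thesis by (simp add: c_def)
    qed
    then have "ennreal (c * ?r powr t) \<le> ennreal (1 / (C * ?r powr (gam - ?d)) * ((1 - \<rho>) / 4 * \<rho> ^ (j - k0)) powr p)" by (rule ennreal_leI)
    also have "\<dots> = ennreal (1 / (C * ?r powr (gam - ?d))) * ennreal (((1 - \<rho>) / 4 * \<rho> ^ (j - k0)) powr p)"
      using C0 by (intro ennreal_mult) auto
    also have "\<dots> \<le> ennreal (1 / (C * ?r powr (gam - ?d))) * (ennreal (C * ?r powr (gam - ?d)) * enS \<phi> (ball x (2 * ?r)))"
      by (intro mult_left_mono main) auto
    also have "\<dots> = enS \<phi> (ball x (2 * ?r))"
      using C0 r by (simp add: mult.assoc[symmetric] ennreal_mult[symmetric] del: ennreal_mult)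
    finally show ?thesis using j by blast
  qed
  obtain a where a: "a \<in> ?E" using frontier_nonempty by blast
  have "ennreal \<theta> \<le> enS \<phi> (ball a (3 * (1/2) ^ k0))"
    unfolding \<theta>_def using good c0 by (intro enS_lower_bound[OF l(2,1) \<phi>m _ a order_refl, of _ K]) auto
  also have "\<dots> \<le> en \<phi>" by (rule enS_le_en)
  also note en\<phi>
  also have "ennreal (\<eta> powr p) < ennreal \<theta>" using \<eta>p \<theta> by (intro ennreal_lessI) auto
  finally show False by simp
qed

end

theorem theorem3:
  fixes \<Omega> :: "'a::euclidean_space set" and s p \<alpha> \<beta> :: real
  assumes "\<Omega> \<noteq> {}" and "bounded \<Omega>" and "open \<Omega>"
    and "0 < s" and "s < 1" and "1 \<le> p" and "0 \<le> \<alpha>" and "0 \<le> \<beta>"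
  shows "(ereal (s * p + \<alpha> + \<beta>) < ereal (real DIM('a)) - upper_minkowski_dim (frontier \<Omega>)
            \<longrightarrow> W0_space s p \<alpha> \<beta> \<Omega> = W_space s p \<alpha> \<beta> \<Omega>)
       \<and> (homogeneous (real DIM('a) - s * p - \<alpha> - \<beta>) (frontier \<Omega>) \<and> 1 < p
            \<and> ereal (s * p + \<alpha> + \<beta>) = lower_assouad_codim (frontier \<Omega>)
            \<longrightarrow> W0_space s p \<alpha> \<beta> \<Omega> = W_space s p \<alpha> \<beta> \<Omega>)
       \<and> ((\<exists>\<kappa>. plump \<kappa> \<Omega>) \<and> ereal (s * p + \<alpha> + \<beta>) > upper_assouad_codim (frontier \<Omega>)
            \<longrightarrow> W0_space s p \<alpha> \<beta> \<Omega> \<noteq> W_space s p \<alpha> \<beta> \<Omega>)"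
proof -
  interpret wfrac \<Omega> s p \<alpha> \<beta> using assms by unfold_locales
  have g: "gam = s * p + \<alpha> + \<beta>" by (simp add: gam_def)
  have "real DIM('a) - s * p - \<alpha> - \<beta> = real DIM('a) - gam" by (simp add: g)
  then show ?thesis
    using W0_eq_W_minkowski[unfolded g] W0_eq_W_homogeneous W0_neq_W_plump[unfolded g] by metis
qed

end
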